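(* Let $S$ be a string of length $N$ compressed into a Straight Line Program (SLP) $G$ of size $n$. One can construct data structures that support $\textsc{Fingerprint}$ queries in: (i) $O(n)$ space and query time $O(\log N)$; (ii) $O(n)$ space and query time $O(\log\log N)$ if $G$ is a Linear SLP.
   Context: Model of computation: word RAM with word size $\log N$ bits. $S[i]$ is the $i$-th character of $S$ and $S[i,j]$ the substring from position $i$ to $j$ inclusive. An SLP is a context-free grammar in Chomsky normal form producing exactly one string, represented as an ordered node-labelled DAG: each leaf is labelled by a character (a terminal rule), each internal node (a nonterminal rule) has exactly two ordered children $\mathit{left}(v),\mathit{right}(v)$, and the string $S(v)$ produced by a node $v$ is the sequence of leaf labels met in a left-to-right depth-first traversal from $v$; the root produces $S$. The size $n$ is the number of nodes (rules). A Linear SLP is an SLP in which the root may have more than two (ordered) children, and every other internal node $v$ has a leaf as $\mathit{right}(v)$. The Karp–Rabin fingerprint of a string $x$ is $\phi(x)=\sum_{i=1}^{|x|} x[i]\cdot c^i \bmod p$, where $c$ is a randomly chosen positive integer and $p$ is a prime with $2N^{c+4}\le p\le 4N^{c+4}$. A query $\textsc{Fingerprint}(i,j)$, for $1\le i\le j\le N$, must return $\phi(S[i,j])$.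
   Formalization: In (ii), the size n of a Linear SLP counts a root with k > 2 children as k-1 rules, since counting it as one node makes the claim false (arbitrary root sequences over two leaves); words have O(log N) bits for each fixed c, so that a fingerprint fits in O(1) words. *)

theory Defs
  imports
    Complex_Main
    "HOL-Computational_Algebra.Primes"
    "HOL-Library.Landau_Symbols"
begin

section \<open>Straight line programs\<close>

text \<open>Characters are natural numbers, since a fingerprint does arithmetic on them.\<close>

datatype rule = Terminal nat | Nonterminal "nat list"

primrec children :: "rule \<Rightarrow> nat list" where
  "children (Terminal a) = []"
| "children (Nonterminal us) = us"

record grammar =
  nodes :: "nat set"
  root :: nat
  rule_of :: "nat \<Rightarrow> rule"

definition dag :: "grammar \<Rightarrow> bool" where
  "dag G \<longleftrightarrow> finite (nodes G) \<and> root G \<in> nodes G \<and>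
     (\<forall>v\<in>nodes G. set (children (rule_of G v)) \<subseteq> nodes G) \<and>
     acyclic {(v, u). v \<in> nodes G \<and> u \<in> set (children (rule_of G v))}"

definition slp :: "grammar \<Rightarrow> bool" where
  "slp G \<longleftrightarrow> dag G \<and>
     (\<forall>v\<in>nodes G. (\<exists>a. rule_of G v = Terminal a) \<or>
                  (\<exists>l r. rule_of G v = Nonterminal [l, r]))"

definition linear_slp :: "grammar \<Rightarrow> bool" where
  "linear_slp G \<longleftrightarrow> dag G \<and>
     ((\<exists>a. rule_of G (root G) = Terminal a) \<or>
      (\<exists>us. rule_of G (root G) = Nonterminal us \<and> 2 \<le> length us)) \<and>
     (\<forall>v\<in>nodes G - {root G}. (\<exists>a. rule_of G v = Terminal a) \<or>
        (\<exists>l r a. rule_of G v = Nonterminal [l, r] \<and> rule_of G r = Terminal a))"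

inductive produces :: "grammar \<Rightarrow> nat \<Rightarrow> nat list \<Rightarrow> bool" for G where
  leaf: "rule_of G v = Terminal a \<Longrightarrow> produces G v [a]"
| node: "rule_of G v = Nonterminal us \<Longrightarrow> list_all2 (produces G) us xs \<Longrightarrow>
         produces G v (concat xs)"

text \<open>
  The size is the number of nodes, where a root with \<open>k > 2\<close> children counts as the
  \<open>k - 1\<close> binary rules it abbreviates; for a binary grammar the second summand is \<open>0\<close>.
  Without it a root listing \<open>N\<close> occurrences of two leaves would have size \<open>3\<close>, although such
  grammars produce about \<open>2 ^ N\<close> different strings.
\<close>

definition size_slp :: "grammar \<Rightarrow> nat" where
  "size_slp G = card (nodes G) + (length (children (rule_of G (root G))) - 2)"


section \<open>Fingerprints\<close>

text \<open>List positions start at \<open>0\<close>, string positions at \<open>1\<close>.\<close>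

definition substring :: "nat list \<Rightarrow> nat \<Rightarrow> nat \<Rightarrow> nat list" where
  "substring S i j = map (\<lambda>k. S ! (k - 1)) [i..<Suc j]"

definition fingerprint :: "nat \<Rightarrow> nat \<Rightarrow> nat list \<Rightarrow> nat" where
  "fingerprint c p x = (\<Sum>i = 1..length x. x ! (i - 1) * c ^ i) mod p"


section \<open>Word RAM\<close>

text \<open>
  A machine with \<open>w\<close>-bit words, represented by the numbers below \<open>2 ^ w\<close>. A program is a finite
  list of instructions and hence mentions only finitely many of the registers. It does not
  depend on \<open>w\<close>: immediate operands are truncated to \<open>w\<close> bits.
\<close>

datatype alu = Add | Sub | Mul | Div | Mod | And | Or | Xor | Shl | Shr

context
  includes bit_operations_syntax
begin

primrec alu_op :: "nat \<Rightarrow> alu \<Rightarrow> nat \<Rightarrow> nat \<Rightarrow> nat" where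
  "alu_op w Add x y = take_bit w (x + y)"
| "alu_op w Sub x y = take_bit w (x + 2 ^ w - y)"
| "alu_op w Mul x y = take_bit w (x * y)"
| "alu_op w Div x y = x div y"
| "alu_op w Mod x y = x mod y"
| "alu_op w And x y = x AND y"
| "alu_op w Or x y = x OR y"
| "alu_op w Xor x y = x XOR y"
| "alu_op w Shl x y = take_bit w (push_bit y x)"
| "alu_op w Shr x y = drop_bit y x"

end

datatype instr =
    Imm nat nat         \<comment> \<open>\<open>r := k\<close>\<close>
  | Alu alu nat nat nat \<comment> \<open>\<open>r := r1 op r2\<close>\<close>
  | Load nat nat        \<comment> \<open>\<open>r := mem[r1]\<close>\<close>
  | Store nat nat       \<comment> \<open>\<open>mem[r1] := r2\<close>\<close>
  | Jeq nat nat nat     \<comment> \<open>if \<open>r1 = r2\<close> goto \<open>l\<close>\<close>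
  | Jlt nat nat nat     \<comment> \<open>if \<open>r1 < r2\<close> goto \<open>l\<close>\<close>
  | Halt

record config =
  pc :: nat
  reg :: "nat \<Rightarrow> nat"
  mem :: "nat list"

text \<open>
  \<open>exec w I s = None\<close> if \<open>I\<close> is \<open>Halt\<close> or accesses an address outside the memory; so the length of
  the memory bounds the space in use.
\<close>

primrec exec :: "nat \<Rightarrow> instr \<Rightarrow> config \<Rightarrow> config option" where
  "exec w (Imm r k) s =
     Some (s\<lparr>pc := pc s + 1, reg := (reg s)(r := take_bit w k)\<rparr>)"
| "exec w (Alu f r r1 r2) s =
     Some (s\<lparr>pc := pc s + 1, reg := (reg s)(r := alu_op w f (reg s r1) (reg s r2))\<rparr>)"
| "exec w (Load r r1) s =
     (if reg s r1 < length (mem s)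
      then Some (s\<lparr>pc := pc s + 1, reg := (reg s)(r := mem s ! reg s r1)\<rparr>) else None)"
| "exec w (Store r1 r2) s =
     (if reg s r1 < length (mem s)
      then Some (s\<lparr>pc := pc s + 1, mem := (mem s)[reg s r1 := reg s r2]\<rparr>) else None)"
| "exec w (Jeq r1 r2 l) s =
     Some (s\<lparr>pc := (if reg s r1 = reg s r2 then l else pc s + 1)\<rparr>)"
| "exec w (Jlt r1 r2 l) s =
     Some (s\<lparr>pc := (if reg s r1 < reg s r2 then l else pc s + 1)\<rparr>)"
| "exec w Halt s = None"

definition step :: "nat \<Rightarrow> instr list \<Rightarrow> config \<Rightarrow> config option" where
  "step w P s = (if pc s < length P then exec w (P ! pc s) s else None)"

primrec steps :: "nat \<Rightarrow> instr list \<Rightarrow> nat \<Rightarrow> config \<Rightarrow> config option" where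
  "steps w P 0 s = Some s"
| "steps w P (Suc t) s = Option.bind (step w P s) (steps w P t)"

definition halted :: "instr list \<Rightarrow> config \<Rightarrow> bool" where
  "halted P s \<longleftrightarrow> pc s < length P \<and> P ! pc s = Halt"

text \<open>
  A query receives its arguments in registers \<open>0\<close> and \<open>1\<close>, returns its result in register \<open>0\<close> and
  leaves the memory as it found it, so that any number of queries can be answered.
\<close>

definition query_start :: "nat list \<Rightarrow> nat \<Rightarrow> nat \<Rightarrow> config" where
  "query_start D i j = \<lparr>pc = 0, reg = (\<lambda>_. 0)(0 := i, 1 := j), mem = D\<rparr>"

definition answers :: "nat \<Rightarrow> instr list \<Rightarrow> nat list \<Rightarrow> nat \<Rightarrow> nat \<Rightarrow> nat \<Rightarrow> nat \<Rightarrow> bool" where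
  "answers w P D i j t y \<longleftrightarrow>
     (\<exists>s. steps w P t (query_start D i j) = Some s \<and> halted P s \<and> reg s 0 = y \<and> mem s = D)"

definition supports_fingerprint ::
    "nat \<Rightarrow> instr list \<Rightarrow> nat list \<Rightarrow> nat \<Rightarrow> nat \<Rightarrow> nat list \<Rightarrow> real \<Rightarrow> bool" where
  "supports_fingerprint w P D c p S T \<longleftrightarrow>
     (\<forall>i j. 1 \<le> i \<and> i \<le> j \<and> j \<le> length S \<longrightarrow>
        (\<exists>t. real t \<le> T \<and> answers w P D i j t (fingerprint c p (substring S i j))))"

definition bits :: "nat \<Rightarrow> nat" where
  "bits N = nat \<lceil>log 2 (real N + 1)\<rceil>"

text \<open>
  A fingerprint has about \<open>(c + 4) log N\<close> bits. The word length is \<open>\<kappa>\<close> times that, which is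
  \<open>O(log N)\<close> for fixed \<open>c\<close>. The query program, \<open>\<kappa>\<close> and the bounds on space (in words, as a function
  of the grammar size) and time (as a function of the string length) depend on neither \<open>c\<close> nor \<open>p\<close>.
\<close>

definition fingerprint_structure ::
    "(grammar \<Rightarrow> bool) \<Rightarrow> instr list \<Rightarrow> nat \<Rightarrow> (nat \<Rightarrow> real) \<Rightarrow> (nat \<Rightarrow> real) \<Rightarrow> bool" where
  "fingerprint_structure C P \<kappa> space time \<longleftrightarrow>
     (\<forall>G S N c p w.
        C G \<and> produces G (root G) S \<and> N = length S \<and>
        0 < c \<and> prime p \<and> 2 * N ^ (c + 4) \<le> p \<and> p \<le> 4 * N ^ (c + 4) \<and>
        w = \<kappa> * ((c + 4) * bits N) \<longrightarrow>
        (\<exists>D. (\<forall>x\<in>set D. x < 2 ^ w) \<and> real (length D) \<le> space (size_slp G) \<and>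
             supports_fingerprint w P D c p S (time N)))"

end

theory Submission
  imports
    Defs
    "HOL-Library.Discrete_Functions"
    "HOL-Library.List_Lexorder"
    "HOL-Number_Theory.Cong"
    "HOL-Real_Asymp.Real_Asymp"
begin

text \<open>
  Let \<open>F x\<close> be the fingerprint of the prefix of length \<open>x\<close>. Then \<open>F j - F (i - 1)\<close> is \<open>c ^ (i - 1)\<close> times
  the required fingerprint modulo \<open>p\<close>, so it suffices to compute \<open>F x\<close> and \<open>d ^ x\<close>, where \<open>d\<close> is the
  inverse of \<open>c\<close>. Both are composed from stored values along the way from the root to position \<open>x\<close>.

  For a general SLP, replace the grammar by the set of distinct subtrees of its derivation tree and
  call a parent and a child alike if the binary logarithms of their widths and of their numbers of
  occurrences agree (the symmetric centroid decomposition of Ganardi, Jez and Lohrey). A tree has at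
  most one alike child and at most one alike parent, so the trees split into disjoint chains. A tree
  in a chain is a factor of the top of the chain of at least half its width; hence one biased search
  tree per chain, over the subtrees that branch off, leads from any member of the chain to a
  subtree \<open>v\<close> in about \<open>log (W / width v)\<close> steps, where \<open>W\<close> is the width of the top. The total is linear in size, and the times telescope.

  A linear SLP writes the string as a concatenation of pieces with only \<open>O(n)\<close> different prefixes. The
  piece that contains a position is found by a predecessor query among the starting positions.
  Prefixes ordered by length and then lexicographically turn the truncation of a piece to a given
  length into a second predecessor query. Predecessors take time \<open>O(log log N)\<close>: hash the
  binary prefixes shared by more than \<open>L\<close> keys, where \<open>L\<close> is the number of bits of a key, binary search
  for the shortest such block around the query, and finish among at most \<open>L\<close> keys.
\<close>

section \<open>Structured programs\<close>

text \<open>Why \<open>d ^ x\<close> is composed like \<open>F x\<close>: raising \<open>d\<close>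
  to a power at query time would already cost about \<open>log N\<close> multiplications, too slow
  for the linear case, whereas stored next to \<open>F x\<close> it only adds a constant factor. The
  inverse \<open>d\<close> exists unless \<open>p\<close> divides \<open>c\<close>; the size of
  \<open>p\<close> then forces \<open>N = 1\<close>, where every fingerprint is \<open>0\<close>,
  and the structure is built for another string. On a DAG a node may have many parents, so paths
  that follow the wider child can merge. Widths leave at most one alike child, occurrence counts at
  most one alike parent, and both together give disjoint chains. Hashing needs a prime above all
  block numbers, but none has to be searched for: the range of \<open>p\<close> makes
  \<open>p\<close> itself large enough from \<open>N = 5\<close> on, and one numeral serves below.
  Truncation replaces an ancestor query in the trie of prefixes, so that one predecessor structure
  serves both lookups. The programs may depend on none of \<open>N\<close>, \<open>c\<close>,
  \<open>p\<close>; all such values are read from memory.\<close>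

datatype cond = Lt nat nat | Eq nat nat

datatype com =
    Basic "instr list"
  | Seq com com
  | Ite cond com com
  | While cond com

primrec jump :: "cond \<Rightarrow> nat \<Rightarrow> instr" where
  "jump (Lt a b) l = Jlt a b l"
| "jump (Eq a b) l = Jeq a b l"

primrec holds :: "cond \<Rightarrow> (nat \<Rightarrow> nat) \<Rightarrow> bool" where
  "holds (Lt a b) \<rho> \<longleftrightarrow> \<rho> a < \<rho> b"
| "holds (Eq a b) \<rho> \<longleftrightarrow> \<rho> a = \<rho> b"

primrec comp_size :: "com \<Rightarrow> nat" where
  "comp_size (Basic is) = length is"
| "comp_size (Seq a b) = comp_size a + comp_size b"
| "comp_size (Ite b c d) = comp_size c + comp_size d + 2"
| "comp_size (While b c) = comp_size c + 3"

text \<open>The first argument is the address at which the code is placed.\<close>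

primrec comp :: "nat \<Rightarrow> com \<Rightarrow> instr list" where
  "comp k (Basic is) = is"
| "comp k (Seq a b) = comp k a @ comp (k + comp_size a) b"
| "comp k (Ite b c d) =
     jump b (k + comp_size d + 2) # comp (k + 1) d @
     Jeq 0 0 (k + comp_size d + comp_size c + 2) # comp (k + comp_size d + 2) c"
| "comp k (While b c) =
     jump b (k + 2) # Jeq 0 0 (k + comp_size c + 3) # comp (k + 2) c @ [Jeq 0 0 k]"

lemma length_comp [simp]: "length (comp k c) = comp_size c"
  by (induction c arbitrary: k) auto

text \<open>Programs never store, so the memory \<open>D\<close> is a parameter.\<close>

fun effect :: "nat \<Rightarrow> nat list \<Rightarrow> instr \<Rightarrow> (nat \<Rightarrow> nat) \<Rightarrow> (nat \<Rightarrow> nat) option" where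
  "effect w D (Imm r k) \<rho> = Some (\<rho>(r := take_bit w k))"
| "effect w D (Alu f r r1 r2) \<rho> = Some (\<rho>(r := alu_op w f (\<rho> r1) (\<rho> r2)))"
| "effect w D (Load r r1) \<rho> = (if \<rho> r1 < length D then Some (\<rho>(r := D ! \<rho> r1)) else None)"
| "effect w D _ \<rho> = None"

primrec run :: "nat \<Rightarrow> nat list \<Rightarrow> instr list \<Rightarrow> (nat \<Rightarrow> nat) \<Rightarrow> (nat \<Rightarrow> nat) option" where
  "run w D [] \<rho> = Some \<rho>"
| "run w D (i # is) \<rho> = Option.bind (effect w D i \<rho>) (run w D is)"

text \<open>The constants count the jumps emitted by \<open>comp\<close>: the true branch is placed
  last and falls through, the false branch ends with a jump over it, and leaving a loop takes a
  failed test and a jump. The times are exact; bounds come in with \<open>ensures\<close>.\<close>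

inductive big :: "nat \<Rightarrow> nat list \<Rightarrow> com \<Rightarrow> (nat \<Rightarrow> nat) \<Rightarrow> nat \<Rightarrow> (nat \<Rightarrow> nat) \<Rightarrow> bool"
  for w D where
  basic: "run w D is \<rho> = Some \<rho>' \<Longrightarrow> big w D (Basic is) \<rho> (length is) \<rho>'"
| seq: "big w D a \<rho> t \<rho>' \<Longrightarrow> big w D b \<rho>' t' \<rho>'' \<Longrightarrow> big w D (Seq a b) \<rho> (t + t') \<rho>''"
| if_true: "holds b \<rho> \<Longrightarrow> big w D c \<rho> t \<rho>' \<Longrightarrow> big w D (Ite b c d) \<rho> (1 + t) \<rho>'"
| if_false: "\<not> holds b \<rho> \<Longrightarrow> big w D d \<rho> t \<rho>' \<Longrightarrow> big w D (Ite b c d) \<rho> (1 + (t + 1)) \<rho>'"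
| while_false: "\<not> holds b \<rho> \<Longrightarrow> big w D (While b c) \<rho> 2 \<rho>"
| while_true: "holds b \<rho> \<Longrightarrow> big w D c \<rho> t \<rho>' \<Longrightarrow> big w D (While b c) \<rho>' t' \<rho>'' \<Longrightarrow>
    big w D (While b c) \<rho> (1 + (t + (1 + t'))) \<rho>''"

lemma steps_add: "steps w P (t + t') s = Option.bind (steps w P t s) (steps w P t')"
  by (induction t arbitrary: s) (auto simp: bind_assoc split: Option.bind_splits)

lemma steps_trans:
  "steps w P t s = Some s' \<Longrightarrow> steps w P t' s' = Some s'' \<Longrightarrow> steps w P (t + t') s = Some s''"
  by (simp add: steps_add)

lemma exec_jump:
  "exec w (jump b l) \<lparr>pc = k, reg = \<rho>, mem = D\<rparr> =
     Some \<lparr>pc = (if holds b \<rho> then l else k + 1), reg = \<rho>, mem = D\<rparr>"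
  by (cases b) auto

lemma step_at:
  "P = xs @ i # ys \<Longrightarrow> k = length xs \<Longrightarrow>
   steps w P 1 \<lparr>pc = k, reg = \<rho>, mem = D\<rparr> = exec w i \<lparr>pc = k, reg = \<rho>, mem = D\<rparr>"
  by (cases "exec w i \<lparr>pc = k, reg = \<rho>, mem = D\<rparr>") (auto simp: step_def)

lemma exec_effect:
  "effect w D i \<rho> = Some \<rho>' \<Longrightarrow>
   exec w i \<lparr>pc = k, reg = \<rho>, mem = D\<rparr> = Some \<lparr>pc = k + 1, reg = \<rho>', mem = D\<rparr>"
  by (cases i) (auto split: if_splits)

lemma steps_run:
  "run w D is \<rho> = Some \<rho>' \<Longrightarrow> P = xs @ is @ ys \<Longrightarrow> k = length xs \<Longrightarrow>
   steps w P (length is) \<lparr>pc = k, reg = \<rho>, mem = D\<rparr> =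
     Some \<lparr>pc = k + length is, reg = \<rho>', mem = D\<rparr>"
proof (induction "is" arbitrary: k \<rho> xs)
  case (Cons i "is")
  then obtain \<rho>1 where 1: "effect w D i \<rho> = Some \<rho>1" "run w D is \<rho>1 = Some \<rho>'"
    by (auto split: Option.bind_splits)
  have "steps w P 1 \<lparr>pc = k, reg = \<rho>, mem = D\<rparr> = Some \<lparr>pc = k + 1, reg = \<rho>1, mem = D\<rparr>"
    using step_at[of P xs i "is @ ys" k] exec_effect[OF 1(1)] Cons.prems by simp
  moreover have "steps w P (length is) \<lparr>pc = k + 1, reg = \<rho>1, mem = D\<rparr> =
     Some \<lparr>pc = k + 1 + length is, reg = \<rho>', mem = D\<rparr>"
    using Cons.IH[OF 1(2), of "xs @ [i]"] Cons.prems by simp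
  ultimately show ?case using steps_trans by fastforce
qed simp

theorem comp_correct:
  "big w D c \<rho> t \<rho>' \<Longrightarrow> P = xs @ comp k c @ ys \<Longrightarrow> k = length xs \<Longrightarrow>
   steps w P t \<lparr>pc = k, reg = \<rho>, mem = D\<rparr> =
     Some \<lparr>pc = k + comp_size c, reg = \<rho>', mem = D\<rparr>"
proof (induction arbitrary: xs k ys rule: big.induct)
  case (basic "is" \<rho> \<rho>')
  then show ?case using steps_run by simp
next
  case (seq a \<rho> t \<rho>' b t' \<rho>'')
  have 1: "steps w P t \<lparr>pc = k, reg = \<rho>, mem = D\<rparr> =
     Some \<lparr>pc = k + comp_size a, reg = \<rho>', mem = D\<rparr>"
    using seq.IH(1)[of xs k "comp (k + comp_size a) b @ ys"] seq.prems by simp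
  have 2: "steps w P t' \<lparr>pc = k + comp_size a, reg = \<rho>', mem = D\<rparr> =
     Some \<lparr>pc = k + comp_size a + comp_size b, reg = \<rho>'', mem = D\<rparr>"
    using seq.IH(2)[of "xs @ comp k a" "k + comp_size a" ys] seq.prems by simp
  show ?case using steps_trans[OF 1 2] by (simp add: add.assoc)
next
  case (if_true b \<rho> c t \<rho>' d)
  let ?k = "k + comp_size d + 2"
  have 1: "steps w P 1 \<lparr>pc = k, reg = \<rho>, mem = D\<rparr> = Some \<lparr>pc = ?k, reg = \<rho>, mem = D\<rparr>"
    by (subst step_at[of P xs "jump b ?k"]) (use if_true in \<open>auto simp: exec_jump\<close>)
  have 2: "steps w P t \<lparr>pc = ?k, reg = \<rho>, mem = D\<rparr> =
     Some \<lparr>pc = ?k + comp_size c, reg = \<rho>', mem = D\<rparr>"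
    using if_true.IH[of "xs @ jump b ?k # comp (k + 1) d @ [Jeq 0 0 (k + comp_size d + comp_size c + 2)]"
        ?k ys] if_true.prems by simp
  show ?case using steps_trans[OF 1 2] by (simp add: algebra_simps)
next
  case (if_false b \<rho> d t \<rho>' c)
  let ?k = "k + comp_size d + 2" and ?e = "k + comp_size d + comp_size c + 2"
  have 1: "steps w P 1 \<lparr>pc = k, reg = \<rho>, mem = D\<rparr> = Some \<lparr>pc = k + 1, reg = \<rho>, mem = D\<rparr>"
    by (subst step_at[of P xs "jump b ?k"]) (use if_false in \<open>auto simp: exec_jump\<close>)
  have 2: "steps w P t \<lparr>pc = k + 1, reg = \<rho>, mem = D\<rparr> =
     Some \<lparr>pc = k + 1 + comp_size d, reg = \<rho>', mem = D\<rparr>"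
    using if_false.IH[of "xs @ [jump b ?k]" "k + 1" "Jeq 0 0 ?e # comp ?k c @ ys"] if_false.prems
    by simp
  have 3: "steps w P 1 \<lparr>pc = k + 1 + comp_size d, reg = \<rho>', mem = D\<rparr> =
      Some \<lparr>pc = ?e, reg = \<rho>', mem = D\<rparr>"
    by (subst step_at[of P "xs @ jump b ?k # comp (k + 1) d" "Jeq 0 0 ?e"])
      (use if_false in auto)
  show ?case using steps_trans[OF 1 steps_trans[OF 2 3]] by (simp add: algebra_simps)
next
  case (while_false b \<rho> c)
  let ?e = "k + comp_size c + 3"
  have 1: "steps w P 1 \<lparr>pc = k, reg = \<rho>, mem = D\<rparr> = Some \<lparr>pc = k + 1, reg = \<rho>, mem = D\<rparr>"
    by (subst step_at[of P xs "jump b (k + 2)"]) (use while_false in \<open>auto simp: exec_jump\<close>)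
  have 2: "steps w P 1 \<lparr>pc = k + 1, reg = \<rho>, mem = D\<rparr> = Some \<lparr>pc = ?e, reg = \<rho>, mem = D\<rparr>"
    by (subst step_at[of P "xs @ [jump b (k + 2)]" "Jeq 0 0 ?e"]) (use while_false in auto)
  show ?case using steps_trans[OF 1 2] by (simp add: numeral_2_eq_2)
next
  case (while_true b \<rho> c t \<rho>' t' \<rho>'')
  let ?e = "k + comp_size c + 3"
  have 1: "steps w P 1 \<lparr>pc = k, reg = \<rho>, mem = D\<rparr> = Some \<lparr>pc = k + 2, reg = \<rho>, mem = D\<rparr>"
    by (subst step_at[of P xs "jump b (k + 2)"]) (use while_true in \<open>auto simp: exec_jump\<close>)
  have 2: "steps w P t \<lparr>pc = k + 2, reg = \<rho>, mem = D\<rparr> =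
      Some \<lparr>pc = k + 2 + comp_size c, reg = \<rho>', mem = D\<rparr>"
    using while_true.IH(1)[of "xs @ [jump b (k + 2), Jeq 0 0 ?e]" "k + 2" "Jeq 0 0 k # ys"]
      while_true.prems by simp
  have 3: "steps w P 1 \<lparr>pc = k + 2 + comp_size c, reg = \<rho>', mem = D\<rparr> =
      Some \<lparr>pc = k, reg = \<rho>', mem = D\<rparr>"
    by (subst step_at[of P "xs @ jump b (k + 2) # Jeq 0 0 ?e # comp (k + 2) c" "Jeq 0 0 k"])
      (use while_true in auto)
  show ?case
    using steps_trans[OF 1 steps_trans[OF 2 steps_trans[OF 3 while_true.IH(2)]]] while_true.prems
    by simp
qed

text \<open>Total correctness with a time bound. The slack in \<open>t \<le> T\<close> lets the two
  branches of a conditional share one bound.\<close>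

definition ensures :: "nat \<Rightarrow> nat list \<Rightarrow> com \<Rightarrow> (nat \<Rightarrow> nat) \<Rightarrow> nat \<Rightarrow> ((nat \<Rightarrow> nat) \<Rightarrow> bool) \<Rightarrow> bool"
  where "ensures w D c \<rho> T Q \<longleftrightarrow> (\<exists>t \<rho>'. big w D c \<rho> t \<rho>' \<and> t \<le> T \<and> Q \<rho>')"

lemma ensures_basic:
  "run w D is \<rho> = Some \<rho>' \<Longrightarrow> Q \<rho>' \<Longrightarrow> length is \<le> T \<Longrightarrow> ensures w D (Basic is) \<rho> T Q"
  unfolding ensures_def by (blast intro: big.basic)

lemma ensures_basicI:
  "length is \<le> T \<Longrightarrow> (case run w D is \<rho> of None \<Rightarrow> False | Some \<rho>' \<Rightarrow> Q \<rho>') \<Longrightarrow>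
   ensures w D (Basic is) \<rho> T Q"
  using ensures_basic[of w D "is" \<rho>] by (cases "run w D is \<rho>") auto

lemma ensures_seq:
  assumes "ensures w D a \<rho> T Q" "\<And>\<rho>'. Q \<rho>' \<Longrightarrow> ensures w D b \<rho>' T' R" "T + T' \<le> U"
  shows "ensures w D (Seq a b) \<rho> U R"
proof -
  obtain t \<rho>' where 1: "big w D a \<rho> t \<rho>'" "t \<le> T" "Q \<rho>'"
    using assms(1) unfolding ensures_def by blast
  obtain t' \<rho>'' where 2: "big w D b \<rho>' t' \<rho>''" "t' \<le> T'" "R \<rho>''"
    using assms(2)[OF 1(3)] unfolding ensures_def by blast
  show ?thesis unfolding ensures_def
    by (rule exI[of _ "t + t'"]) (use big.seq[OF 1(1) 2(1)] 1 2 assms(3) in auto)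
qed

lemma ensures_if:
  assumes "holds b \<rho> \<Longrightarrow> ensures w D c \<rho> T Q" "\<not> holds b \<rho> \<Longrightarrow> ensures w D d \<rho> T Q" "T + 2 \<le> U"
  shows "ensures w D (Ite b c d) \<rho> U Q"
proof (cases "holds b \<rho>")
  case True
  then obtain t \<rho>' where 1: "big w D c \<rho> t \<rho>'" "t \<le> T" "Q \<rho>'"
    using assms(1) unfolding ensures_def by blast
  show ?thesis unfolding ensures_def
    by (rule exI[of _ "1 + t"]) (use big.if_true[OF True 1(1)] 1 assms(3) in auto)
next
  case False
  then obtain t \<rho>' where 1: "big w D d \<rho> t \<rho>'" "t \<le> T" "Q \<rho>'"
    using assms(2) unfolding ensures_def by blast
  show ?thesis unfolding ensures_def
    by (rule exI[of _ "1 + (t + 1)"]) (use big.if_false[OF False 1(1)] 1 assms(3) in auto)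
qed

lemma ensures_while_false:
  "\<not> holds b \<rho> \<Longrightarrow> Q \<rho> \<Longrightarrow> 2 \<le> T \<Longrightarrow> ensures w D (While b c) \<rho> T Q"
  unfolding ensures_def by (blast intro: big.while_false)

lemma ensures_while_true:
  assumes "holds b \<rho>" "ensures w D c \<rho> T Q" "\<And>\<rho>'. Q \<rho>' \<Longrightarrow> ensures w D (While b c) \<rho>' T' R"
    "T + T' + 2 \<le> U"
  shows "ensures w D (While b c) \<rho> U R"
proof -
  obtain t \<rho>' where 1: "big w D c \<rho> t \<rho>'" "t \<le> T" "Q \<rho>'"
    using assms(2) unfolding ensures_def by blast
  obtain t' \<rho>'' where 2: "big w D (While b c) \<rho>' t' \<rho>''" "t' \<le> T'" "R \<rho>''"
    using assms(3)[OF 1(3)] unfolding ensures_def by blast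
  show ?thesis unfolding ensures_def
    by (rule exI[of _ "1 + (t + (1 + t'))"])
      (use big.while_true[OF assms(1) 1(1) 2(1)] 1 2 assms(4) in auto)
qed

lemma ensures_mono: "ensures w D c \<rho> T Q \<Longrightarrow> T \<le> U \<Longrightarrow> (\<And>\<rho>'. Q \<rho>' \<Longrightarrow> R \<rho>') \<Longrightarrow> ensures w D c \<rho> U R"
  unfolding ensures_def using order_trans by blast

lemma answers_ensures:
  assumes "ensures w D c ((\<lambda>_. 0)(0 := i, 1 := j)) T (\<lambda>\<rho>. \<rho> 0 = y)"
  shows "\<exists>t\<le>T. answers w (comp 0 c @ [Halt]) D i j t y"
proof -
  obtain t \<rho> where 1: "big w D c ((\<lambda>_. 0)(0 := i, 1 := j)) t \<rho>" "t \<le> T" "\<rho> 0 = y"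
    using assms unfolding ensures_def by blast
  have "answers w (comp 0 c @ [Halt]) D i j t y"
    unfolding answers_def query_start_def
    using comp_correct[OF 1(1), of _ "[]" 0 "[Halt]"] 1
    by (auto simp: halted_def nth_append)
  then show ?thesis using 1 by blast
qed

lemma take_bit_diff:
  fixes x y :: nat
  assumes "y \<le> x" "x < 2 ^ w"
  shows "take_bit w (x + 2 ^ w - y) = x - y"
proof -
  have "x + 2 ^ w - y = (x - y) + 2 ^ w" using assms(1) by linarith
  then have "take_bit w (x + 2 ^ w - y) = ((x - y) + 2 ^ w) mod 2 ^ w"
    by (simp only: take_bit_eq_mod)
  also have "\<dots> = x - y" using assms(2) by (simp only: mod_add_self2) (rule mod_less, linarith)
  finally show ?thesis .
qed

text \<open>These rules replace the defining equations in the simplifier: symbolic execution then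
  computes in plain natural numbers, and every possible overflow shows up as a side
  condition.\<close>

lemma effect_ram:
  "k < 2 ^ w \<Longrightarrow> effect w D (Imm r k) \<rho> = Some (\<rho>(r := k))"
  "\<rho> r1 < length D \<Longrightarrow> effect w D (Load r r1) \<rho> = Some (\<rho>(r := D ! \<rho> r1))"
  "\<rho> r1 + \<rho> r2 < 2 ^ w \<Longrightarrow> effect w D (Alu Add r r1 r2) \<rho> = Some (\<rho>(r := \<rho> r1 + \<rho> r2))"
  "\<rho> r2 \<le> \<rho> r1 \<Longrightarrow> \<rho> r1 < 2 ^ w \<Longrightarrow>
     effect w D (Alu Sub r r1 r2) \<rho> = Some (\<rho>(r := \<rho> r1 - \<rho> r2))"
  "\<rho> r1 * \<rho> r2 < 2 ^ w \<Longrightarrow> effect w D (Alu Mul r r1 r2) \<rho> = Some (\<rho>(r := \<rho> r1 * \<rho> r2))"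
  "effect w D (Alu Div r r1 r2) \<rho> = Some (\<rho>(r := \<rho> r1 div \<rho> r2))"
  "effect w D (Alu Mod r r1 r2) \<rho> = Some (\<rho>(r := \<rho> r1 mod \<rho> r2))"
  "effect w D (Alu Shr r r1 r2) \<rho> = Some (\<rho>(r := \<rho> r1 div 2 ^ \<rho> r2))"
  by (auto simp: take_bit_nat_eq_self take_bit_diff drop_bit_eq_div)

declare effect.simps [simp del]
declare effect_ram [simp]

section \<open>Descent through search trees\<close>

text \<open>
  Registers: \<open>2\<close> position in the current string, \<open>3\<close> and \<open>4\<close> results \<open>F x\<close> and \<open>d ^ x\<close>, \<open>5\<close> address of the
  current cell, \<open>6\<close> factor by which further contributions to \<open>F x\<close> are multiplied, \<open>7\<close> the prime \<open>p\<close>,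
  \<open>8\<close> zero.
\<close>

definition field :: "nat \<Rightarrow> nat \<Rightarrow> instr list" where
  "field k r = [Imm 10 k, Alu Add 10 5 10, Load r 10]"

text \<open>The order matters: register \<open>3\<close> is updated with the old factor in register
  \<open>6\<close>, and register \<open>5\<close> is overwritten last because every field is
  addressed relative to it.\<close>

definition enter_code :: "instr list" where
  "enter_code = [Alu Sub 2 2 9] @ field 5 11 @ [Alu Add 2 2 11] @
     field 6 11 @ [Alu Mul 11 6 11, Alu Add 3 3 11, Alu Mod 3 3 7] @
     field 7 11 @ [Alu Mul 6 6 11, Alu Mod 6 6 7] @
     field 8 11 @ [Alu Mul 4 4 11, Alu Mod 4 4 7] @ field 4 5"

definition descend_body :: com where
  "descend_body =
     Seq (Basic [Load 9 5])
       (Ite (Lt 2 9) (Basic (field 2 5))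
         (Seq (Basic (field 1 11))
           (Ite (Lt 2 11) (Basic enter_code) (Basic (field 3 5)))))"

definition descend :: com where
  "descend = While (Lt 8 5) descend_body"

definition descend_query :: com where
  "descend_query =
    Seq (Basic [Imm 8 0, Load 7 8, Imm 5 1, Load 5 5, Imm 3 0, Imm 4 1, Imm 6 1]) descend"

text \<open>
  A cell at address \<open>q\<close> of a search tree consists of the bounds of the interval of its item, its
  two subtrees, the search tree in which to continue inside the item, the offset there, and the
  coefficients that turn the result there into the result here. Address \<open>0\<close> is the empty tree.
\<close>

inductive walk :: "nat \<Rightarrow> nat list \<Rightarrow> nat \<Rightarrow> nat \<Rightarrow> nat \<Rightarrow> nat \<Rightarrow> nat \<Rightarrow> nat \<Rightarrow> bool" for w D p where
  stop: "walk w D p 0 x 0 0 1"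
| left: "0 < q \<Longrightarrow> q + 8 < length D \<Longrightarrow> x < D ! q \<Longrightarrow> walk w D p (D ! (q + 2)) x n f g \<Longrightarrow>
    walk w D p q x (Suc n) f g"
| right: "0 < q \<Longrightarrow> q + 8 < length D \<Longrightarrow> D ! q \<le> x \<Longrightarrow> D ! (q + 1) \<le> x \<Longrightarrow>
    walk w D p (D ! (q + 3)) x n f g \<Longrightarrow> walk w D p q x (Suc n) f g"
| enter: "0 < q \<Longrightarrow> q + 8 < length D \<Longrightarrow> D ! q \<le> x \<Longrightarrow> x < D ! (q + 1) \<Longrightarrow>
    x < 2 ^ w \<Longrightarrow> x - D ! q + D ! (q + 5) < 2 ^ w \<Longrightarrow>
    D ! (q + 6) < p \<Longrightarrow> D ! (q + 7) < p \<Longrightarrow> D ! (q + 8) < p \<Longrightarrow>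
    walk w D p (D ! (q + 4)) (x - D ! q + D ! (q + 5)) n f g \<Longrightarrow>
    walk w D p q x (Suc n) (D ! (q + 6) + D ! (q + 7) * f) (D ! (q + 8) * g)"

lemma mult_less_square: "(a::nat) < p \<Longrightarrow> b < p \<Longrightarrow> p * p + p < B \<Longrightarrow> a * b < B"
  using mult_le_mono[of a p b p] by linarith

lemma add_mult_less_square: "(a::nat) < p \<Longrightarrow> b < p \<Longrightarrow> c < p \<Longrightarrow> p * p + p < B \<Longrightarrow> c + a * b < B"
  using mult_le_mono[of a p b p] by linarith

abbreviation agree :: "nat set \<Rightarrow> (nat \<Rightarrow> nat) \<Rightarrow> (nat \<Rightarrow> nat) \<Rightarrow> bool" where
  "agree A \<rho> \<rho>' \<equiv> \<forall>r\<in>A. \<rho>' r = \<rho> r"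

lemma descend_body_left:
  assumes "length D < 2 ^ w" "16 < (2 :: nat) ^ w" "\<rho> 5 + 8 < length D" "\<rho> 2 < D ! \<rho> 5"
  shows "ensures w D descend_body \<rho> 40
     (\<lambda>\<rho>'. \<rho>' 5 = D ! (\<rho> 5 + 2) \<and> agree {0, 1, 2, 3, 4, 6, 7, 8, 14, 15} \<rho> \<rho>')"
  unfolding descend_body_def
  apply (rule ensures_seq[where Q = "\<lambda>\<rho>'. \<rho>' = \<rho>(9 := D ! \<rho> 5)" and T = 1 and T' = 36])
    apply (rule ensures_basicI)
  using assms apply (simp_all)
  apply (rule ensures_if[where T = 34])
    apply (rule ensures_basicI)
     apply (simp_all add: field_def)
  done

lemma descend_body_ge:
  assumes "length D < 2 ^ w" "16 < (2 :: nat) ^ w" "\<rho> 5 + 8 < length D" "D ! \<rho> 5 \<le> \<rho> 2"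
    and "ensures w D (Ite (Lt 2 11) (Basic enter_code) (Basic (field 3 5)))
        (\<rho>(9 := D ! \<rho> 5, 10 := \<rho> 5 + 1, 11 := D ! (\<rho> 5 + 1))) 32 Q"
  shows "ensures w D descend_body \<rho> 40 Q"
  unfolding descend_body_def
  apply (rule ensures_seq[where Q = "\<lambda>\<rho>'. \<rho>' = \<rho>(9 := D ! \<rho> 5)" and T = 1 and T' = 37])
    apply (rule ensures_basicI)
  using assms(1-4) apply (simp_all)
  apply (rule ensures_if[where T = 35])
    apply simp
  apply (rule ensures_seq[where Q = "\<lambda>\<rho>'. \<rho>' = \<rho>(9 := D ! \<rho> 5, 10 := \<rho> 5 + 1, 11 := D ! (\<rho> 5 + 1))" and T = 3 and T' = 32])
    apply (rule ensures_basicI)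
     apply (simp_all add: field_def)
  using assms(5) apply (simp add: field_def)
  done

lemma descend_body_right:
  assumes "length D < 2 ^ w" "16 < (2 :: nat) ^ w" "\<rho> 5 + 8 < length D" "D ! \<rho> 5 \<le> \<rho> 2"
    "D ! (\<rho> 5 + 1) \<le> \<rho> 2"
  shows "ensures w D descend_body \<rho> 40
     (\<lambda>\<rho>'. \<rho>' 5 = D ! (\<rho> 5 + 3) \<and> agree {0, 1, 2, 3, 4, 6, 7, 8, 14, 15} \<rho> \<rho>')"
  apply (rule descend_body_ge[OF assms(1-4)])
  apply (rule ensures_if[where T = 30])
  using assms apply simp
   apply (rule ensures_basicI)
  using assms apply (simp_all add: field_def)
  done

lemma descend_body_enter:
  assumes "length D < 2 ^ w" "16 < (2 :: nat) ^ w" "\<rho> 5 + 8 < length D" "D ! \<rho> 5 \<le> \<rho> 2"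
    "\<rho> 2 < D ! (\<rho> 5 + 1)" "\<rho> 2 < 2 ^ w" "\<rho> 2 - D ! \<rho> 5 + D ! (\<rho> 5 + 5) < 2 ^ w"
    "D ! (\<rho> 5 + 6) < \<rho> 7" "D ! (\<rho> 5 + 7) < \<rho> 7" "D ! (\<rho> 5 + 8) < \<rho> 7" "\<rho> 3 < \<rho> 7" "\<rho> 4 < \<rho> 7"
    "\<rho> 6 < \<rho> 7" "\<rho> 7 * \<rho> 7 + \<rho> 7 < 2 ^ w"
  shows "ensures w D descend_body \<rho> 40
     (\<lambda>\<rho>'. \<rho>' 5 = D ! (\<rho> 5 + 4) \<and> \<rho>' 2 = \<rho> 2 - D ! \<rho> 5 + D ! (\<rho> 5 + 5) \<and>
       \<rho>' 3 = (\<rho> 3 + \<rho> 6 * D ! (\<rho> 5 + 6)) mod \<rho> 7 \<and> \<rho>' 6 = \<rho> 6 * D ! (\<rho> 5 + 7) mod \<rho> 7 \<and>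
       \<rho>' 4 = \<rho> 4 * D ! (\<rho> 5 + 8) mod \<rho> 7 \<and> agree {0, 1, 7, 8, 14, 15} \<rho> \<rho>')"
proof (rule descend_body_ge[OF assms(1-4)], rule ensures_if[where T = 30])
  have "\<rho> 6 * D ! (\<rho> 5 + 6) < 2 ^ w" "\<rho> 6 * D ! (\<rho> 5 + 7) < 2 ^ w" "\<rho> 4 * D ! (\<rho> 5 + 8) < 2 ^ w"
    "\<rho> 3 + \<rho> 6 * D ! (\<rho> 5 + 6) < 2 ^ w"
    using assms by (auto intro: mult_less_square add_mult_less_square)
  then show "ensures w D (Basic enter_code)
      (\<rho>(9 := D ! \<rho> 5, 10 := \<rho> 5 + 1, 11 := D ! (\<rho> 5 + 1))) 30
     (\<lambda>\<rho>'. \<rho>' 5 = D ! (\<rho> 5 + 4) \<and> \<rho>' 2 = \<rho> 2 - D ! \<rho> 5 + D ! (\<rho> 5 + 5) \<and>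
       \<rho>' 3 = (\<rho> 3 + \<rho> 6 * D ! (\<rho> 5 + 6)) mod \<rho> 7 \<and> \<rho>' 6 = \<rho> 6 * D ! (\<rho> 5 + 7) mod \<rho> 7 \<and>
       \<rho>' 4 = \<rho> 4 * D ! (\<rho> 5 + 8) mod \<rho> 7 \<and> agree {0, 1, 7, 8, 14, 15} \<rho> \<rho>')"
    using assms by (intro ensures_basicI) (simp_all add: enter_code_def field_def)
qed (use assms in auto)

text \<open>If \<open>a\<close> has been collected and \<open>b\<close> is the current factor,
  entering an item that turns the inner result \<open>f\<close> into \<open>m + n * f\<close> adds
  \<open>b * m\<close> to \<open>a\<close> and multiplies \<open>b\<close> by \<open>n\<close>; this
  is the accumulator step of \<open>descend\<close>.\<close>

lemma affine_mod: "((a + b * m) mod p + b * n mod p * f) mod p = (a + b * (m + n * f)) mod (p :: nat)"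
proof -
  have "((a + b * m) mod p + b * n mod p * f) mod p = ((a + b * m) + (b * n mod p * f) mod p) mod p"
    by (metis mod_add_left_eq mod_add_right_eq)
  also have "\<dots> = ((a + b * m) + (b * n * f) mod p) mod p" by (simp only: mod_mult_left_eq)
  also have "\<dots> = ((a + b * m) + b * n * f) mod p" by (rule mod_add_right_eq)
  finally show ?thesis by (simp only: distrib_left add.assoc mult.assoc)
qed

text \<open>\<open>walk\<close> builds \<open>f\<close> and \<open>g\<close> from the innermost cell
  outwards, while the program goes inwards; arbitrary contents of registers \<open>3\<close>,
  \<open>4\<close> and \<open>6\<close> make the claim inductive. Each of the \<open>n\<close>
  rounds costs \<open>40\<close> for the body and \<open>2\<close> for the loop.\<close>

lemma descend_correct:
  assumes "walk w D p q x n f g" "length D < 2 ^ w" "p * p + p < 2 ^ w" "16 < (2 :: nat) ^ w"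
    and "\<rho> 5 = q" "\<rho> 2 = x" "\<rho> 8 = 0" "\<rho> 7 = p" "\<rho> 3 < p" "\<rho> 4 < p" "\<rho> 6 < p"
  shows "ensures w D descend \<rho> (42 * n + 2)
    (\<lambda>\<rho>'. \<rho>' 3 = (\<rho> 3 + \<rho> 6 * f) mod p \<and> \<rho>' 4 = \<rho> 4 * g mod p \<and> agree {0, 1, 7, 8, 14, 15} \<rho> \<rho>')"
  using assms
proof (induction arbitrary: \<rho> rule: walk.induct)
  case (stop x)
  then show ?case unfolding descend_def by (intro ensures_while_false) auto
next
  case (left q x n f g)
  have body: "ensures w D descend_body \<rho> 40
     (\<lambda>\<rho>'. \<rho>' 5 = D ! (q + 2) \<and> agree {0, 1, 2, 3, 4, 6, 7, 8, 14, 15} \<rho> \<rho>')"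
    using descend_body_left[of D w \<rho>] left.hyps left.prems by simp
  show ?case
    unfolding descend_def
    by (rule ensures_while_true[OF _ body, where T' = "42 * n + 2"], use left.prems left.hyps in simp)
      (rule ensures_mono[OF left.IH[unfolded descend_def]], use left.prems in auto)
next
  case (right q x n f g)
  have body: "ensures w D descend_body \<rho> 40
     (\<lambda>\<rho>'. \<rho>' 5 = D ! (q + 3) \<and> agree {0, 1, 2, 3, 4, 6, 7, 8, 14, 15} \<rho> \<rho>')"
    using descend_body_right[of D w \<rho>] right.hyps right.prems by simp
  show ?case
    unfolding descend_def
    by (rule ensures_while_true[OF _ body, where T' = "42 * n + 2"], use right.prems right.hyps in simp)
      (rule ensures_mono[OF right.IH[unfolded descend_def]], use right.prems in auto)
next
  case (enter q x n f g)
  have body: "ensures w D descend_body \<rho> 40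
     (\<lambda>\<rho>'. \<rho>' 5 = D ! (q + 4) \<and> \<rho>' 2 = x - D ! q + D ! (q + 5) \<and>
       \<rho>' 3 = (\<rho> 3 + \<rho> 6 * D ! (q + 6)) mod p \<and> \<rho>' 6 = \<rho> 6 * D ! (q + 7) mod p \<and>
       \<rho>' 4 = \<rho> 4 * D ! (q + 8) mod p \<and> agree {0, 1, 7, 8, 14, 15} \<rho> \<rho>')"
    using descend_body_enter[of D w \<rho>] enter.hyps enter.prems by simp
  show ?case
    unfolding descend_def
  proof (rule ensures_while_true[OF _ body, where T' = "42 * n + 2"])
    fix \<rho>' assume *: "\<rho>' 5 = D ! (q + 4) \<and> \<rho>' 2 = x - D ! q + D ! (q + 5) \<and>
       \<rho>' 3 = (\<rho> 3 + \<rho> 6 * D ! (q + 6)) mod p \<and> \<rho>' 6 = \<rho> 6 * D ! (q + 7) mod p \<and>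
       \<rho>' 4 = \<rho> 4 * D ! (q + 8) mod p \<and> agree {0, 1, 7, 8, 14, 15} \<rho> \<rho>'"
    have pos: "0 < p" using enter.prems by simp
    show "ensures w D (While (Lt 8 5) descend_body) \<rho>' (42 * n + 2)
      (\<lambda>\<rho>'. \<rho>' 3 = (\<rho> 3 + \<rho> 6 * (D ! (q + 6) + D ! (q + 7) * f)) mod p \<and>
        \<rho>' 4 = \<rho> 4 * (D ! (q + 8) * g) mod p \<and> agree {0, 1, 7, 8, 14, 15} \<rho> \<rho>')"
      unfolding descend_def[symmetric]
      by (rule ensures_mono[OF enter.IH[of \<rho>']])
        (use * pos enter.prems in \<open>auto simp: affine_mod mod_mult_left_eq mult.assoc\<close>)
  qed (use enter in auto)
qed

lemma descend_query_correct:
  assumes "walk w D p q x n f g" "length D < 2 ^ w" "p * p + p < 2 ^ w" "16 < (2 :: nat) ^ w"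
    and "1 < length D" "D ! 0 = p" "D ! 1 = q" "1 < p" "\<rho> 2 = x"
  shows "ensures w D descend_query \<rho> (42 * n + 9)
    (\<lambda>\<rho>'. \<rho>' 3 = f mod p \<and> \<rho>' 4 = g mod p \<and> \<rho>' 7 = p \<and> agree {0, 1, 14, 15} \<rho> \<rho>')"
  unfolding descend_query_def
proof (rule ensures_seq)
  show "ensures w D (Basic [Imm 8 0, Load 7 8, Imm 5 1, Load 5 5, Imm 3 0, Imm 4 1, Imm 6 1]) \<rho> 7
     (\<lambda>\<rho>'. \<rho>' = \<rho>(8 := 0, 7 := p, 5 := q, 3 := 0, 4 := 1, 6 := 1))"
    using assms by (intro ensures_basicI) (auto simp flip: length_greater_0_conv)
next
  fix \<rho>' assume *: "\<rho>' = \<rho>(8 := 0, 7 := p, 5 := q, 3 := 0, 4 := 1, 6 := 1)"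
  show "ensures w D descend \<rho>' (42 * n + 2)
    (\<lambda>\<rho>'. \<rho>' 3 = f mod p \<and> \<rho>' 4 = g mod p \<and> \<rho>' 7 = p \<and> agree {0, 1, 14, 15} \<rho> \<rho>')"
    by (rule ensures_mono[OF descend_correct[OF assms(1-4)]]) (use assms * in auto)
qed simp

section \<open>Fingerprints and derivation trees\<close>

primrec hash :: "nat \<Rightarrow> nat list \<Rightarrow> nat" where
  "hash c [] = 0"
| "hash c (a # x) = c * (a + hash c x)"

lemma hash_append: "hash c (x @ y) = hash c x + c ^ length x * hash c y"
  by (induction x) (auto simp: algebra_simps)

lemma hash_eq_sum: "hash c x = (\<Sum>i = 1..length x. x ! (i - 1) * c ^ i)"
proof (induction x)
  case (Cons a x)
  have "(\<Sum>i = 1..length (a # x). (a # x) ! (i - 1) * c ^ i) =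
      (\<Sum>i = 0..length x. (a # x) ! i * c ^ Suc i)"
    using sum.shift_bounds_cl_Suc_ivl[of "\<lambda>i. (a # x) ! (i - 1) * c ^ i" 0 "length x"] by simp
  also have "\<dots> = a * c + (\<Sum>i = 1..length x. x ! (i - 1) * c ^ Suc i)"
    by (subst sum.atLeast_Suc_atMost) (auto intro!: sum.cong simp: nth_Cons')
  also have "\<dots> = c * (a + hash c x)"
    by (simp add: Cons algebra_simps sum_distrib_left)
  finally show ?case by simp
qed simp

lemma fingerprint_eq_hash: "fingerprint c p x = hash c x mod p"
  by (simp add: fingerprint_def hash_eq_sum)

lemma take_eq_substring:
  assumes "1 \<le> i" "i \<le> j" "j \<le> length S"
  shows "take j S = take (i - 1) S @ substring S i j"
proof -
  have "substring S i j = take (Suc j - i) (drop (i - 1) S)"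
    by (rule nth_equalityI) (use assms in \<open>auto simp: substring_def nth_append simp del: upt_Suc\<close>)
  moreover have "take j S = take (i - 1) S @ take (j - (i - 1)) (drop (i - 1) S)"
    using assms take_add[of "i - 1" "j - (i - 1)" S] by simp
  ultimately show ?thesis using assms by (simp add: Suc_diff_le)
qed

text \<open>Here \<open>a\<close> stands for the hash of the prefix of length \<open>k\<close> and
  \<open>b\<close> for that of the wanted substring. Adding \<open>p\<close> before subtracting
  keeps the difference non-negative, and \<open>d ^ k\<close> cancels \<open>c ^ k\<close>.\<close>

lemma mod_cancel_prefix:
  fixes c d p a b :: nat
  assumes "[c * d = 1] (mod p)" "1 < p"
  shows "((a + c ^ k * b) mod p + p - a mod p) * (d ^ k mod p) mod p = b mod p"
proof -
  have "[(a + c ^ k * b) mod p + p - a mod p = c ^ k * b] (mod p)"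
  proof -
    have le: "a mod p \<le> (a + c ^ k * b) mod p + p"
      using assms(2) mod_less_divisor[of p a] by linarith
    have "[(a + c ^ k * b) mod p + p = a mod p + c ^ k * b] (mod p)"
      by (simp add: Cong.cong_def mod_simps)
    then have "[(a + c ^ k * b) mod p + p - a mod p + a mod p = c ^ k * b + a mod p] (mod p)"
      using le by (simp add: add.commute)
    then show ?thesis using cong_add_rcancel_nat by blast
  qed
  then have "[((a + c ^ k * b) mod p + p - a mod p) * (d ^ k mod p) = c ^ k * b * d ^ k] (mod p)"
    by (intro cong_mult) (simp_all add: Cong.cong_def)
  also have "c ^ k * b * d ^ k = (c * d) ^ k * b" by (simp add: power_mult_distrib)
  also have "[(c * d) ^ k * b = 1 ^ k * b] (mod p)"
    using assms(1) by (intro cong_mult cong_pow) auto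
  finally show ?thesis by (simp add: Cong.cong_def)
qed

section \<open>Derivation trees, their subtrees and numbers of occurrences\<close>

datatype tree = Leaf nat | Node tree tree

primrec yield :: "tree \<Rightarrow> nat list" where
  "yield (Leaf a) = [a]"
| "yield (Node l r) = yield l @ yield r"

abbreviation width :: "tree \<Rightarrow> nat" where
  "width t \<equiv> length (yield t)"

primrec subtrees :: "tree \<Rightarrow> tree set" where
  "subtrees (Leaf a) = {Leaf a}"
| "subtrees (Node l r) = insert (Node l r) (subtrees l \<union> subtrees r)"

primrec occurrences :: "tree \<Rightarrow> tree \<Rightarrow> nat" where
  "occurrences (Leaf a) s = of_bool (s = Leaf a)"
| "occurrences (Node l r) s = of_bool (s = Node l r) + occurrences l s + occurrences r s"

definition child :: "tree \<Rightarrow> tree \<Rightarrow> bool" where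
  "child s u \<longleftrightarrow> (\<exists>l r. s = Node l r \<and> (u = l \<or> u = r))"

lemma yield_not_Nil [simp]: "yield t \<noteq> []"
  by (induction t) auto

lemma width_ge_1: "1 \<le> width t"
  by (cases "yield t") auto

lemma finite_subtrees [simp]: "finite (subtrees t)"
  by (induction t) auto

lemma subtrees_refl [simp]: "t \<in> subtrees t"
  by (cases t) auto

lemma subtrees_trans: "s \<in> subtrees t \<Longrightarrow> u \<in> subtrees s \<Longrightarrow> u \<in> subtrees t"
  by (induction t) auto

lemma child_in_subtrees: "child s u \<Longrightarrow> u \<in> subtrees s"
  by (auto simp: child_def)

lemma width_child: "child s u \<Longrightarrow> width u < width s"
  by (auto simp: child_def)

lemma width_subtrees: "s \<in> subtrees t \<Longrightarrow> width s \<le> width t"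
  by (induction t) auto

lemma subtrees_width_eq: "s \<in> subtrees t \<Longrightarrow> width t \<le> width s \<Longrightarrow> s = t"
proof (cases t)
  case (Node l r)
  assume "s \<in> subtrees t" "width t \<le> width s"
  then show ?thesis
    using Node width_subtrees[of s l] width_subtrees[of s r] width_ge_1[of l] width_ge_1[of r]
    by auto
qed auto

lemma occurrences_outside: "s \<notin> subtrees t \<Longrightarrow> occurrences t s = 0"
  by (induction t) auto

lemma occurrences_narrow: "width t < width s \<Longrightarrow> occurrences t s = 0"
  using occurrences_outside width_subtrees leD by blast

lemma occurrences_refl: "occurrences t t = 1"
  by (cases t) (auto simp: occurrences_narrow)

lemma occurrences_pos: "s \<in> subtrees t \<Longrightarrow> 0 < occurrences t s"
  by (induction t) auto

lemma occurrences_le_width: "occurrences t s \<le> width t"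
proof (induction t)
  case (Node l r)
  then show ?case
    using occurrences_refl[of "Node l r"] width_ge_1[of l] by (cases "s = Node l r") auto
qed auto

lemma occurrences_child: "child s u \<Longrightarrow> occurrences t s \<le> occurrences t u"
proof (induction t)
  case (Node l r)
  show ?case
  proof (cases "s = Node l r")
    case True
    then have "u \<in> subtrees (Node l r)" using Node.prems child_in_subtrees by blast
    then show ?thesis
      using True occurrences_refl[of s] occurrences_pos[of u "Node l r"] by auto
  qed (use Node in auto)
qed (auto simp: child_def)

text \<open>
  Every occurrence of a tree lies below at most one occurrence of a parent, so the occurrences
  of two different parents add up.
\<close>

lemma occurrences_two_parents:
  assumes "child s u" "child s' u" "s \<noteq> s'"
  shows "occurrences t s + occurrences t s' \<le> occurrences t u"
proof (induction t)
  case (Leaf a)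
  then show ?case using assms by (auto simp: child_def)
next
  case (Node l r)
  \<comment> \<open>If the current tree is itself one of the parents, it brings one additional
    occurrence. The child equal to \<open>u\<close> pays for it: \<open>u\<close> occurs in it once
    and neither parent does.\<close>
  have "occurrences u s = 0" "occurrences u s' = 0" "occurrences u u = 1"
    using assms width_child occurrences_narrow occurrences_refl by auto
  then have "1 + occurrences l s + occurrences r s + occurrences l s' + occurrences r s' \<le>
      occurrences l u + occurrences r u" if "u = l \<or> u = r"
    using that Node by auto
  moreover have "u = l \<or> u = r" if "s = Node l r \<or> s' = Node l r"
    using that assms by (auto simp: child_def)
  ultimately show ?case using Node assms(3) by auto
qed

text \<open>
  Along a chain of alike parents and children, the number of occurrences and the width stay within
  a factor of \<open>2\<close>.
\<close>

definition alike :: "tree \<Rightarrow> tree \<Rightarrow> tree \<Rightarrow> bool" where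
  "alike T s u \<longleftrightarrow> floor_log (occurrences T s) = floor_log (occurrences T u) \<and>
     floor_log (width s) = floor_log (width u)"

lemma alike_refl: "alike T s s" by (simp add: alike_def)
lemma alike_trans: "alike T s u \<Longrightarrow> alike T u v \<Longrightarrow> alike T s v" by (simp add: alike_def)

text \<open>Two summands of at least \<open>2 ^ k\<close> exceed every number of logarithm
  \<open>k\<close>. Applied to occurrences this gives a single alike parent, applied to widths a
  single alike child.\<close>

lemma floor_log_add_greater:
  assumes "0 < a" "0 < b" "a + b \<le> c" "floor_log a = floor_log c"
  shows "floor_log b \<noteq> floor_log c"
proof
  assume "floor_log b = floor_log c"
  then have "2 ^ floor_log c \<le> a" "2 ^ floor_log c \<le> b"
    using floor_log_exp2_le[of a] floor_log_exp2_le[of b] assms by simp_all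
  then show False using floor_log_exp2_gt[of c] assms(3) by simp
qed

lemma alike_parent_unique:
  assumes "s \<in> subtrees T" "s' \<in> subtrees T" "child s u" "child s' u" "alike T s u" "alike T s' u"
  shows "s = s'"
  using assms occurrences_two_parents[of s u s' T] occurrences_pos[of s T] occurrences_pos[of s' T]
    floor_log_add_greater[of "occurrences T s" "occurrences T s'" "occurrences T u"]
  by (auto simp: alike_def)

lemma alike_left_right: "alike T (Node l r) l \<Longrightarrow> \<not> alike T (Node l r) r"
  using floor_log_add_greater[of "width l" "width r" "width (Node l r)"] 
  by (auto simp: alike_def)

lemma not_alike_leaf: "\<not> alike T (Node l r) (Leaf a)"
proof -
  have "floor_log (width (Node l r)) \<ge> floor_log 2"
    using width_ge_1[of l] width_ge_1[of r] by (intro floor_log_le_iff) simp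
  moreover have "floor_log (2 * 1) = Suc 0" by (subst floor_log_twice) simp_all
  ultimately have "floor_log (width (Node l r)) \<noteq> floor_log (width (Leaf a))" by simp
  then show ?thesis by (simp add: alike_def)
qed

section \<open>Chains of alike trees and the subtrees that branch off\<close>

primrec chain :: "tree \<Rightarrow> tree \<Rightarrow> tree list" where
  "chain T (Leaf a) = []"
| "chain T (Node l r) = Node l r #
     (if alike T (Node l r) l then chain T l else if alike T (Node l r) r then chain T r else [])"

text \<open>The subtrees that branch off the chain, in string order. The last chain member
  contributes both children, which makes one item more than chain members.\<close>

primrec items :: "tree \<Rightarrow> tree \<Rightarrow> tree list" where
  "items T (Leaf a) = [Leaf a]"
| "items T (Node l r) =
     (if alike T (Node l r) l then items T l @ [r]
      else if alike T (Node l r) r then l # items T r else [l, r])"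

lemma concat_items: "concat (map yield (items T t)) = yield t"
  by (induction t) auto

lemma length_items: "length (items T t) = length (chain T t) + 1"
  by (induction t) auto

lemma chain_subtrees: "set (chain T t) \<subseteq> subtrees t"
  by (induction t) auto

lemma distinct_chain: "distinct (chain T t)"
proof (induction t)
  case (Node l r)
  have "Node l r \<notin> subtrees l" "Node l r \<notin> subtrees r"
    using width_subtrees[of "Node l r" l] width_subtrees[of "Node l r" r] by auto
  then show ?case using Node chain_subtrees by auto
qed simp

lemma chain_alike: "s \<in> set (chain T t) \<Longrightarrow> alike T t s"
  by (induction t) (auto split: if_splits intro: alike_refl alike_trans)

lemma chain_infix: "s \<in> set (chain T t) \<Longrightarrow> \<exists>pre post. yield t = pre @ yield s @ post"
proof (induction t)
  case (Node l r)
  then consider "s = Node l r" | "s \<in> set (chain T l)" | "s \<in> set (chain T r)"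
    by (auto split: if_splits)
  then show ?case
  proof cases
    case 1
    then have "yield (Node l r) = [] @ yield s @ []" by simp
    then show ?thesis by blast
  next
    case 2
    then obtain pre post where "yield l = pre @ yield s @ post" using Node.IH(1) by blast
    then have "yield (Node l r) = pre @ yield s @ (post @ yield r)" by simp
    then show ?thesis by blast
  next
    case 3
    then obtain pre post where "yield r = pre @ yield s @ post" using Node.IH(2) by blast
    then have "yield (Node l r) = (yield l @ pre) @ yield s @ post" by simp
    then show ?thesis by blast
  qed
qed simp

lemma chain_refl: "t \<in> set (chain T t) \<longleftrightarrow> (\<exists>l r. t = Node l r)"
  by (cases t) auto

lemma chain_step:
  "s \<in> set (chain T t) \<Longrightarrow> child s u \<Longrightarrow> alike T s u \<Longrightarrow> u \<in> set (chain T t)"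
proof (induction t)
  case (Node l r)
  show ?case
  proof (cases "s = Node l r")
    case True
    have "\<exists>a b. u = Node a b"
      using Node.prems True not_alike_leaf by (cases u) auto
    then have "u \<in> set (chain T u)" by (simp add: chain_refl)
    then show ?thesis using Node.prems True alike_left_right by (auto simp: child_def)
  qed (use Node in \<open>auto split: if_splits\<close>)
qed simp

lemma chain_parent:
  "s \<in> set (chain T t) \<Longrightarrow> s \<noteq> t \<Longrightarrow> \<exists>m\<in>set (chain T t). child m s \<and> alike T m s"
proof (induction t)
  case (Node l r)
  obtain u where u: "u = l \<or> u = r" "alike T (Node l r) u" "s \<in> set (chain T u)"
    "set (chain T u) \<subseteq> set (chain T (Node l r))"
    using Node.prems by (auto split: if_splits)
  show ?case
  proof (cases "s = u")
    case True
    then show ?thesis using u by (intro bexI[of _ "Node l r"]) (auto simp: child_def)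
  next
    case False
    then show ?thesis using u Node.IH by blast
  qed
qed simp

definition tops :: "tree \<Rightarrow> tree set" where
  "tops T = {t \<in> subtrees T. (\<exists>l r. t = Node l r) \<and>
     \<not> (\<exists>s\<in>subtrees T. child s t \<and> alike T s t)}"

text \<open>Two chains that meet can be followed upwards together, since alike parents are unique,
  until one of them begins; its first tree then lies on the other.\<close>

lemma chain_connected:
  assumes "t' \<in> subtrees T"
  shows "t \<in> subtrees T \<Longrightarrow> s \<in> set (chain T t) \<Longrightarrow> s \<in> set (chain T t') \<Longrightarrow>
    t \<in> set (chain T t') \<or> t' \<in> set (chain T t)"
proof (induction t)
  case (Node l r)
  show ?case
  proof (cases "s = Node l r")
    case True
    then show ?thesis using Node.prems by blast
  next
    case False
    then obtain u where u: "u = l \<or> u = r" "alike T (Node l r) u" "s \<in> set (chain T u)"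
      "set (chain T u) \<subseteq> set (chain T (Node l r))"
      using Node.prems by (auto split: if_splits)
    have sub: "u \<in> subtrees T" using u(1) Node.prems(1) subtrees_trans[of "Node l r" T u] by auto
    have "u \<in> set (chain T t') \<or> t' \<in> set (chain T u)" using u Node.IH Node.prems sub by blast
    then show ?thesis
    proof
      assume in': "u \<in> set (chain T t')"
      show ?thesis
      proof (cases "u = t'")
        case True
        then have "t' \<in> set (chain T u)" using in' by simp
        then show ?thesis using u by blast
      next
        case False
        then obtain m where m: "m \<in> set (chain T t')" "child m u" "alike T m u"
          using chain_parent in' by blast
        have "m = Node l r"
          by (rule alike_parent_unique[of _ T _ u])
            (use m u Node.prems assms chain_subtrees[of T t'] subtrees_trans[of t' T m]
              in \<open>auto simp: child_def\<close>)
        then show ?thesis using m by blast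
      qed
    qed (use u in blast)
  qed
qed simp

lemma chains_disjoint:
  assumes "t \<in> tops T" "t' \<in> tops T" "t \<noteq> t'"
  shows "set (chain T t) \<inter> set (chain T t') = {}"
proof (rule ccontr)
  \<comment> \<open>A top has no alike parent, but every chain member other than the first has
    one.\<close>
  have no_parent: "b \<notin> set (chain T a)" if ab: "a \<in> tops T" "b \<in> tops T" "a \<noteq> b" for a b
  proof
    assume "b \<in> set (chain T a)"
    then obtain m where "m \<in> set (chain T a)" "child m b" "alike T m b"
      using ab(3) chain_parent[of b T a] by auto
    moreover have "m \<in> subtrees T"
      using ab(1) calculation(1) chain_subtrees subtrees_trans[of a T m] by (auto simp: tops_def)
    ultimately show False using ab(2) by (auto simp: tops_def)
  qed
  assume "set (chain T t) \<inter> set (chain T t') \<noteq> {}"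
  then show False
    using chain_connected[of t' T t] assms no_parent by (fastforce simp: tops_def)
qed

text \<open>Climbing to alike parents widens the tree, so it stops, and it stops at a top;
  \<open>chain_step\<close> carries membership back down.\<close>

lemma chain_covers:
  "s \<in> subtrees T \<Longrightarrow> s = Node l r \<Longrightarrow> \<exists>t\<in>tops T. s \<in> set (chain T t)"
proof (induction "width T - width s" arbitrary: s l r rule: less_induct)
  case less
  show ?case
  proof (cases "s \<in> tops T")
    case True
    then show ?thesis using less.prems chain_refl by blast
  next
    case False
    then obtain m where m: "m \<in> subtrees T" "child m s" "alike T m s"
      using less.prems by (auto simp: tops_def)
    have "width T - width m < width T - width s"
      using width_child[OF m(2)] width_subtrees[OF m(1)] by linarith
    moreover obtain l' r' where "m = Node l' r'" using m(2) by (auto simp: child_def)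
    ultimately show ?thesis using less.hyps m chain_step by blast
  qed
qed

text \<open>Disjoint chains have at most \<open>card (subtrees T)\<close> members altogether; each
  chain adds one further item, and there are at most as many tops as subtrees.\<close>

lemma sum_length_items: "(\<Sum>t\<in>tops T. length (items T t)) \<le> 2 * card (subtrees T)"
proof -
  have fin: "finite (tops T)" by (simp add: tops_def)
  have "(\<Sum>t\<in>tops T. length (chain T t)) = (\<Sum>t\<in>tops T. card (set (chain T t)))"
    by (simp add: distinct_card distinct_chain)
  also have "\<dots> = card (\<Union>t\<in>tops T. set (chain T t))"
    by (rule card_UN_disjoint[symmetric]) (use fin chains_disjoint in auto)
  also have "\<dots> \<le> card (subtrees T)"
  proof (rule card_mono)
    show "(\<Union>t\<in>tops T. set (chain T t)) \<subseteq> subtrees T"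
      using chain_subtrees subtrees_trans unfolding tops_def by blast
  qed simp
  finally have "(\<Sum>t\<in>tops T. length (chain T t)) \<le> card (subtrees T)" .
  moreover have "card (tops T) \<le> card (subtrees T)"
    by (rule card_mono) (auto simp: tops_def)
  ultimately show ?thesis by (simp add: length_items sum_Suc)
qed

text \<open>An item is a child of a chain member without being alike to it. As all chain members are
  alike, it differs from \<open>s\<close> in at least one logarithm, and the direction is known
  because widths shrink and occurrences grow downwards. This is the progress that pays for one
  search.\<close>

lemma items_properties:
  assumes "s \<in> subtrees T" "s = Node l r" "u \<in> set (items T s)"
  shows "u \<in> subtrees s \<and> width u < width s \<and> occurrences T s \<le> occurrences T u \<and> \<not> alike T s u"
  using assms
proof (induction s arbitrary: l r)
  case (Node a b)
  have direct: ?case if "child (Node a b) u" "\<not> alike T (Node a b) u"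
    using that child_in_subtrees[OF that(1)] width_child[OF that(1)] occurrences_child[OF that(1)]
    by simp
  have step: ?case
    if v: "child (Node a b) v" "alike T (Node a b) v" "u \<in> set (items T v)" "v = a \<or> v = b" for v
  proof -
    obtain l' r' where v': "v = Node l' r'" using v(2) not_alike_leaf by (cases v) auto
    have "v \<in> subtrees T" using Node.prems(1) v(1) child_in_subtrees subtrees_trans by blast
    then have IH: "u \<in> subtrees v" "width u < width v" "occurrences T v \<le> occurrences T u" "\<not> alike T v u"
      using Node.IH[of l' r'] v' v(3,4) by blast+
    have "u \<in> subtrees (Node a b)" using IH(1) child_in_subtrees[OF v(1)] subtrees_trans by blast
    moreover have "width u < width (Node a b)" using IH(2) width_child[OF v(1)] by linarith
    moreover have "occurrences T (Node a b) \<le> occurrences T u"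
      using IH(3) occurrences_child[OF v(1), of T] by linarith
    moreover have "\<not> alike T (Node a b) u" using IH(4) v(2) by (simp add: alike_def)
    ultimately show ?thesis by blast
  qed
  consider v where "child (Node a b) v" "alike T (Node a b) v" "u \<in> set (items T v)" "v = a \<or> v = b"
    | "child (Node a b) u" "\<not> alike T (Node a b) u"
  proof (cases "alike T (Node a b) a")
    case True
    then have "\<not> alike T (Node a b) b" by (rule alike_left_right)
    then show ?thesis using True Node.prems(3) that by (auto simp: child_def)
  next
    case False
    then show ?thesis
      using Node.prems(3) that by (cases "alike T (Node a b) b") (auto simp: child_def)
  qed
  then show ?case
  proof cases
    case 1
    then show ?thesis by (rule step)
  next
    case 2
    then show ?thesis by (rule direct)
  qed
qed simp

section \<open>Fingerprints of substrings\<close>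

text \<open>
  The subroutine \<open>lk\<close> takes a position \<open>x\<close> in register \<open>2\<close> and returns \<open>F x\<close>, \<open>d ^ x\<close> and \<open>p\<close> in
  registers \<open>3\<close>, \<open>4\<close> and \<open>7\<close>.
\<close>

definition range_query :: "com \<Rightarrow> com" where
  "range_query lk =
    Seq (Basic [Imm 2 1, Alu Sub 2 0 2])
   (Seq lk
   (Seq (Basic [Imm 8 0, Alu Add 14 3 8, Alu Add 15 4 8, Alu Add 2 1 8])
   (Seq lk
     (Basic [Alu Add 3 3 7, Alu Sub 3 3 14, Alu Mul 3 3 15, Alu Mod 0 3 7]))))"

lemma range_query_correct:
  assumes lookup: "\<And>x \<rho>. x \<le> N \<Longrightarrow> \<rho> 2 = x \<Longrightarrow> ensures w D lk \<rho> T
     (\<lambda>\<rho>'. \<rho>' 3 = F x mod p \<and> \<rho>' 4 = G x mod p \<and> \<rho>' 7 = p \<and> agree {0, 1, 14, 15} \<rho> \<rho>')"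
    and ij: "1 \<le> i" "i \<le> N" "j \<le> N" and w: "N < 2 ^ w" "2 * (p * p) < 2 ^ w" "16 < (2 :: nat) ^ w"
    and p1: "1 < p"
  shows "ensures w D (range_query lk) ((\<lambda>_. 0)(0 := i, 1 := j)) (2 * T + 10)
    (\<lambda>\<rho>. \<rho> 0 = (F j mod p + p - F (i - 1) mod p) * (G (i - 1) mod p) mod p)"
proof -
  have p: "2 * p < 2 ^ w" using w(2) p1 mult_le_mono1[of 2 p p] by linarith
  have fg: "F x mod p < p" "G x mod p < p" for x using p1 by auto
  have fg': "F x mod p < 2 ^ w" "G x mod p < 2 ^ w" "F x mod p + p < 2 ^ w" for x
    using p fg[of x] by linarith+
  have i: "i - 1 \<le> N" "i < 2 ^ w" "j < 2 ^ w" using ij w(1) by linarith+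
  have A1: "ensures w D (Basic [Imm 2 1, Alu Sub 2 0 2]) ((\<lambda>_. 0)(0 := i, 1 := j)) 2
      (\<lambda>\<rho>. \<rho> 2 = i - 1 \<and> \<rho> 1 = j)"
    using ij i w by (intro ensures_basicI) simp_all
  have A2: "ensures w D lk \<rho> T
      (\<lambda>\<rho>. \<rho> 3 = F (i - 1) mod p \<and> \<rho> 4 = G (i - 1) mod p \<and> \<rho> 1 = j)"
    if "\<rho> 2 = i - 1 \<and> \<rho> 1 = j" for \<rho>
    by (rule ensures_mono[OF lookup[OF i(1)]]) (use that in auto)
  have A3: "ensures w D (Basic [Imm 8 0, Alu Add 14 3 8, Alu Add 15 4 8, Alu Add 2 1 8]) \<rho> 4
      (\<lambda>\<rho>. \<rho> 14 = F (i - 1) mod p \<and> \<rho> 15 = G (i - 1) mod p \<and> \<rho> 2 = j)"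
    if "\<rho> 3 = F (i - 1) mod p \<and> \<rho> 4 = G (i - 1) mod p \<and> \<rho> 1 = j" for \<rho>
    using that i fg' by (intro ensures_basicI) simp_all
  have A4: "ensures w D lk \<rho> T (\<lambda>\<rho>. \<rho> 3 = F j mod p \<and> \<rho> 7 = p \<and>
      \<rho> 14 = F (i - 1) mod p \<and> \<rho> 15 = G (i - 1) mod p)"
    if "\<rho> 14 = F (i - 1) mod p \<and> \<rho> 15 = G (i - 1) mod p \<and> \<rho> 2 = j" for \<rho>
    by (rule ensures_mono[OF lookup[OF ij(3)]]) (use that in auto)
  have A5: "ensures w D (Basic [Alu Add 3 3 7, Alu Sub 3 3 14, Alu Mul 3 3 15, Alu Mod 0 3 7]) \<rho> 4
      (\<lambda>\<rho>. \<rho> 0 = (F j mod p + p - F (i - 1) mod p) * (G (i - 1) mod p) mod p)"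
    if "\<rho> 3 = F j mod p \<and> \<rho> 7 = p \<and> \<rho> 14 = F (i - 1) mod p \<and> \<rho> 15 = G (i - 1) mod p" for \<rho>
  proof -
    \<comment> \<open>The difference may come close to \<open>2 * p\<close>, hence the bound on
      \<open>2 * (p * p)\<close> rather than \<open>p * p\<close>.\<close>
    have "(F j mod p + p - F (i - 1) mod p) * (G (i - 1) mod p) \<le> (2 * p) * p"
      using fg[of j] fg[of "i - 1"] by (intro mult_le_mono) linarith+
    then have "(F j mod p + p - F (i - 1) mod p) * (G (i - 1) mod p) < 2 ^ w" using w(2) by simp
    moreover have "F (i - 1) mod p \<le> F j mod p + p" using fg(1)[of "i - 1"] by linarith
    ultimately show ?thesis using that fg'[of j] fg'[of "i - 1"] by (intro ensures_basicI) simp_all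
  qed
  show ?thesis unfolding range_query_def
    by (rule ensures_seq[OF A1 ensures_seq[OF A2 ensures_seq[OF A3 ensures_seq[OF A4 A5 le_refl]
            le_refl] le_refl]]) simp_all
qed

theorem range_query_supports:
  assumes lookup: "\<And>x \<rho>. x \<le> length S \<Longrightarrow> \<rho> 2 = x \<Longrightarrow> ensures w D lk \<rho> T
     (\<lambda>\<rho>'. \<rho>' 3 = hash c (take x S) mod p \<and> \<rho>' 4 = d ^ x mod p \<and> \<rho>' 7 = p \<and> agree {0, 1, 14, 15} \<rho> \<rho>')"
    and inverse: "[c * d = 1] (mod p)" and p: "1 < p"
    and w: "length S < 2 ^ w" "2 * (p * p) < 2 ^ w" "16 < (2 :: nat) ^ w"
  shows "supports_fingerprint w (comp 0 (range_query lk) @ [Halt]) D c p S (real (2 * T + 10))"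
proof -
  have "\<exists>k\<le>2 * T + 10. answers w (comp 0 (range_query lk) @ [Halt]) D i j k (fingerprint c p (substring S i j))"
    if ij: "1 \<le> i" "i \<le> j" "j \<le> length S" for i j
  proof -
    have iN: "i \<le> length S" using ij by linarith
    note query = range_query_correct[where N = "length S" and F = "\<lambda>x. hash c (take x S)" and G = "\<lambda>x. d ^ x",
        OF lookup ij(1) iN ij(3) w p]
    have "take j S = take (i - 1) S @ substring S i j" using take_eq_substring ij by blast
    moreover have "length (take (i - 1) S) = i - 1" using ij by simp
    ultimately have "hash c (take j S) = hash c (take (i - 1) S) + c ^ (i - 1) * hash c (substring S i j)"
      by (simp only: hash_append)
    then have "(hash c (take j S) mod p + p - hash c (take (i - 1) S) mod p) * (d ^ (i - 1) mod p) mod p =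
        fingerprint c p (substring S i j)"
      unfolding fingerprint_eq_hash by (simp only: mod_cancel_prefix[OF inverse p])
    with query have "ensures w D (range_query lk) ((\<lambda>_. 0)(0 := i, 1 := j)) (2 * T + 10)
        (\<lambda>\<rho>. \<rho> 0 = fingerprint c p (substring S i j))" by (simp only:)
    from answers_ensures[OF this] show ?thesis .
  qed
  then show ?thesis unfolding supports_fingerprint_def of_nat_le_iff by simp
qed

section \<open>Biased search trees\<close>

text \<open>A node stores the whole string in front of its item, not only the length, since the
  record written to memory also needs its hash.\<close>

datatype bst = Tip | Bin bst "nat list" tree bst

primrec cells :: "bst \<Rightarrow> bst set" where
  "cells Tip = {}"
| "cells (Bin l u v r) = insert (Bin l u v r) (cells l \<union> cells r)"

text \<open>
  \<open>locate B x n u v\<close>: \<open>n\<close> steps down \<open>B\<close> lead to the item \<open>v\<close> that contains position \<open>x\<close>; it is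
  preceded by the string \<open>u\<close>.
\<close>

inductive locate :: "bst \<Rightarrow> nat \<Rightarrow> nat \<Rightarrow> nat list \<Rightarrow> tree \<Rightarrow> bool" where
  here: "length u \<le> x \<Longrightarrow> x < length u + width v \<Longrightarrow> locate (Bin l u v r) x 1 u v"
| left: "x < length u' \<Longrightarrow> locate l x n u v \<Longrightarrow> locate (Bin l u' v' r) x (Suc n) u v"
| right: "length u' + width v' \<le> x \<Longrightarrow> locate r x n u v \<Longrightarrow> locate (Bin l u' v' r) x (Suc n) u v"

lemma finite_cells [simp]: "finite (cells B)"
  by (induction B) auto

lemma cells_refl: "B \<in> cells B \<longleftrightarrow> B \<noteq> Tip"
  by (cases B) auto

lemma cells_trans: "B' \<in> cells B \<Longrightarrow> cells B' \<subseteq> cells B"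
  by (induction B) auto

lemma locate_cell:
  "locate B x n u v \<Longrightarrow> length u \<le> x \<and> x < length u + width v \<and> (\<exists>l r. Bin l u v r \<in> cells B)"
  by (induction rule: locate.induct) auto

text \<open>\<open>y\<close> is the item in which the accumulated weight passes one half, so neither
  what precedes it nor what follows it weighs more than \<open>W / 2\<close>. The accumulator
  \<open>a\<close> is the weight already passed.\<close>

lemma split_at_half:
  fixes f :: "'a \<Rightarrow> nat"
  assumes "xs \<noteq> []" "2 * a \<le> W" "a + (\<Sum>x\<leftarrow>xs. f x) = W"
  shows "\<exists>ps y qs. xs = ps @ y # qs \<and> 2 * (a + (\<Sum>x\<leftarrow>ps. f x)) \<le> W \<and> 2 * (\<Sum>x\<leftarrow>qs. f x) \<le> W"
  using assms
proof (induction xs arbitrary: a)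
  case (Cons x xs)
  show ?case
  proof (cases "2 * (\<Sum>x\<leftarrow>xs. f x) \<le> W")
    case True
    have "x # xs = [] @ x # xs" "2 * (a + (\<Sum>x\<leftarrow>[]. f x)) \<le> W" using Cons.prems by auto
    with True show ?thesis by blast
  next
    case False
    then have "xs \<noteq> []" "2 * (a + f x) \<le> W" "a + f x + (\<Sum>x\<leftarrow>xs. f x) = W" using Cons.prems by auto
    then obtain ps y qs where "xs = ps @ y # qs" "2 * (a + f x + (\<Sum>x\<leftarrow>ps. f x)) \<le> W"
      "2 * (\<Sum>x\<leftarrow>qs. f x) \<le> W"
      using Cons.IH by blast
    then have "x # xs = (x # ps) @ y # qs" "2 * (a + (\<Sum>x\<leftarrow>x # ps. f x)) \<le> W"
      "2 * (\<Sum>x\<leftarrow>qs. f x) \<le> W" by auto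
    then show ?thesis by blast
  qed
qed simp

text \<open>The last bound reads \<open>n \<le> 1 + log (W / width v)\<close>: with the item at the
  middle of the string as root, the weight halves at each step. The multiplicative form needs no
  real logarithms.\<close>

definition searches :: "bst \<Rightarrow> nat list \<Rightarrow> tree list \<Rightarrow> bool" where
  "searches B pre ts \<longleftrightarrow> card (cells B) \<le> length ts \<and>
     (\<forall>l u v r. Bin l u v r \<in> cells B \<longrightarrow> (\<exists>ps qs. ts = ps @ v # qs \<and> u = pre @ concat (map yield ps))) \<and>
     (\<forall>x. length pre \<le> x \<longrightarrow> x < length pre + length (concat (map yield ts)) \<longrightarrow>
        (\<exists>n u v. locate B x n u v \<and> width v * 2 ^ n \<le> 2 * length (concat (map yield ts))))"

lemma searches_Bin:
  assumes l: "searches l pre ps" and r: "searches r (pre @ concat (map yield (ps @ [t]))) qs"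
    and half: "2 * length (concat (map yield ps)) \<le> length (concat (map yield (ps @ t # qs)))"
      "2 * length (concat (map yield qs)) \<le> length (concat (map yield (ps @ t # qs)))"
  shows "searches (Bin l (pre @ concat (map yield ps)) t r) pre (ps @ t # qs)"
proof -
  let ?u = "pre @ concat (map yield ps)" and ?W = "length (concat (map yield (ps @ t # qs)))"
  let ?B = "Bin l ?u t r"
  have "card (cells ?B) \<le> Suc (card (cells l) + card (cells r))"
    using card_insert_le_m1 card_Un_le[of "cells l" "cells r"]
    by (simp add: card_insert_if)
  then have card: "card (cells ?B) \<le> length (ps @ t # qs)"
    using l r by (auto simp: searches_def)
  have items: "\<exists>ps' qs'. ps @ t # qs = ps' @ v # qs' \<and> u = pre @ concat (map yield ps')"
    if "Bin l' u v r' \<in> cells ?B" for l' u v r'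
  proof -
    from that consider "u = ?u" "v = t" | "Bin l' u v r' \<in> cells l" | "Bin l' u v r' \<in> cells r"
      by auto
    then show ?thesis
    proof cases
      case 1
      then show ?thesis by blast
    next
      case 2
      then obtain ps' qs' where "ps = ps' @ v # qs'" "u = pre @ concat (map yield ps')"
        using l unfolding searches_def by blast
      then have "ps @ t # qs = ps' @ v # (qs' @ t # qs)" by simp
      then show ?thesis using \<open>u = _\<close> by blast
    next
      case 3
      then obtain ps' qs' where *: "qs = ps' @ v # qs'"
        "u = (pre @ concat (map yield (ps @ [t]))) @ concat (map yield ps')"
        using r unfolding searches_def by blast
      then have "ps @ t # qs = (ps @ t # ps') @ v # qs'"
        "u = pre @ concat (map yield (ps @ t # ps'))" by simp_all
      then show ?thesis by blast
    qed
  qed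
  have "\<exists>n u v. locate ?B x n u v \<and> width v * 2 ^ n \<le> 2 * ?W"
    if x: "length pre \<le> x" "x < length pre + ?W" for x
  proof -
    consider "x < length ?u" | "length ?u \<le> x" "x < length ?u + width t" | "length ?u + width t \<le> x"
      by linarith
    then show ?thesis
    proof cases
      case 1
      then have "x < length pre + length (concat (map yield ps))" by simp
      then obtain n u v where n: "locate l x n u v" "width v * 2 ^ n \<le> 2 * length (concat (map yield ps))"
        using l x(1) unfolding searches_def by blast
      then have "width v * 2 ^ Suc n \<le> 2 * ?W" using half(1) by simp
      then show ?thesis using locate.left[OF 1 n(1)] by blast
    next
      case 2
      have "width t * 2 ^ 1 \<le> 2 * ?W" by simp
      then show ?thesis using locate.here[OF 2] by blast
    next
      case 3
      have "length (pre @ concat (map yield (ps @ [t]))) \<le> x"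
        "x < length (pre @ concat (map yield (ps @ [t]))) + length (concat (map yield qs))"
        using 3 x by simp_all
      then obtain n u v where n: "locate r x n u v" "width v * 2 ^ n \<le> 2 * length (concat (map yield qs))"
        using r unfolding searches_def by blast
      then have "width v * 2 ^ Suc n \<le> 2 * ?W" using half(2) by simp
      then show ?thesis using locate.right[OF 3 n(1)] by blast
    qed
  qed
  then show ?thesis unfolding searches_def using card items by blast
qed

lemma searches_exists: "\<exists>B. searches B pre ts"
proof (induction "length ts" arbitrary: pre ts rule: less_induct)
  case less
  show ?case
  proof (cases "ts = []")
    case True
    then have "searches Tip pre ts" by (simp add: searches_def)
    then show ?thesis by blast
  next
    case False
    have "\<exists>ps t qs. ts = ps @ t # qs \<and> 2 * (0 + (\<Sum>t\<leftarrow>ps. width t)) \<le> (\<Sum>t\<leftarrow>ts. width t) \<and>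
        2 * (\<Sum>t\<leftarrow>qs. width t) \<le> (\<Sum>t\<leftarrow>ts. width t)"
      by (rule split_at_half[OF False]) simp_all
    then obtain ps t qs where ts: "ts = ps @ t # qs"
      and half: "2 * (0 + (\<Sum>t\<leftarrow>ps. width t)) \<le> (\<Sum>t\<leftarrow>ts. width t)"
        "2 * (\<Sum>t\<leftarrow>qs. width t) \<le> (\<Sum>t\<leftarrow>ts. width t)"
      by blast
    have len: "length (concat (map yield us)) = (\<Sum>t\<leftarrow>us. width t)" for us
      by (induction us) auto
    obtain l where l: "searches l pre ps" using less[of ps pre] ts by auto
    obtain r where r: "searches r (pre @ concat (map yield (ps @ [t]))) qs"
      using less[of qs] ts by fastforce
    show ?thesis using searches_Bin[OF l r] half unfolding ts len[symmetric] by auto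
  qed
qed

section \<open>The index of a derivation tree\<close>

locale tree_index =
  fixes T :: tree and c d p w :: nat
  assumes T_Node: "\<exists>l r. T = Node l r"
    and inverse: "[c * d = 1] (mod p)"
    and p: "1 < p" "p < 2 ^ w"
    and fits: "2 * width T < 2 ^ w" "18 * card (subtrees T) + 2 < 2 ^ w"
begin

definition top_bst :: "tree \<Rightarrow> bst" where
  "top_bst t = (SOME B. searches B [] (items T t))"

definition host :: "tree \<Rightarrow> tree" where
  "host s = (case s of Leaf a \<Rightarrow> s | Node l r \<Rightarrow> SOME t. t \<in> tops T \<and> s \<in> set (chain T t))"

definition offset :: "tree \<Rightarrow> nat" where
  "offset s = (case s of Leaf a \<Rightarrow> 0 | Node l r \<Rightarrow>
     SOME k. \<exists>pre post. yield (host s) = pre @ yield s @ post \<and> k = length pre)"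

definition entry :: "tree \<Rightarrow> bst" where
  "entry s = (case s of Leaf a \<Rightarrow> Tip | Node l r \<Rightarrow> top_bst (host s))"

definition all_cells :: "bst set" where
  "all_cells = (\<Union>t\<in>tops T. cells (top_bst t))"

definition cell_number :: "bst \<Rightarrow> nat" where
  "cell_number = (SOME h. bij_betw h all_cells {0..<card all_cells})"

text \<open>Cells start behind the two header words, which leaves address \<open>0\<close> free to
  denote the empty tree.\<close>

definition address :: "bst \<Rightarrow> nat" where
  "address B = (if B = Tip then 0 else 2 + 9 * cell_number B)"

text \<open>In the host of \<open>v\<close> the item is preceded by \<open>offset v\<close>
  characters, so its contribution there carries the factor \<open>c ^ offset v\<close>. Here it
  follows \<open>u\<close> and has to carry \<open>c ^ length u\<close> instead.\<close>

definition scale :: "nat list \<Rightarrow> tree \<Rightarrow> nat" where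
  "scale u v = c ^ length u * d ^ offset v"

text \<open>Subtraction modulo \<open>p\<close> is multiplication by \<open>p - 1\<close>.\<close>

definition shift :: "nat list \<Rightarrow> tree \<Rightarrow> nat" where
  "shift u v = hash c u + scale u v * ((p - 1) * hash c (take (offset v) (yield (host v))))"

primrec record_of :: "bst \<Rightarrow> nat list" where
  "record_of Tip = []"
| "record_of (Bin l u v r) =
    [length u, length u + width v, address l, address r, address (entry v), offset v,
     shift u v mod p, scale u v mod p, d ^ length u * c ^ offset v mod p]"

definition memory :: "nat list" where
  "memory = p # address (entry T) #
     map (\<lambda>a. record_of (inv_into all_cells cell_number (a div 9)) ! (a mod 9)) [0..<9 * card all_cells]"

lemma searches_top_bst: "searches (top_bst t) [] (items T t)"
  unfolding top_bst_def by (rule someI_ex) (rule searches_exists)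

lemma host_Node:
  assumes "s \<in> subtrees T" "s = Node l r"
  shows "host s \<in> tops T" "s \<in> set (chain T (host s))"
proof -
  have "\<exists>t. t \<in> tops T \<and> s \<in> set (chain T t)" using chain_covers[OF assms] by blast
  from someI_ex[OF this] show "host s \<in> tops T" "s \<in> set (chain T (host s))"
    using assms(2) by (auto simp: host_def)
qed

lemma host_alike: "s \<in> subtrees T \<Longrightarrow> alike T (host s) s"
proof (cases s)
  case (Node l r)
  assume "s \<in> subtrees T"
  then show ?thesis using host_Node(2)[OF _ Node] chain_alike by blast
qed (simp add: host_def alike_refl)

lemma host_subtrees: "s \<in> subtrees T \<Longrightarrow> host s \<in> subtrees T"
proof (cases s)
  case (Node l r)
  assume "s \<in> subtrees T"
  then show ?thesis using host_Node(1)[OF _ Node] by (auto simp: tops_def)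
qed (simp add: host_def)

lemma yield_host:
  assumes "s \<in> subtrees T"
  shows "\<exists>pre post. yield (host s) = pre @ yield s @ post \<and> offset s = length pre"
proof (cases s)
  case (Leaf a)
  then show ?thesis by (simp add: host_def offset_def)
next
  case (Node l r)
  have "\<exists>k pre post. yield (host s) = pre @ yield s @ post \<and> k = length pre"
    using chain_infix[OF host_Node(2)[OF assms Node]] by blast
  from someI_ex[OF this] show ?thesis using Node by (simp add: offset_def)
qed

lemma offset_bound: "s \<in> subtrees T \<Longrightarrow> offset s + width s \<le> width (host s)"
  using yield_host by fastforce

text \<open>The host of \<open>T\<close> is a subtree of \<open>T\<close> that has \<open>T\<close>
  as a subtree. Hence a walk from the root cell starts at the queried position itself.\<close>

lemma offset_T: "offset T = 0" and host_T: "host T = T"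
proof -
  obtain l r where T: "T = Node l r" using T_Node by blast
  have "T \<in> subtrees (host T)"
    using host_Node(2)[OF _ T] chain_subtrees by fastforce
  then show host: "host T = T"
    using subtrees_width_eq[of "host T" T] host_subtrees[of T] width_subtrees by simp
  show "offset T = 0" using offset_bound[of T] host by simp
qed

lemma finite_all_cells: "finite all_cells"
  by (simp add: all_cells_def tops_def)

lemma card_all_cells: "card all_cells \<le> 2 * card (subtrees T)"
proof -
  have "card all_cells \<le> (\<Sum>t\<in>tops T. card (cells (top_bst t)))"
    unfolding all_cells_def by (rule card_UN_le) (simp add: tops_def)
  also have "\<dots> \<le> (\<Sum>t\<in>tops T. length (items T t))"
    by (rule sum_mono) (use searches_top_bst in \<open>auto simp: searches_def\<close>)
  finally show ?thesis using sum_length_items[of T] by linarith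
qed

lemma bij_cell_number: "bij_betw cell_number all_cells {0..<card all_cells}"
  unfolding cell_number_def by (rule someI_ex[OF ex_bij_betw_finite_nat[OF finite_all_cells]])

lemma Tip_not_cell: "Tip \<notin> all_cells"
proof -
  have "Tip \<notin> cells B" for B by (induction B) auto
  then show ?thesis by (simp add: all_cells_def)
qed

lemma all_cells_closed: "B \<in> all_cells \<Longrightarrow> cells B \<subseteq> all_cells"
  unfolding all_cells_def using cells_trans by blast

lemma cell_item:
  assumes "Bin l u v r \<in> all_cells"
  obtains t where "t \<in> tops T" "v \<in> set (items T t)" "\<exists>post. yield t = u @ yield v @ post"
proof -
  obtain t where t: "t \<in> tops T" "Bin l u v r \<in> cells (top_bst t)"
    using assms unfolding all_cells_def by blast
  then obtain ps qs where "items T t = ps @ v # qs" "u = [] @ concat (map yield ps)"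
    using searches_top_bst[of t] unfolding searches_def by blast
  then have "yield t = u @ yield v @ concat (map yield qs)" "v \<in> set (items T t)"
    using concat_items[of T t] by simp_all
  then show ?thesis using that t(1) by blast
qed

lemma cell_item_subtree:
  assumes "Bin l u v r \<in> all_cells"
  shows "v \<in> subtrees T" "length u + width v \<le> width T"
proof -
  obtain t post where t: "t \<in> tops T" "v \<in> set (items T t)" "yield t = u @ yield v @ post"
    using cell_item[OF assms] by metis
  then obtain a b where "t \<in> subtrees T" "t = Node a b" by (auto simp: tops_def)
  then show "v \<in> subtrees T" using items_properties t(2) subtrees_trans by blast
  have "length u + width v \<le> width t" using t(3) by simp
  then show "length u + width v \<le> width T" using width_subtrees[OF \<open>t \<in> subtrees T\<close>] by linarith
qed

lemma entry_cell: "v \<in> subtrees T \<Longrightarrow> entry v = Tip \<or> entry v \<in> all_cells"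
proof (cases v)
  case (Node l r)
  assume "v \<in> subtrees T"
  from host_Node(1)[OF this Node] show ?thesis
    using Node cells_refl unfolding entry_def all_cells_def by fastforce
qed (simp add: entry_def)

lemma length_memory: "length memory = 2 + 9 * card all_cells"
  by (simp add: memory_def)

lemma length_memory_le: "length memory \<le> 18 * card (subtrees T) + 2"
  using card_all_cells by (simp add: length_memory)

lemma cell_number_less: "B \<in> all_cells \<Longrightarrow> cell_number B < card all_cells"
  using bij_cell_number by (auto simp: bij_betw_def)

lemma memory_cell:
  assumes "B \<in> all_cells"
  shows "0 < address B" "address B + 8 < length memory"
    and "k < 9 \<Longrightarrow> memory ! (address B + k) = record_of B ! k"
proof -
  have B: "B \<noteq> Tip" using assms Tip_not_cell by blast
  note n = cell_number_less[OF assms]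
  show "0 < address B" "address B + 8 < length memory"
    using B n by (auto simp: address_def length_memory)
  show "memory ! (address B + k) = record_of B ! k" if "k < 9"
  proof -
    have "inv_into all_cells cell_number (cell_number B) = B"
      using bij_cell_number assms by (simp add: bij_betw_def)
    moreover have "9 * cell_number B + k < 9 * card all_cells" using n that by linarith
    ultimately show ?thesis
      using that B by (simp add: memory_def address_def nth_append)
  qed
qed

lemma address_less: "B = Tip \<or> B \<in> all_cells \<Longrightarrow> address B < 2 ^ w"
  using memory_cell(2)[of B] length_memory_le fits by (auto simp: address_def)

lemma record_words: "B \<in> all_cells \<Longrightarrow> x \<in> set (record_of B) \<Longrightarrow> x < 2 ^ w"
proof (cases B)
  case (Bin l u v r)
  assume B: "B \<in> all_cells" and x: "x \<in> set (record_of B)"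
  note v = cell_item_subtree[OF B[unfolded Bin]]
  have "l = Tip \<or> l \<in> all_cells" "r = Tip \<or> r \<in> all_cells"
    using all_cells_closed[OF B] Bin cells_refl by auto
  then have "address l < 2 ^ w" "address r < 2 ^ w" "address (entry v) < 2 ^ w"
    using address_less entry_cell[OF v(1)] by auto
  moreover have "offset v \<le> width T"
    using offset_bound[OF v(1)] width_subtrees[OF host_subtrees[OF v(1)]] by linarith
  moreover have "y mod p < 2 ^ w" for y using p mod_less_divisor[of p y] by linarith
  ultimately show ?thesis using x v(2) fits Bin by auto
qed (use Tip_not_cell in blast)

lemma memory_words: "x \<in> set memory \<Longrightarrow> x < 2 ^ w"
proof -
  assume "x \<in> set memory"
  then consider "x = p" | "x = address (entry T)"
    | a where "a < 9 * card all_cells"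
        "x = record_of (inv_into all_cells cell_number (a div 9)) ! (a mod 9)"
    unfolding memory_def by auto
  then show ?thesis
  proof cases
    case 1
    then show ?thesis using p by simp
  next
    case 2
    then show ?thesis using address_less entry_cell[of T] by simp
  next
    case 3
    have "a div 9 \<in> cell_number ` all_cells"
      using 3(1) bij_cell_number by (auto simp: bij_betw_def)
    then have B: "inv_into all_cells cell_number (a div 9) \<in> all_cells" by (rule inv_into_into)
    then have "length (record_of (inv_into all_cells cell_number (a div 9))) = 9"
      using Tip_not_cell by (cases "inv_into all_cells cell_number (a div 9)") auto
    then show ?thesis using 3(2) record_words[OF B] by (metis mod_less_divisor nth_mem zero_less_numeral)
  qed
qed

section \<open>Correctness and length of a walk through the index\<close>

lemma walk_locate:
  assumes "locate B x n u v" "cells B \<subseteq> all_cells" "x < width T"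
    and "walk w memory p (address (entry v)) (x - length u + offset v) m f g"
  shows "walk w memory p (address B) x (n + m) (shift u v mod p + scale u v mod p * f)
    (d ^ length u * c ^ offset v mod p * g)"
  using assms
proof (induction rule: locate.induct)
  case (here u x v l r)
  then have B: "Bin l u v r \<in> all_cells" by simp
  note rec = memory_cell(3)[OF B]
  have r: "memory ! (address (Bin l u v r)) = length u"
    "memory ! (address (Bin l u v r) + 1) = length u + width v"
    "memory ! (address (Bin l u v r) + 4) = address (entry v)"
    "memory ! (address (Bin l u v r) + 5) = offset v"
    "memory ! (address (Bin l u v r) + 6) = shift u v mod p"
    "memory ! (address (Bin l u v r) + 7) = scale u v mod p"
    "memory ! (address (Bin l u v r) + 8) = d ^ length u * c ^ offset v mod p"
    using rec[of 0] rec[of 1] rec[of 4] rec[of 5] rec[of 6] rec[of 7] rec[of 8] by simp_all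
  have v: "v \<in> subtrees T" using cell_item_subtree[OF B] by simp
  have "offset v + width v \<le> width T"
    using offset_bound[OF v] width_subtrees[OF host_subtrees[OF v]] by linarith
  then have "x - length u + offset v < 2 ^ w" using here.hyps fits by linarith
  moreover have "x < 2 ^ w" using here.prems fits by linarith
  moreover have "0 < p" using p by simp
  ultimately have "walk w memory p (address (Bin l u v r)) x (Suc m)
      (memory ! (address (Bin l u v r) + 6) + memory ! (address (Bin l u v r) + 7) * f)
      (memory ! (address (Bin l u v r) + 8) * g)"
    using memory_cell(1,2)[OF B] here.hyps here.prems
    by (intro walk.enter) (simp_all only: r mod_less_divisor)
  then show ?case by (simp only: r plus_1_eq_Suc)
next
  case (left x u' l n u v v' r)
  then have B: "Bin l u' v' r \<in> all_cells" by simp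
  note rec = memory_cell(3)[OF B]
  have r: "memory ! (address (Bin l u' v' r)) = length u'"
    "memory ! (address (Bin l u' v' r) + 2) = address l"
    using rec[of 0] rec[of 2] by simp_all
  have "walk w memory p (address l) x (n + m) (shift u v mod p + scale u v mod p * f)
    (d ^ length u * c ^ offset v mod p * g)"
    using left by simp
  then have "walk w memory p (address (Bin l u' v' r)) x (Suc (n + m))
     (shift u v mod p + scale u v mod p * f) (d ^ length u * c ^ offset v mod p * g)"
    using memory_cell(1,2)[OF B] left.hyps by (intro walk.left) (simp_all only: r)
  then show ?case by (simp only: add_Suc)
next
  case (right u' v' x r n u v l)
  then have B: "Bin l u' v' r \<in> all_cells" by simp
  note rec = memory_cell(3)[OF B]
  have r: "memory ! (address (Bin l u' v' r)) = length u'"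
    "memory ! (address (Bin l u' v' r) + 1) = length u' + width v'"
    "memory ! (address (Bin l u' v' r) + 3) = address r"
    using rec[of 0] rec[of 1] rec[of 3] by simp_all
  have "walk w memory p (address r) x (n + m) (shift u v mod p + scale u v mod p * f)
    (d ^ length u * c ^ offset v mod p * g)"
    using right by simp
  then have "walk w memory p (address (Bin l u' v' r)) x (Suc (n + m))
     (shift u v mod p + scale u v mod p * f) (d ^ length u * c ^ offset v mod p * g)"
    using memory_cell(1,2)[OF B] right.hyps by (intro walk.right) (simp_all only: r add_leE)
  then show ?case by (simp only: add_Suc)
qed

lemma shift_scale_correct:
  assumes "v \<in> subtrees T" "y < width v"
    and "[f = hash c (take (offset v + y) (yield (host v)))] (mod p)"
  shows "[shift u v mod p + scale u v mod p * f = hash c (u @ take y (yield v))] (mod p)"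
proof -
  obtain pre post where pre: "yield (host v) = pre @ yield v @ post" "offset v = length pre"
    using yield_host[OF assms(1)] by blast
  let ?k = "length pre" and ?h = "hash c (take y (yield v))"
  have "hash c (take (offset v + y) (yield (host v))) = hash c pre + c ^ ?k * ?h"
    using pre assms(2) by (simp add: hash_append)
  then have f: "[f = hash c pre + c ^ ?k * ?h] (mod p)" using assms(3) by simp
  have "[shift u v mod p + scale u v mod p * f = shift u v + scale u v * (hash c pre + c ^ ?k * ?h)] (mod p)"
    by (intro cong_add cong_mult f) (simp_all add: Cong.cong_def)
  also have "shift u v + scale u v * (hash c pre + c ^ ?k * ?h) =
      hash c u + c ^ length u * d ^ ?k * ((p - 1) * hash c pre + hash c pre) + c ^ length u * ((c * d) ^ ?k * ?h)"
    using pre by (simp add: shift_def scale_def algebra_simps power_mult_distrib)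
  \<comment> \<open>\<open>p - 1\<close> further copies complete the part in front of the offset to
    a multiple of \<open>p\<close>, so it drops out.\<close>
  also have "(p - 1) * hash c pre + hash c pre = p * hash c pre"
    using p by (cases p) auto
  also have "[hash c u + c ^ length u * d ^ ?k * (p * hash c pre) + c ^ length u * ((c * d) ^ ?k * ?h) =
      hash c u + c ^ length u * d ^ ?k * (0 * hash c pre) + c ^ length u * (1 ^ ?k * ?h)] (mod p)"
    by (intro cong_add cong_mult cong_pow inverse cong_refl) (simp add: Cong.cong_def)
  finally show ?thesis by (simp add: hash_append)
qed

text \<open>The inner result also counts the offset \<open>k\<close>; \<open>c ^ k\<close> takes
  that back, and \<open>d ^ n\<close> accounts for the \<open>n\<close> characters that precede the
  item here.\<close>

lemma unscale_correct:
  assumes "[g = d ^ (k + y)] (mod p)"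
  shows "[d ^ n * c ^ k mod p * g = d ^ (n + y)] (mod p)"
proof -
  have "[d ^ n * c ^ k mod p * g = (d ^ n * c ^ k) * d ^ (k + y)] (mod p)"
    by (intro cong_mult assms) (simp add: Cong.cong_def)
  also have "(d ^ n * c ^ k) * d ^ (k + y) = (c * d) ^ k * d ^ (n + y)"
    by (simp add: power_add power_mult_distrib)
  also have "[(c * d) ^ k * d ^ (n + y) = 1 ^ k * d ^ (n + y)] (mod p)"
    by (intro cong_mult cong_pow inverse cong_refl)
  finally show ?thesis by simp
qed

lemma occurrences_log_le: "floor_log (occurrences T v) \<le> floor_log (width T)"
  by (intro floor_log_le_iff occurrences_le_width)

text \<open>
  One search for an item \<open>v'\<close> from \<open>v\<close> costs about \<open>log (width v / width v')\<close>, and it strictly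
  decreases the difference of the two logarithms that \<^const>\<open>alike\<close> compares. So the costs
  telescope.
\<close>

lemma walk_entry:
  assumes "v \<in> subtrees T" "y < width v"
  shows "\<exists>n f g. walk w memory p (address (entry v)) (offset v + y) n f g \<and>
     [f = hash c (take (offset v + y) (yield (host v)))] (mod p) \<and> [g = d ^ (offset v + y)] (mod p) \<and>
     n + 2 * floor_log (occurrences T v) \<le> 2 * (floor_log (width v) + floor_log (width T))"
  using assms
proof (induction "floor_log (width v) + floor_log (width T) - floor_log (occurrences T v)"
    arbitrary: v y rule: less_induct)
  case less
  show ?case
  proof (cases v)
    case (Leaf a)
    \<comment> \<open>A leaf has no search tree: the only position inside it is \<open>0\<close>,
      with the values of the empty prefix.\<close>
    have "address (entry v) = 0" using Leaf by (simp add: entry_def address_def)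
    then have "walk w memory p (address (entry v)) (offset v + y) 0 0 1"
      using walk.stop by metis
    moreover have "offset v + y = 0" using Leaf less.prems by (simp add: offset_def)
    then have "[0 = hash c (take (offset v + y) (yield (host v)))] (mod p)" "[1 = d ^ (offset v + y)] (mod p)"
      by simp_all
    moreover have "0 + 2 * floor_log (occurrences T v) \<le> 2 * (floor_log (width v) + floor_log (width T))"
      using occurrences_log_le[of v] by simp
    ultimately show ?thesis by blast
  next
    case (Node a b)
    let ?t = "host v" and ?x = "offset v + y"
    have t: "?t \<in> tops T" "?t \<in> subtrees T" and alike: "alike T ?t v"
      using host_Node[OF less.prems(1) Node] host_subtrees host_alike less.prems(1) by auto
    obtain a' b' where t': "?t = Node a' b'" using t(1) by (auto simp: tops_def)
    have x: "?x < width ?t" using offset_bound[OF less.prems(1)] less.prems(2) by linarith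
    obtain n u v' where n: "locate (top_bst ?t) ?x n u v'" "width v' * 2 ^ n \<le> 2 * width ?t"
      using searches_top_bst[of ?t] x unfolding searches_def concat_items by auto
    obtain l r where cell: "Bin l u v' r \<in> cells (top_bst ?t)" and u: "length u \<le> ?x" "?x < length u + width v'"
      using locate_cell[OF n(1)] by blast
    obtain ps qs where ps: "items T ?t = ps @ v' # qs" "u = [] @ concat (map yield ps)"
      using searches_top_bst[of ?t] cell unfolding searches_def by blast
    have yt: "yield ?t = u @ yield v' @ concat (map yield qs)" using concat_items[of T ?t] ps by simp
    have v': "v' \<in> subtrees ?t" "width v' < width ?t" "occurrences T ?t \<le> occurrences T v'" "\<not> alike T ?t v'"
      using items_properties[OF t(2) t', of v'] ps by auto
    have v'T: "v' \<in> subtrees T" using v'(1) t(2) subtrees_trans by blast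
    let ?y = "?x - length u"
    have y: "?y < width v'" using u by linarith
    \<comment> \<open>The properties of the item refer to the host; they carry over to
      \<open>v\<close> because \<open>v\<close> and its host are alike.\<close>
    have logs: "floor_log (width v') \<le> floor_log (width v)" "floor_log (occurrences T v) \<le> floor_log (occurrences T v')"
      "floor_log (width v') \<noteq> floor_log (width v) \<or> floor_log (occurrences T v) \<noteq> floor_log (occurrences T v')"
      using v' alike floor_log_le_iff[of "width v'" "width ?t"] floor_log_le_iff[OF v'(3)] by (auto simp: alike_def)
    have "floor_log (width v') + floor_log (width T) - floor_log (occurrences T v') <
        floor_log (width v) + floor_log (width T) - floor_log (occurrences T v)"
      using logs occurrences_log_le[of v] occurrences_log_le[of v'] by linarith
    from less.hyps[OF this v'T y] obtain m f g where m:
      "walk w memory p (address (entry v')) (offset v' + ?y) m f g"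
      "[f = hash c (take (offset v' + ?y) (yield (host v')))] (mod p)" "[g = d ^ (offset v' + ?y)] (mod p)"
      "m + 2 * floor_log (occurrences T v') \<le> 2 * (floor_log (width v') + floor_log (width T))"
      by blast
    have "cells (top_bst ?t) \<subseteq> all_cells" using t(1) by (auto simp: all_cells_def)
    moreover have "?x < width T" using x width_subtrees[OF t(2)] by linarith
    moreover have "walk w memory p (address (entry v')) (?x - length u + offset v') m f g"
      using m(1) by (simp only: add.commute)
    ultimately have "walk w memory p (address (top_bst ?t)) ?x (n + m)
        (shift u v' mod p + scale u v' mod p * f) (d ^ length u * c ^ offset v' mod p * g)"
      by (rule walk_locate[OF n(1)])
    moreover have "entry v = top_bst ?t" using Node by (simp add: entry_def)
    ultimately have 1: "walk w memory p (address (entry v)) ?x (n + m)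
        (shift u v' mod p + scale u v' mod p * f) (d ^ length u * c ^ offset v' mod p * g)"
      by simp
    have "take ?x (yield ?t) = u @ take ?y (yield v')" using yt u by simp
    then have 2: "[shift u v' mod p + scale u v' mod p * f = hash c (take ?x (yield ?t))] (mod p)"
      using shift_scale_correct[OF v'T y m(2), of u] by simp
    have "length u + ?y = ?x" using u by simp
    then have 3: "[d ^ length u * c ^ offset v' mod p * g = d ^ ?x] (mod p)"
      using unscale_correct[OF m(3), of "length u"] by simp
    \<comment> \<open>The search bound in terms of logarithms: \<open>n\<close> is at most
      \<open>1\<close> plus the drop of the logarithm of the width.\<close>
    have "2 ^ floor_log (width v') * 2 ^ n \<le> width v' * 2 ^ n"
      using floor_log_exp2_le[of "width v'"] by simp
    also have "\<dots> < 2 * 2 ^ Suc (floor_log (width v))"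
      using n(2) floor_log_exp2_gt[of "width ?t"] alike by (simp add: alike_def)
    finally have "(2 :: nat) ^ (floor_log (width v') + n) < 2 ^ (floor_log (width v) + 2)"
      by (simp add: power_add)
    then have "floor_log (width v') + n < floor_log (width v) + 2"
      by (rule power_less_imp_less_exp[rotated]) simp
    \<comment> \<open>Either the logarithm of the width drops by some \<open>k \<ge> 1\<close>, and
      \<open>n \<le> k + 1 \<le> 2 * k\<close>; or it stays, \<open>n \<le> 1\<close>, and the
      logarithm of the occurrences grows. This is the origin of the factor \<open>2\<close>.\<close>
    then have 4: "n + m + 2 * floor_log (occurrences T v) \<le> 2 * (floor_log (width v) + floor_log (width T))"
      using m(4) logs unfolding distrib_left by linarith
    from 1 2 3 4 show ?thesis by blast
  qed
qed

theorem walk_memory: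
  assumes "x < width T"
  shows "\<exists>n f g. walk w memory p (memory ! 1) x n f g \<and> f mod p = hash c (take x (yield T)) mod p \<and>
     g mod p = d ^ x mod p \<and> n \<le> 4 * floor_log (width T)"
proof -
  have "occurrences T T = 1" by (rule occurrences_refl)
  then have log: "floor_log (occurrences T T) = 0" by simp
  obtain n f g where "walk w memory p (address (entry T)) (offset T + x) n f g"
     "[f = hash c (take (offset T + x) (yield (host T)))] (mod p)" "[g = d ^ (offset T + x)] (mod p)"
     "n + 2 * floor_log (occurrences T T) \<le> 2 * (floor_log (width T) + floor_log (width T))"
    using walk_entry[OF subtrees_refl assms] by blast
  then have "walk w memory p (memory ! 1) x n f g" "f mod p = hash c (take x (yield T)) mod p"
     "g mod p = d ^ x mod p" "n \<le> 4 * floor_log (width T)"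
    unfolding offset_T host_T log by (simp_all add: memory_def Cong.cong_def)
  then show ?thesis by blast
qed

end

text \<open>\<open>18\<close> stands for nine words in each of two cells per subtree. Either of the
  two lookups walks at most four times \<open>floor_log (N + 1)\<close> steps at \<open>42\<close>
  instructions, whence \<open>336\<close>.\<close>

theorem tree_query_answers:
  assumes S: "S = yield t" and N: "N = length S"
    and cd: "[c * d = 1] (mod p)" and prime_bound: "1 < p" "2 * (p * p) < 2 ^ w"
    and words: "2 * (N + 1) < 2 ^ w" "18 * (card (subtrees t) + 2) + 2 < (2 :: nat) ^ w"
  shows "\<exists>D. (\<forall>x\<in>set D. x < 2 ^ w) \<and> length D \<le> 18 * (card (subtrees t) + 2) + 2 \<and>
    supports_fingerprint w (comp 0 (range_query descend_query) @ [Halt]) D c p S (real (336 * floor_log (N + 1) + 28))"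
proof -
  \<comment> \<open>A further character makes every prefix of \<open>S\<close> end strictly inside the string.\<close>
  define T where "T = Node t (Leaf 0)"
  have yT: "yield T = S @ [0]" by (simp add: T_def S)
  have "card (subtrees T) \<le> Suc (card (subtrees t \<union> {Leaf 0}))"
    unfolding T_def by (simp add: card_insert_if)
  also have "\<dots> \<le> card (subtrees t) + 2" by (simp add: card_insert_if)
  finally have card: "card (subtrees T) \<le> card (subtrees t) + 2" .
  have pw: "p < 2 ^ w" using prime_bound mult_le_mono2[of 1 p p] by linarith
  interpret tree_index T c d p w
    using cd prime_bound pw words card N by unfold_locales (auto simp: T_def S)
  define K where "K = floor_log (N + 1)"
  have walk: "\<exists>n f g. walk w memory p (memory ! 1) x n f g \<and> f mod p = hash c (take x S) mod p \<and>
     g mod p = d ^ x mod p \<and> n \<le> 4 * K" if "x \<le> N" for x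
    using walk_memory[of x] that N unfolding K_def by (simp add: yT)
  have len: "length memory < 2 ^ w" "1 < length memory" "memory ! 0 = p"
  proof -
    show "length memory < 2 ^ w" using length_memory_le fits(2) by (rule le_less_trans)
  qed (simp_all add: memory_def)
  have big: "16 < (2 :: nat) ^ w" using words(2) by simp
  have p2: "p * p + p < 2 ^ w" using prime_bound mult_le_mono2[of 1 p p] by linarith
  have "supports_fingerprint w (comp 0 (range_query descend_query) @ [Halt]) memory c p S
      (real (2 * (168 * K + 9) + 10))"
  proof (rule range_query_supports[OF _ cd prime_bound(1) _ prime_bound(2) big])
    fix x and \<rho> :: "nat \<Rightarrow> nat" assume x: "x \<le> length S" "\<rho> 2 = x"
    then obtain n f g where walks: "walk w memory p (memory ! 1) x n f g" "f mod p = hash c (take x S) mod p"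
      "g mod p = d ^ x mod p" "n \<le> 4 * K"
      using walk[of x] N by blast
    have "42 * n + 9 \<le> 168 * K + 9" using walks(4) by simp
    then show "ensures w memory descend_query \<rho> (168 * K + 9) (\<lambda>\<rho>'. \<rho>' 3 = hash c (take x S) mod p \<and>
        \<rho>' 4 = d ^ x mod p \<and> \<rho>' 7 = p \<and> agree {0, 1, 14, 15} \<rho> \<rho>')"
      by (rule ensures_mono[OF descend_query_correct[where \<rho> = \<rho>, OF walks(1) len(1) p2 big len(2,3) refl
            prime_bound(1) x(2)]])
        (use walks in simp)
  next
    show "length S < 2 ^ w" using words(1) N by simp
  qed
  then have "supports_fingerprint w (comp 0 (range_query descend_query) @ [Halt]) memory c p S (real (336 * K + 28))"
    by (simp add: algebra_simps)
  moreover have "length memory \<le> 18 * (card (subtrees t) + 2) + 2"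
    using length_memory_le card by simp
  ultimately show ?thesis using memory_words unfolding K_def by blast
qed

section \<open>Straight line programs\<close>

inductive derives :: "grammar \<Rightarrow> nat \<Rightarrow> tree \<Rightarrow> bool" for G where
  Leaf: "rule_of G v = Terminal a \<Longrightarrow> derives G v (Leaf a)"
| Node: "rule_of G v = Nonterminal [l, r] \<Longrightarrow> derives G l s \<Longrightarrow> derives G r t \<Longrightarrow>
    derives G v (Node s t)"

lemma derives_unique: "derives G v s \<Longrightarrow> derives G v t \<Longrightarrow> s = t"
proof (induction arbitrary: t rule: derives.induct)
  case (Leaf v a)
  from Leaf(2) show ?case by cases (use Leaf(1) in simp_all)
next
  case (Node v l r s s')
  from Node.prems show ?case
  proof cases
    case (Node l' r' u u')
    then have "l' = l" "r' = r" using \<open>rule_of G v = Nonterminal [l, r]\<close> by simp_all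
    then show ?thesis using Node(1,3,4) Node.IH by blast
  qed (use Node.hyps in simp)
qed

lemma produces_derives:
  assumes "slp G"
  shows "produces G v x \<Longrightarrow> v \<in> nodes G \<Longrightarrow> \<exists>t. derives G v t \<and> yield t = x"
proof (induction rule: produces.induct)
  case (leaf v a)
  then show ?case by (intro exI[of _ "Leaf a"]) (auto intro: derives.Leaf)
next
  case (node v us xs)
  then obtain l r where us: "us = [l, r]" using assms unfolding slp_def by fastforce
  have "l \<in> nodes G" "r \<in> nodes G"
    using node.prems node.hyps us assms by (force simp: slp_def dag_def)+
  moreover obtain x y where "xs = [x, y]" using node.IH us by (auto simp: list_all2_Cons1)
  ultimately obtain s t where "derives G l s" "yield s = x" "derives G r t" "yield t = y"
    using node.IH us by auto
  then show ?case
    using node.hyps us \<open>xs = _\<close> by (intro exI[of _ "Node s t"]) (auto intro: derives.Node)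
qed

lemma subtrees_derived:
  assumes "slp G"
  shows "derives G v t \<Longrightarrow> v \<in> nodes G \<Longrightarrow> subtrees t \<subseteq> {s. \<exists>u\<in>nodes G. derives G u s}"
proof (induction rule: derives.induct)
  case (Leaf v a)
  then show ?case by (auto intro: derives.Leaf)
next
  case (Node v l r s t)
  have "l \<in> nodes G" "r \<in> nodes G"
    using Node.prems Node.hyps assms by (force simp: slp_def dag_def)+
  then show ?case using Node derives.Node[OF Node.hyps(1-3)] by auto
qed

text \<open>Every subtree is the derivation tree of some node, and a node has only one; nodes with
  equal trees are merged.\<close>

lemma card_subtrees_le_nodes:
  assumes "slp G" "derives G v t" "v \<in> nodes G"
  shows "card (subtrees t) \<le> card (nodes G)"
proof -
  have fin: "finite (nodes G)" using assms(1) by (simp add: slp_def dag_def)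
  have "subtrees t \<subseteq> (\<lambda>u. THE s. derives G u s) ` nodes G"
  proof
    fix s assume "s \<in> subtrees t"
    then obtain u where u: "u \<in> nodes G" "derives G u s" using subtrees_derived[OF assms] by blast
    then have "(THE s. derives G u s) = s" using derives_unique by blast
    then show "s \<in> (\<lambda>u. THE s. derives G u s) ` nodes G" using u(1) by (metis image_eqI)
  qed
  then show ?thesis using surj_card_le[OF fin] by blast
qed

section \<open>Word length, inverses modulo p, and the case that p divides c\<close>

lemma card_subtrees_le_width: "card (subtrees t) + 1 \<le> 2 * width t"
proof (induction t)
  case (Node l r)
  have "card (subtrees (Node l r)) \<le> Suc (card (subtrees l \<union> subtrees r))"
    by (simp add: card_insert_if)
  also have "\<dots> \<le> Suc (card (subtrees l) + card (subtrees r))" using card_Un_le by blast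
  finally show ?case using Node by simp
qed simp

text \<open>With \<open>b = bits N\<close> and \<open>m = (c + 4) * b\<close>, twice a product of
  two residues needs \<open>2 * m + 5\<close> bits, and \<open>m \<ge> 5\<close>. As
  \<open>c > 0\<close>, the word has at least \<open>40 * b\<close> bits, which covers
  \<open>30 + 10 * b\<close>.\<close>

lemma word_bounds:
  assumes "1 \<le> N" "0 < c" "p \<le> 4 * N ^ (c + 4)" "w = 8 * ((c + 4) * bits N)"
  shows "2 * (p * p) < 2 ^ w" "2 ^ 30 * (N + 1) ^ 10 \<le> (2 :: nat) ^ w"
proof -
  define b m where "b = bits N" and "m = (c + 4) * b"
  have w: "w = 8 * m" using assms(4) by (simp add: b_def m_def)
  have "real N + 1 = 2 powr log 2 (real N + 1)" by simp
  also have "\<dots> \<le> 2 powr real b" unfolding bits_def b_def by (intro powr_mono) linarith+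
  finally have "real (N + 1) \<le> real (2 ^ b)" by (simp add: powr_realpow)
  then have N: "N + 1 \<le> 2 ^ b" using of_nat_le_iff by blast
  have b: "1 \<le> b" using N assms(1) by (cases b) auto
  have m: "5 * b \<le> m" unfolding m_def using assms(2) by (intro mult_le_mono1) simp
  have "N \<le> 2 ^ b" using N by (rule add_leD1)
  then have "N ^ (c + 4) \<le> (2 ^ b) ^ (c + 4)" by (rule power_mono) (rule le0)
  also have "\<dots> = 2 ^ m" by (simp only: m_def power_mult[symmetric] mult.commute)
  finally have "p \<le> 2 ^ 2 * 2 ^ m" using assms(3) by simp
  then have p: "p \<le> 2 ^ (2 + m)" by (simp only: power_add)
  have "2 * (p * p) \<le> 2 ^ 1 * (2 ^ (2 + m) * 2 ^ (2 + m))"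
    using mult_le_mono[OF p p] by simp
  also have "\<dots> = 2 ^ (1 + ((2 + m) + (2 + m)))" by (simp only: power_add)
  also have "\<dots> < 2 ^ w" unfolding w using m b by (intro power_strict_increasing) linarith+
  finally show "2 * (p * p) < 2 ^ w" .
  have "(N + 1) ^ 10 \<le> (2 ^ b) ^ 10" using N by (rule power_mono) simp
  then have "2 ^ 30 * (N + 1) ^ 10 \<le> 2 ^ 30 * (2 ^ b) ^ 10" by (rule mult_le_mono2)
  also have "\<dots> = 2 ^ (30 + b * 10)" by (simp only: power_add power_mult)
  also have "\<dots> \<le> 2 ^ w" unfolding w using m b by (intro power_increasing) linarith+
  finally show "2 ^ 30 * (N + 1) ^ 10 \<le> (2 :: nat) ^ w" .
qed

lemma word_bound_linear:
  assumes "2 ^ 30 * (N + 1) ^ 10 \<le> (B :: nat)"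
  shows "2 ^ 30 * (N + 1) \<le> B"
proof -
  have "(N + 1) ^ 1 \<le> (N + 1) ^ 10" by (rule power_increasing) simp_all
  then show ?thesis using assms by simp
qed

lemma hash_dvd: "p dvd c \<Longrightarrow> p dvd hash c x"
  by (induction x) auto

lemma hash_zeros: "\<forall>a\<in>set x. a = 0 \<Longrightarrow> hash c x = 0"
  by (induction x) simp_all

lemma inverse_exists:
  fixes c p :: nat
  assumes "prime p" "\<not> p dvd c"
  shows "\<exists>d. [c * d = 1] (mod p)"
proof -
  have "coprime c p"
    using prime_imp_coprime[OF assms] by (simp add: coprime_commute)
  from cong_solve_coprime_nat[OF this] show ?thesis by (simp only: One_nat_def)
qed

text \<open>\<open>c < 2 ^ c \<le> N ^ c\<close> makes \<open>p\<close> larger than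
  \<open>c\<close>. For \<open>N = 1\<close> the admissible primes are \<open>2\<close> and
  \<open>3\<close>, which may well divide \<open>c\<close>.\<close>

lemma prime_not_dvd:
  assumes "0 < c" "2 * N ^ (c + 4) \<le> p" "2 \<le> N"
  shows "\<not> p dvd (c :: nat)"
proof
  assume "p dvd c"
  have "c < 2 ^ c" by (rule less_exp)
  also have "\<dots> \<le> N ^ c" using assms(3) by (rule power_mono) simp
  also have "\<dots> \<le> N ^ (c + 4)" using assms(3) by (intro power_increasing) auto
  also have "\<dots> \<le> p" using assms(2) by simp
  finally show False using \<open>p dvd c\<close> assms(1) dvd_imp_le by fastforce
qed

text \<open>If \<open>p\<close> divides \<open>c\<close>, all fingerprints vanish, as they do for a string of zeros.\<close>

lemma supports_fingerprint_zero:
  assumes "p dvd c" "supports_fingerprint w P D 1 p [0] B" "length S = 1"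
  shows "supports_fingerprint w P D c p S B"
proof -
  have "fingerprint 1 p (substring [0] i j) = fingerprint c p (substring S i j)"
    if "1 \<le> i" "i \<le> j" "j \<le> 1" for i j
  proof -
    have "i = 1" "j = 1" using that by auto
    then have "hash 1 (substring [0] i j) = 0" by (intro hash_zeros) (simp add: substring_def)
    moreover have "hash c (substring S i j) mod p = 0"
      using hash_dvd[OF assms(1)] by (rule dvd_imp_mod_0)
    ultimately show ?thesis by (simp add: fingerprint_eq_hash)
  qed
  then show ?thesis using assms(2,3) unfolding supports_fingerprint_def by simp
qed

lemma log_bound_floor_log: "0 < n \<Longrightarrow> real (floor_log n) \<le> log 2 (real n)"
  by (simp add: floor_log_exp2_le le_log_of_power)

lemma supports_fingerprint_mono:
  "supports_fingerprint w P D c p S T \<Longrightarrow> T \<le> T' \<Longrightarrow> supports_fingerprint w P D c p S T'"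
  unfolding supports_fingerprint_def by (meson order_trans)

theorem slp_fingerprint_structure:
  "fingerprint_structure slp (comp 0 (range_query descend_query) @ [Halt]) 8
     (\<lambda>n. 18 * real n + 56) (\<lambda>N. 336 * log 2 (real N + 1) + 28)"
  unfolding fingerprint_structure_def
proof (intro allI impI, elim conjE)
  fix G S N c p w
  assume G: "slp G" and S: "produces G (root G) S" and N: "N = length S" and c: "0 < c"
    and p: "prime p" "2 * N ^ (c + 4) \<le> p" "p \<le> 4 * N ^ (c + 4)"
    and w: "w = 8 * ((c + 4) * bits N)"
  have root: "root G \<in> nodes G" using G by (simp add: slp_def dag_def)
  obtain t where t: "derives G (root G) t" "yield t = S" using produces_derives[OF G S root] by blast
  have N1: "1 \<le> N" using t N width_ge_1[of t] by simp
  note bounds = word_bounds[OF N1 c p(3) w]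
  have lin: "2 ^ 30 * (N + 1) \<le> (2 :: nat) ^ w" by (rule word_bound_linear[OF bounds(2)])
  have p1: "1 < p" using p(1) by (rule prime_gt_1_nat)
  \<comment> \<open>If \<open>p\<close> divides \<open>c\<close>, the index is built for the string
    of a single \<open>0\<close>, with base and inverse \<open>1\<close>.\<close>
  obtain u c' d where u: "width u = N" "card (subtrees u) \<le> card (nodes G)" "[c' * d = 1] (mod p)"
    and *: "\<And>D T. supports_fingerprint w (comp 0 (range_query descend_query) @ [Halt]) D c' p (yield u) T \<Longrightarrow>
       supports_fingerprint w (comp 0 (range_query descend_query) @ [Halt]) D c p S T"
  proof (cases "p dvd c")
    case True
    then have "N = 1" using prime_not_dvd[OF c p(2)] N1 by linarith
    moreover have "card (nodes G) \<ge> 1"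
      using root G by (auto simp: slp_def dag_def card_gt_0_iff Suc_le_eq)
    ultimately show ?thesis
      using supports_fingerprint_zero[OF True] N by (intro that[of "Leaf 0" 1 1]) auto
  next
    case False
    then obtain d where "[c * d = 1] (mod p)" using inverse_exists p(1) by blast
    then show ?thesis
      using t N card_subtrees_le_nodes[OF G t(1) root] by (intro that[of t c d]) auto
  qed
  \<comment> \<open>The size of the grammar is not bounded in terms of \<open>N\<close>; that
    addresses fit in a word follows from the number of distinct subtrees.\<close>
  have "card (subtrees u) \<le> 2 * N" using card_subtrees_le_width[of u] u by simp
  then have "2 * (N + 1) < (2 :: nat) ^ w" "18 * (card (subtrees u) + 2) + 2 < (2 :: nat) ^ w"
    using lin by simp_all
  then obtain D where D: "\<forall>x\<in>set D. x < 2 ^ w" "length D \<le> 18 * (card (subtrees u) + 2) + 2"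
    "supports_fingerprint w (comp 0 (range_query descend_query) @ [Halt]) D c' p (yield u) (real (336 * floor_log (N + 1) + 28))"
    using tree_query_answers[OF refl u(1)[symmetric] u(3) p1 bounds(1)] by blast
  have "real (336 * floor_log (N + 1) + 28) \<le> 336 * log 2 (real N + 1) + 28"
    using log_bound_floor_log[of "N + 1"] by (simp add: add.commute)
  then have "supports_fingerprint w (comp 0 (range_query descend_query) @ [Halt]) D c p S (336 * log 2 (real N + 1) + 28)"
    using * D(3) supports_fingerprint_mono by blast
  moreover have "length D \<le> 18 * size_slp G + 56" using D(2) u(2) by (simp add: size_slp_def)
  then have "real (length D) \<le> 18 * real (size_slp G) + 56" by linarith
  ultimately show "\<exists>D. (\<forall>x\<in>set D. x < 2 ^ w) \<and> real (length D) \<le> 18 * real (size_slp G) + 56 \<and>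
     supports_fingerprint w (comp 0 (range_query descend_query) @ [Halt]) D c p S (336 * log 2 (real N + 1) + 28)"
    using D(1) by blast
qed

section \<open>Perfect hashing\<close>

definition hash_to :: "nat \<Rightarrow> nat \<Rightarrow> nat \<Rightarrow> nat \<Rightarrow> nat" where
  "hash_to q m a z = a * z mod q mod m"

text \<open>For fixed \<open>x \<noteq> y\<close> the difference of \<open>a * x mod q\<close> and
  \<open>a * y mod q\<close> determines \<open>a\<close>. In a collision it is a non-zero multiple
  of \<open>m\<close> of absolute value below \<open>q\<close>, and there are at most
  \<open>2 * ((q - 1) div m)\<close> of those.\<close>

lemma card_collisions:
  fixes q m x y :: nat
  assumes q: "prime q" and xy: "x < q" "y < q" "x \<noteq> y" and m: "0 < m"
  shows "card {a \<in> {1..<q}. hash_to q m a x = hash_to q m a y} * m \<le> 2 * (q - 1)"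
proof -
  let ?A = "{a \<in> {1..<q}. hash_to q m a x = hash_to q m a y}"
  let ?f = "\<lambda>a. int (a * x mod q) - int (a * y mod q)"
  let ?K = "int ((q - 1) div m)"
  have q1: "1 < q" using q by (rule prime_gt_1_nat)
  have pq: "prime (int q)" using q by simp
  have ndvd: "\<not> int q dvd int x - int y"
    using xy dvd_imp_le_int[of "int x - int y" "int q"] by force
  have f_cong: "int q dvd ?f a - int a * (int x - int y)" for a
  proof -
    have "?f a - int a * (int x - int y) =
        (int (a * y) - int (a * y) mod int q) - (int (a * x) - int (a * x) mod int q)"
      by (simp add: zmod_int algebra_simps)
    then show ?thesis using dvd_minus_mod by (metis dvd_diff)
  qed
  have f_eq: "int q dvd (int a - int b) * (int x - int y)" if "?f a = ?f b" for a b
  proof -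
    have "int q dvd (?f b - int b * (int x - int y)) - (?f a - int a * (int x - int y))"
      by (rule dvd_diff) (rule f_cong)+
    then show ?thesis using that by (simp add: algebra_simps)
  qed
  have inj: "inj_on ?f ?A"
  proof (rule inj_onI)
    fix a b assume ab: "a \<in> ?A" "b \<in> ?A" "?f a = ?f b"
    then have "int q dvd int a - int b" using f_eq ndvd pq prime_dvd_mult_iff by blast
    moreover have "\<bar>int a - int b\<bar> < int q" using ab by auto
    ultimately show "a = b" using dvd_imp_le_int[of "int a - int b" "int q"] by force
  qed
  have sub: "?f ` ?A \<subseteq> (\<lambda>k. int m * k) ` ({- ?K..?K} - {0})"
  proof
    fix z assume "z \<in> ?f ` ?A"
    then obtain a where a: "a \<in> ?A" "z = ?f a" by blast
    have "int m dvd z"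
      using a unfolding hash_to_def by (metis (mono_tags, lifting) mem_Collect_eq mod_eq_dvd_iff of_nat_mod)
    then obtain k where k: "z = int m * k" by (elim dvdE)
    have "z \<noteq> 0"
    proof
      assume "z = 0"
      then have "int q dvd int a * (int x - int y)" using f_cong[of a] a(2) by simp
      then have "int q dvd int a" using ndvd pq prime_dvd_mult_iff by blast
      then show False using a(1) dvd_imp_le_int[of "int a" "int q"] by auto
    qed
    moreover have "\<bar>z\<bar> \<le> int (q - 1)"
    proof -
      have "a * x mod q < q" "a * y mod q < q" using q1 by simp_all
      then show ?thesis unfolding a(2) by linarith
    qed
    then have "int m * \<bar>k\<bar> \<le> int (q - 1)" using k by (simp add: abs_mult)
    then have "int (nat \<bar>k\<bar> * m) \<le> int (q - 1)" by (simp add: mult.commute)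
    then have "nat \<bar>k\<bar> \<le> (q - 1) div m"
      using m by (simp only: of_nat_le_iff less_eq_div_iff_mult_less_eq)
    then have "\<bar>k\<bar> \<le> ?K" by linarith
    ultimately show "z \<in> (\<lambda>k. int m * k) ` ({- ?K..?K} - {0})"
      unfolding k by (intro imageI) auto
  qed
  have "card ?A = card (?f ` ?A)" using inj by (simp add: card_image)
  also have "\<dots> \<le> card ((\<lambda>k. int m * k) ` ({- ?K..?K} - {0}))" by (rule card_mono[OF _ sub]) simp
  also have "\<dots> \<le> card ({- ?K..?K} - {0})" by (rule card_image_le) simp
  also have "\<dots> = 2 * ((q - 1) div m)" by (simp add: card_Diff_subset)
  finally have "card ?A * m \<le> 2 * ((q - 1) div m) * m" by (rule mult_le_mono1)
  also have "\<dots> \<le> 2 * (q - 1)" by simp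
  finally show ?thesis .
qed

definition collisions :: "nat \<Rightarrow> nat \<Rightarrow> nat set \<Rightarrow> nat \<Rightarrow> (nat \<times> nat) set" where
  "collisions q m Z a = {(x, y) \<in> Z \<times> Z. x \<noteq> y \<and> hash_to q m a x = hash_to q m a y}"

text \<open>Averaging over \<open>a\<close>: the bound for one pair is summed over all ordered pairs
  of distinct keys, and the two sums are exchanged.\<close>

lemma few_collisions:
  assumes q: "prime q" and Z: "Z \<subseteq> {..<q}" and m: "0 < m"
  shows "\<exists>a\<in>{1..<q}. card (collisions q m Z a) * m \<le> 2 * (card Z * (card Z - 1))"
proof (rule ccontr)
  assume "\<not> ?thesis"
  then have more: "2 * (card Z * (card Z - 1)) < card (collisions q m Z a) * m" if "a \<in> {1..<q}" for a
    using that by force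
  have fin: "finite Z" using Z finite_subset by blast
  let ?P = "{(x, y) \<in> Z \<times> Z. x \<noteq> y}"
  let ?R = "\<lambda>a z. hash_to q m a (fst z) = hash_to q m a (snd z)"
  have finP: "finite ?P" by (rule finite_subset[of _ "Z \<times> Z"]) (use fin in auto)
  have "?P = Z \<times> Z - (\<lambda>z. (z, z)) ` Z" by auto
  then have "card ?P = card Z * card Z - card Z"
    using fin by (simp add: card_Diff_subset card_cartesian_product card_image inj_on_def image_subset_iff)
  then have cardP: "card ?P = card Z * (card Z - 1)" by (simp add: diff_mult_distrib2)
  have q1: "1 < q" using q by (rule prime_gt_1_nat)
  have C: "card (collisions q m Z a) = (\<Sum>z\<in>?P. of_bool (?R a z))" for a
  proof -
    have "collisions q m Z a = ?P \<inter> {z. ?R a z}" by (auto simp: collisions_def)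
    then show ?thesis using finP by (simp add: sum_of_bool_eq)
  qed
  have "(q - 1) * (2 * (card Z * (card Z - 1))) = (\<Sum>a\<in>{1..<q}. 2 * (card Z * (card Z - 1)))" by simp
  also have "\<dots> < (\<Sum>a\<in>{1..<q}. card (collisions q m Z a) * m)"
    by (rule sum_strict_mono) (use q1 more in auto)
  also have "\<dots> = (\<Sum>a\<in>{1..<q}. \<Sum>z\<in>?P. of_bool (?R a z)) * m"
    by (simp only: C sum_distrib_right)
  also have "\<dots> = (\<Sum>z\<in>?P. \<Sum>a\<in>{1..<q}. of_bool (?R a z)) * m"
    by (subst sum.swap) (rule refl)
  also have "\<dots> = (\<Sum>z\<in>?P. card {a \<in> {1..<q}. ?R a z} * m)"
    by (simp add: sum_distrib_right sum_of_bool_eq Int_def)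
  also have "\<dots> \<le> (\<Sum>z\<in>?P. 2 * (q - 1))"
  proof (rule sum_mono)
    fix z assume "z \<in> ?P"
    then show "card {a \<in> {1..<q}. ?R a z} * m \<le> 2 * (q - 1)"
      using Z by (intro card_collisions q m) auto
  qed
  also have "\<dots> = (q - 1) * (2 * (card Z * (card Z - 1)))" using cardP by simp
  finally show False by simp
qed

text \<open>With \<open>k\<close> keys and a range of twice the square of \<open>k\<close>, the
  average falls below one collision, so some \<open>a\<close> has none. The \<open>max 1\<close>
  keeps the modulus positive for an empty set.\<close>

lemma injective_hash:
  assumes q: "prime q" and Z: "Z \<subseteq> {..<q}"
  shows "\<exists>a<q. inj_on (hash_to q (max 1 (2 * (card Z)\<^sup>2)) a) Z"
proof (cases "card Z = 0")
  case True
  then have "Z = {}" using Z finite_subset by fastforce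
  then show ?thesis using prime_gt_0_nat[OF q] by auto
next
  case False
  let ?m = "max 1 (2 * (card Z)\<^sup>2)"
  have m: "?m = 2 * (card Z)\<^sup>2" using False by simp
  obtain a where a: "a \<in> {1..<q}" "card (collisions q ?m Z a) * ?m \<le> 2 * (card Z * (card Z - 1))"
    using few_collisions[OF q Z, of ?m] m False by (metis mult_pos_pos power2_eq_square neq0_conv zero_less_numeral)
  have "card Z * (card Z - 1) < card Z * card Z" using False by (intro mult_strict_left_mono) auto
  then have "2 * (card Z * (card Z - 1)) < ?m" unfolding m power2_eq_square by linarith
  then have less: "card (collisions q ?m Z a) * ?m < ?m" using a(2) by linarith
  have "card (collisions q ?m Z a) = 0"
  proof (cases "card (collisions q ?m Z a)")
    case (Suc n)
    then show ?thesis using less by (simp only: mult_Suc)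
  qed
  moreover have "finite (collisions q ?m Z a)"
    by (rule finite_subset[of _ "Z \<times> Z"]) (use Z finite_subset in \<open>auto simp: collisions_def\<close>)
  ultimately have "collisions q ?m Z a = {}" by simp
  then have "inj_on (hash_to q ?m a) Z" by (auto simp: collisions_def inj_on_def)
  then show ?thesis using a(1) by auto
qed

text \<open>
  Two-level perfect hashing (Fredman, Komlos, Szemeredi): a function with few collisions
  splits the keys into buckets, and a bucket with \<open>b\<close> keys has an injective function into a range of size
  about \<open>2 b\<^sup>2\<close>.
\<close>

theorem perfect_hash:
  assumes q: "prime q" and Z: "Z \<subseteq> {..<q}" "Z \<noteq> {}"
  shows "\<exists>a A M B. a < q \<and> (\<forall>i. A i < q) \<and> (\<forall>i. 1 \<le> M i) \<and> (\<forall>i<card Z. B i + M i \<le> 7 * card Z) \<and>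
    inj_on (\<lambda>z. B (hash_to q (card Z) a z) +
      hash_to q (M (hash_to q (card Z) a z)) (A (hash_to q (card Z) a z)) z) Z"
proof -
  let ?k = "card Z"
  have fin: "finite Z" using Z finite_subset by blast
  have k: "0 < ?k" using fin Z by (simp add: card_gt_0_iff)
  obtain a where a: "a \<in> {1..<q}" "card (collisions q ?k Z a) * ?k \<le> 2 * (?k * (?k - 1))"
    using few_collisions[OF q Z(1) k] by blast
  have "card (collisions q ?k Z a) * ?k \<le> (2 * (?k - 1)) * ?k" using a(2) by (simp add: mult.assoc mult.commute)
  then have few: "card (collisions q ?k Z a) \<le> 2 * ?k" using k by simp
  let ?h = "hash_to q ?k a"
  define bucket where "bucket i = {z \<in> Z. ?h z = i}" for i
  define M where "M i = max 1 (2 * (card (bucket i))\<^sup>2)" for i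
  define B where "B i = (\<Sum>j<i. M j)" for i
  have "\<forall>i. \<exists>b<q. inj_on (hash_to q (M i) b) (bucket i)"
  proof
    fix i
    have "bucket i \<subseteq> {..<q}" using Z(1) by (auto simp: bucket_def)
    from injective_hash[OF q this] show "\<exists>b<q. inj_on (hash_to q (M i) b) (bucket i)"
      by (simp only: M_def)
  qed
  then obtain A where A: "\<And>i. A i < q" "\<And>i. inj_on (hash_to q (M i) (A i)) (bucket i)" by metis
  have h: "?h z < ?k" for z using k by (simp add: hash_to_def)
  have finb: "finite (bucket i)" for i using fin by (simp add: bucket_def)
  \<comment> \<open>The squares count the pairs inside a bucket: \<open>?k\<close> diagonal ones and
    at most \<open>2 * ?k\<close> collisions. Doubling \<open>3 * ?k\<close> and adding
    \<open>1\<close> per bucket gives the \<open>7 * ?k\<close> below.\<close>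
  have "(\<Sum>i<?k. (card (bucket i))\<^sup>2) = (\<Sum>i<?k. card (bucket i \<times> bucket i))"
    by (simp add: power2_eq_square card_cartesian_product)
  also have "\<dots> = card (\<Union>i<?k. bucket i \<times> bucket i)"
    by (rule card_UN_disjoint[symmetric]) (use finb in \<open>auto simp: bucket_def\<close>)
  also have "(\<Union>i<?k. bucket i \<times> bucket i) = (\<lambda>z. (z, z)) ` Z \<union> collisions q ?k Z a"
    using h by (auto simp: bucket_def collisions_def)
  also have "card \<dots> \<le> card ((\<lambda>z. (z, z)) ` Z) + card (collisions q ?k Z a)" by (rule card_Un_le)
  also have "\<dots> \<le> ?k + 2 * ?k" using few card_image_le[OF fin] by (intro add_mono)
  finally have squares: "(\<Sum>i<?k. (card (bucket i))\<^sup>2) \<le> 3 * ?k" by simp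
  have "(\<Sum>i<?k. M i) \<le> (\<Sum>i<?k. 1 + 2 * (card (bucket i))\<^sup>2)" by (rule sum_mono) (simp add: M_def)
  also have "\<dots> = ?k + 2 * (\<Sum>i<?k. (card (bucket i))\<^sup>2)"
    by (simp add: sum.distrib sum_distrib_left sum_Suc)
  also have "\<dots> \<le> 7 * ?k" using squares by simp
  finally have total: "(\<Sum>i<?k. M i) \<le> 7 * ?k" .
  have B_mono: "B i + M i \<le> B j" if "i < j" for i j
  proof -
    have "(\<Sum>l<Suc i. M l) \<le> (\<Sum>l<j. M l)" by (rule sum_mono2) (use that in auto)
    then show ?thesis by (simp add: B_def)
  qed
  have "B i + M i \<le> 7 * ?k" if "i < ?k" for i using B_mono[OF that] total by (simp add: B_def)
  moreover have "inj_on (\<lambda>z. B (?h z) + hash_to q (M (?h z)) (A (?h z)) z) Z"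
  proof (rule inj_onI)
    have M: "1 \<le> M i" for i by (simp add: M_def)
    have less: "hash_to q (M i) b z < M i" for i b z using M[of i] by (simp add: hash_to_def)
    fix y z assume yz: "y \<in> Z" "z \<in> Z"
      and eq: "B (?h y) + hash_to q (M (?h y)) (A (?h y)) y = B (?h z) + hash_to q (M (?h z)) (A (?h z)) z"
    have "?h y = ?h z"
    proof (rule ccontr)
      assume "?h y \<noteq> ?h z"
      then consider "?h y < ?h z" | "?h z < ?h y" by linarith
      then show False
      proof cases
        case 1
        from B_mono[OF this] less[of "?h y" "A (?h y)" y] eq show False by linarith
      next
        case 2
        from B_mono[OF this] less[of "?h z" "A (?h z)" z] eq show False by linarith
      qed
    qed
    then show "y = z" using eq yz inj_onD[OF A(2)[of "?h z"]] by (simp add: bucket_def)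
  qed
  moreover have "\<forall>i. 1 \<le> M i" by (simp add: M_def)
  ultimately show ?thesis using a(1) A(1) by (intro exI[of _ a] exI[of _ A] exI[of _ M] exI[of _ B]) auto
qed

section \<open>Predecessor queries\<close>

text \<open>Registers \<open>21\<close> to \<open>24\<close> hold \<open>q\<close>, the outer
  multiplier, the number of buckets and the address of the bucket table, \<open>25\<close> to
  \<open>27\<close> the constants \<open>1\<close>, \<open>2\<close>, \<open>3\<close>, and
  \<open>28\<close> the argument with a leading bit, \<open>x + 2 ^ L\<close>. The outer hash
  selects a bucket record of three words; its multiplier, modulus and base address lead to a slot of
  three words.\<close>

definition level_code :: "instr list" where
  "level_code =
     [Alu Div 30 30 26, Alu Sub 39 29 30, Alu Shr 32 28 39, Alu Mul 33 22 32, Alu Mod 33 33 21,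
      Alu Mod 33 33 23, Alu Mul 33 33 27, Alu Add 33 33 24, Load 34 33, Alu Add 33 33 25, Load 35 33,
      Alu Add 33 33 25, Load 36 33, Alu Mul 37 34 32, Alu Mod 37 37 21, Alu Mod 37 37 35,
      Alu Mul 37 37 27, Alu Add 37 37 36, Load 38 37]"

definition init_code :: "instr list" where
  "init_code =
     [Imm 32 1, Load 21 32, Imm 32 2, Load 22 32, Imm 32 3, Load 23 32, Imm 32 4, Load 24 32,
      Imm 32 6, Load 29 32, Imm 32 7, Load 28 32, Alu Add 28 28 20, Imm 32 10, Load 31 32, Imm 25 1,
      Imm 26 2, Imm 27 3, Imm 32 0, Alu Add 30 29 32]"

text \<open>The bit of the argument just below the level found selects a half of the block; the slot
  stores the number of keys before either half. The window of the rank search has width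
  \<open>2 * L\<close>, and \<open>5\<close> is the length of a key record.\<close>

definition middle_code :: "instr list" where
  "middle_code =
     [Alu Sub 39 29 25, Alu Shr 32 28 39, Alu Mod 32 32 26, Alu Add 31 31 25, Alu Add 31 31 32,
      Load 33 31, Imm 34 8, Load 34 34, Imm 35 9, Load 35 35, Imm 36 6, Load 30 36, Alu Mul 30 30 26,
      Imm 27 5]"

text \<open>
  Register \<open>20\<close> holds the argument, register \<open>33\<close> receives the address of the record of the largest key
  that is at most the argument. The first loop searches for the level (register \<open>29\<close>) of the lowest
  hashed block that contains the argument, the second for the rank of the argument (register \<open>33\<close>);
  register \<open>30\<close> is the step width of both.
\<close>

definition level_body :: com where
  "level_body =
    Seq (Basic level_code)
      (Ite (Eq 38 32) (Basic [Alu Sub 29 29 30, Imm 31 0, Alu Add 31 37 31]) (Basic []))"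

definition rank_body :: com where
  "rank_body =
    Seq (Basic [Alu Div 30 30 26, Alu Add 37 33 30])
      (Ite (Lt 35 37) (Basic [])
        (Seq (Basic [Alu Sub 38 37 25, Alu Mul 38 38 27, Alu Add 38 38 34, Load 38 38])
          (Ite (Lt 20 38) (Basic []) (Basic [Imm 38 0, Alu Add 33 37 38]))))"

definition predecessor :: com where
  "predecessor =
    Seq (Basic init_code)
   (Seq (While (Lt 25 30) level_body)
   (Seq (Basic middle_code)
   (Seq (While (Lt 25 30) rank_body)
     (Basic [Alu Sub 33 33 25, Alu Mul 33 33 27, Alu Add 33 33 34]))))"

text \<open>Only the header and the bucket table: \<open>slot\<close> has to be defined from them
  before the contents of the slots can be specified.\<close>

locale predecessor_memory =
  fixes w :: nat and D :: "nat list" and q a buckets table L keys M :: nat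
    and Z :: "nat set" and rank :: "nat \<Rightarrow> nat"
  assumes header: "16 \<le> length D" "D ! 1 = q" "D ! 2 = a" "D ! 3 = buckets" "D ! 4 = table"
      "D ! 6 = L" "D ! 7 = 2 ^ L" "D ! 8 = keys" "D ! 9 = M"
    and words: "length D < 2 ^ w" "\<And>x. x \<in> set D \<Longrightarrow> x < 2 ^ w" "q * q < 2 ^ w"
    and q: "2 * 2 ^ L \<le> q" "a < q" "0 < buckets"
    and table: "\<And>i. i < buckets \<Longrightarrow> table + 3 * i + 2 < length D \<and> D ! (table + 3 * i) < q \<and>
        0 < D ! (table + 3 * i + 1)"
begin

definition slot :: "nat \<Rightarrow> nat" where
  "slot z = (let i = table + 3 * (a * z mod q mod buckets) in
     D ! (i + 2) + 3 * (D ! i * z mod q mod D ! (i + 1)))"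

end

locale predecessor_structure = predecessor_memory +
  assumes root: "D ! 10 = slot 1" "1 \<in> Z"
    and slot: "\<And>z. z < q \<Longrightarrow> slot z + 2 < length D"
      "\<And>z. z < q \<Longrightarrow> D ! slot z = z \<longleftrightarrow> z \<in> Z"
    and bottom: "\<And>y. 2 ^ L \<le> y \<Longrightarrow> y \<notin> Z"
    and L: "\<exists>n. L = 2 ^ n"
    and range: "\<And>x b. x < 2 ^ L \<Longrightarrow> 1 \<le> b \<Longrightarrow> b \<le> L \<Longrightarrow>
      (x + 2 ^ L) div 2 ^ b \<in> Z \<Longrightarrow> (x + 2 ^ L) div 2 ^ (b - 1) \<notin> Z \<Longrightarrow>
      D ! (slot ((x + 2 ^ L) div 2 ^ b) + 1 + (x + 2 ^ L) div 2 ^ (b - 1) mod 2) \<le> rank x \<and>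
      rank x < D ! (slot ((x + 2 ^ L) div 2 ^ b) + 1 + (x + 2 ^ L) div 2 ^ (b - 1) mod 2) + 2 * L"
    and keys: "keys + 5 * M \<le> length D"
    and rank: "\<And>x. x < 2 ^ L \<Longrightarrow> 1 \<le> rank x \<and> rank x \<le> M"
      "\<And>x t. x < 2 ^ L \<Longrightarrow> 1 \<le> t \<Longrightarrow> t \<le> M \<Longrightarrow> D ! (keys + 5 * (t - 1)) \<le> x \<longleftrightarrow> t \<le> rank x"
begin

section \<open>Correctness and running time of the predecessor program\<close>

lemma big: "16 < (2 :: nat) ^ w"
  using header(1) words(1) by linarith

lemma q_pos: "0 < q"
  using q(1) by (metis gr0I le_zero_eq mult_eq_0_iff power_not_zero zero_neq_numeral)

lemma q_small: "q < 2 ^ w"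
  using words(3) mult_le_mono2[of 1 q q] q_pos by linarith

lemma buckets_small: "3 * buckets \<le> length D"
  using table[of "buckets - 1"] q(3) by (cases buckets) simp_all

lemma level_body_correct:
  assumes \<rho>: "\<rho> 30 = 2 * s" "\<rho> 29 = b" "\<rho> 28 = y" "\<rho> 21 = q" "\<rho> 22 = a" "\<rho> 23 = buckets"
    "\<rho> 24 = table" "\<rho> 25 = 1" "\<rho> 26 = 2" "\<rho> 27 = 3"
    and s: "s \<le> b" "b < 2 ^ w" and y: "y < q"
  shows "ensures w D level_body \<rho> 24
    (\<lambda>\<rho>'. \<rho>' 30 = s \<and> (if y div 2 ^ (b - s) \<in> Z
        then \<rho>' 29 = b - s \<and> \<rho>' 31 = slot (y div 2 ^ (b - s))
        else \<rho>' 29 = b \<and> \<rho>' 31 = \<rho> 31) \<and>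
      agree {..28} \<rho> \<rho>')"
proof -
  define z where "z = y div 2 ^ (b - s)"
  define i where "i = a * z mod q mod buckets"
  define u where "u = table + 3 * i"
  define j where "j = D ! u * z mod q mod D ! (u + 1)"
  have z: "z < q" using y div_le_dividend[of y "2 ^ (b - s)"] unfolding z_def by linarith
  have i: "i < buckets" using q(3) by (simp add: i_def)
  have u: "u + 2 < length D" "D ! u < q" "0 < D ! (u + 1)"
    using table[OF i] by (simp_all add: u_def)
  have sl: "slot z = 3 * j + D ! (u + 2)" by (simp add: slot_def Let_def j_def u_def i_def)
  have v: "3 * j + D ! (u + 2) + 2 < length D" using slot(1)[OF z] sl by simp
  have mem: "D ! (3 * j + D ! (u + 2)) = z \<longleftrightarrow> z \<in> Z" using slot(2)[OF z] sl by simp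
  have "a * z \<le> q * q" "D ! u * z \<le> q * q" using q(2) u(2) z by (auto intro: mult_le_mono)
  then have az: "a * z < 2 ^ w" "D ! u * z < 2 ^ w" using words(3) by linarith+
  have "3 * i < 2 ^ w" "3 * i + table < 2 ^ w" "3 * j < 2 ^ w" "3 * j + D ! (u + 2) < 2 ^ w" "u + 2 < 2 ^ w"
    using i buckets_small words(1) u(1) v by (simp_all add: u_def)
  note small = this az
  show ?thesis unfolding level_body_def
  proof (rule ensures_seq)
    show "ensures w D (Basic level_code) \<rho> 19
      (\<lambda>\<rho>'. \<rho>' 30 = s \<and> \<rho>' 29 = b \<and> \<rho>' 32 = z \<and> \<rho>' 37 = slot z \<and> \<rho>' 38 = D ! slot z \<and>
         \<rho>' 31 = \<rho> 31 \<and> agree {..28} \<rho> \<rho>')"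
    proof -
      have eqs: "y div 2 ^ (b - s) = z" "a * z mod q mod buckets = i" "i * 3 + table = u"
        "D ! u * z mod q mod D ! Suc u = j"
        by (simp_all add: z_def i_def u_def j_def)
      have sl': "slot z = j * 3 + D ! Suc (Suc u)" using sl by simp
      have bounds: "i * 3 < 2 ^ w" "u < 2 ^ w" "Suc u < 2 ^ w" "Suc (Suc u) < 2 ^ w" "u < length D"
        "Suc u < length D" "Suc (Suc u) < length D" "j * 3 < 2 ^ w" "j * 3 + D ! Suc (Suc u) < 2 ^ w"
        "j * 3 + D ! Suc (Suc u) < length D"
        using small u v by simp_all
      show ?thesis
        using \<rho> s az bounds by (intro ensures_basicI) (simp_all add: level_code_def eqs sl')
    qed
  next
    fix \<rho>' assume *: "\<rho>' 30 = s \<and> \<rho>' 29 = b \<and> \<rho>' 32 = z \<and> \<rho>' 37 = slot z \<and> \<rho>' 38 = D ! slot z \<and>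
         \<rho>' 31 = \<rho> 31 \<and> agree {..28} \<rho> \<rho>'"
    show "ensures w D (Ite (Eq 38 32) (Basic [Alu Sub 29 29 30, Imm 31 0, Alu Add 31 37 31]) (Basic [])) \<rho>' 5
      (\<lambda>\<rho>'. \<rho>' 30 = s \<and> (if y div 2 ^ (b - s) \<in> Z
        then \<rho>' 29 = b - s \<and> \<rho>' 31 = slot (y div 2 ^ (b - s))
        else \<rho>' 29 = b \<and> \<rho>' 31 = \<rho> 31) \<and> agree {..28} \<rho> \<rho>')"
      unfolding z_def[symmetric]
      by (rule ensures_if[where T = 3]; (intro ensures_basicI)?)
        (use * s slot(2)[OF z] sl small in auto)
  qed simp
qed

text \<open>Invariant: the block around \<open>y\<close> on level \<open>b\<close> is in
  \<open>Z\<close> and the one \<open>2 ^ n\<close> levels below is not. Whatever the lookup half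
  way answers, one half of the window has the same property; at width \<open>1\<close> the two
  blocks are parent and child.\<close>

lemma levels_correct:
  assumes "\<rho> 30 = 2 ^ n" "\<rho> 29 = b" "\<rho> 28 = y" "\<rho> 21 = q" "\<rho> 22 = a" "\<rho> 23 = buckets"
    "\<rho> 24 = table" "\<rho> 25 = 1" "\<rho> 26 = 2" "\<rho> 27 = 3" "\<rho> 31 = slot (y div 2 ^ b)"
    and "2 ^ n \<le> b" "b < 2 ^ w" "y < q" "y div 2 ^ b \<in> Z" "y div 2 ^ (b - 2 ^ n) \<notin> Z"
  shows "ensures w D (While (Lt 25 30) level_body) \<rho> (26 * n + 2)
    (\<lambda>\<rho>'. \<exists>b'. 1 \<le> b' \<and> b' \<le> b \<and> \<rho>' 29 = b' \<and> \<rho>' 31 = slot (y div 2 ^ b') \<and>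
       y div 2 ^ b' \<in> Z \<and> y div 2 ^ (b' - 1) \<notin> Z \<and> agree {..28} \<rho> \<rho>')"
  using assms
proof (induction n arbitrary: \<rho> b)
  case 0
  then show ?case by (intro ensures_while_false) auto
next
  case (Suc n)
  let ?s = "2 ^ n :: nat"
  have s: "?s \<le> b" "?s \<le> b - ?s" "b - ?s \<le> b" using Suc.prems(12) by simp_all
  have holds: "holds (Lt 25 30) \<rho>" using Suc.prems(1,8) one_less_power[of "2 :: nat" "Suc n"] by simp
  note body = level_body_correct[of \<rho> ?s b y, OF _ Suc.prems(2-10) s(1) Suc.prems(13,14)]
  show ?case
  proof (rule ensures_while_true[OF holds body, where T' = "26 * n + 2"])
    fix \<rho>' assume *: "\<rho>' 30 = ?s \<and> (if y div 2 ^ (b - ?s) \<in> Z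
        then \<rho>' 29 = b - ?s \<and> \<rho>' 31 = slot (y div 2 ^ (b - ?s))
        else \<rho>' 29 = b \<and> \<rho>' 31 = \<rho> 31) \<and> agree {..28} \<rho> \<rho>'"
    have regs: "\<rho>' 28 = y" "\<rho>' 21 = q" "\<rho>' 22 = a" "\<rho>' 23 = buckets"
      "\<rho>' 24 = table" "\<rho>' 25 = 1" "\<rho>' 26 = 2" "\<rho>' 27 = 3"
      using * Suc.prems by simp_all
    show "ensures w D (While (Lt 25 30) level_body) \<rho>' (26 * n + 2)
      (\<lambda>\<rho>'. \<exists>b'. 1 \<le> b' \<and> b' \<le> b \<and> \<rho>' 29 = b' \<and> \<rho>' 31 = slot (y div 2 ^ b') \<and>
       y div 2 ^ b' \<in> Z \<and> y div 2 ^ (b' - 1) \<notin> Z \<and> agree {..28} \<rho> \<rho>')"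
    proof (cases "y div 2 ^ (b - ?s) \<in> Z")
      case True
      have "b - ?s - ?s = b - 2 ^ Suc n" by simp
      then have "y div 2 ^ (b - ?s - ?s) \<notin> Z" using Suc.prems(16) by simp
      moreover have "b - ?s < 2 ^ w" using Suc.prems(13) by linarith
      ultimately show ?thesis
        using True * s by (intro ensures_mono[OF Suc.IH[OF _ _ regs _ s(2) _ Suc.prems(14)]]) force+
    next
      case False
      then show ?thesis
        using * Suc.prems by (intro ensures_mono[OF Suc.IH[OF _ _ regs _ s(1) Suc.prems(13,14)]]) force+
    qed
  qed (use Suc.prems in simp_all)
qed

lemma rank_body_correct:
  assumes \<rho>: "\<rho> 30 = 2 * s" "\<rho> 33 = r" "\<rho> 20 = x" "\<rho> 25 = 1" "\<rho> 26 = 2" "\<rho> 27 = 5"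
    "\<rho> 34 = keys" "\<rho> 35 = M"
    and r: "r \<le> rank x" and s: "0 < s" "M + s < 2 ^ w" and x: "x < 2 ^ L"
  shows "ensures w D rank_body \<rho> 12
    (\<lambda>\<rho>'. \<rho>' 30 = s \<and> \<rho>' 33 = (if r + s \<le> rank x then r + s else r) \<and>
      agree ({..28} \<union> {34, 35}) \<rho> \<rho>')"
proof -
  let ?Q = "\<lambda>\<rho>'. \<rho>' 30 = s \<and> \<rho>' 33 = (if r + s \<le> rank x then r + s else r) \<and>
      agree ({..28} \<union> {34, 35}) \<rho> \<rho>'"
  have rM: "rank x \<le> M" using rank(1)[OF x] by simp
  have rs: "r + s < 2 ^ w" using s(2) r rM by linarith
  show ?thesis unfolding rank_body_def
  proof (rule ensures_seq)
    show "ensures w D (Basic [Alu Div 30 30 26, Alu Add 37 33 30]) \<rho> 2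
       (\<lambda>\<rho>'. \<rho>' = \<rho>(30 := s, 37 := r + s))"
      using \<rho> rs by (intro ensures_basicI) simp_all
    fix \<rho>1 assume 1: "\<rho>1 = \<rho>(30 := s, 37 := r + s)"
    show "ensures w D (Ite (Lt 35 37) (Basic [])
        (Seq (Basic [Alu Sub 38 37 25, Alu Mul 38 38 27, Alu Add 38 38 34, Load 38 38])
          (Ite (Lt 20 38) (Basic []) (Basic [Imm 38 0, Alu Add 33 37 38])))) \<rho>1 10 ?Q"
    proof (rule ensures_if[where T = 8])
      assume "holds (Lt 35 37) \<rho>1"
      then have "\<not> r + s \<le> rank x" using 1 \<rho> rM by simp
      then show "ensures w D (Basic []) \<rho>1 8 ?Q" using 1 \<rho> by (intro ensures_basicI) simp_all
    next
      assume "\<not> holds (Lt 35 37) \<rho>1"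
      then have t: "r + s \<le> M" using 1 \<rho> by simp
      let ?t = "r + s - 1"
      have "?t < M" using t s(1) by linarith
      then have kt: "?t * 5 + keys < length D" using keys by linarith
      have key: "D ! (?t * 5 + keys) \<le> x \<longleftrightarrow> r + s \<le> rank x"
        using rank(2)[OF x, of "r + s"] s(1) t by (simp add: add.commute mult.commute)
      show "ensures w D (Seq (Basic [Alu Sub 38 37 25, Alu Mul 38 38 27, Alu Add 38 38 34, Load 38 38])
          (Ite (Lt 20 38) (Basic []) (Basic [Imm 38 0, Alu Add 33 37 38]))) \<rho>1 8 ?Q"
      proof (rule ensures_seq)
        show "ensures w D (Basic [Alu Sub 38 37 25, Alu Mul 38 38 27, Alu Add 38 38 34, Load 38 38]) \<rho>1 4
          (\<lambda>\<rho>'. \<rho>' = \<rho>1(38 := D ! (?t * 5 + keys)))"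
        proof -
          have "?t * 5 < 2 ^ w" "?t * 5 + keys < 2 ^ w" "Suc 0 \<le> r + s"
            using kt words(1) s(1) by linarith+
          then show ?thesis
            using 1 \<rho> rs kt by (intro ensures_basicI) (simp_all)
        qed
        fix \<rho>2 assume "\<rho>2 = \<rho>1(38 := D ! (?t * 5 + keys))"
        then show "ensures w D (Ite (Lt 20 38) (Basic []) (Basic [Imm 38 0, Alu Add 33 37 38])) \<rho>2 4 ?Q"
          using 1 \<rho> key rs by (intro ensures_if[where T = 2] ensures_basicI) auto
      qed simp
    qed simp
  qed simp
qed

text \<open>\<open>rank x\<close> lies in a window of \<open>2 ^ n\<close> candidates from
  \<open>r\<close> on, which the key in its middle halves. The bound on \<open>M + 2 ^ n\<close>
  keeps candidates beyond the last key from overflowing.\<close>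

lemma ranks_correct:
  assumes "\<rho> 30 = 2 ^ n" "\<rho> 33 = r" "\<rho> 20 = x" "\<rho> 25 = 1" "\<rho> 26 = 2" "\<rho> 27 = 5"
    "\<rho> 34 = keys" "\<rho> 35 = M"
    and "r \<le> rank x" "rank x < r + 2 ^ n" "M + 2 ^ n < (2 :: nat) ^ w" "x < 2 ^ L"
  shows "ensures w D (While (Lt 25 30) rank_body) \<rho> (14 * n + 2)
    (\<lambda>\<rho>'. \<rho>' 33 = rank x \<and> agree ({..28} \<union> {34, 35}) \<rho> \<rho>')"
  using assms
proof (induction n arbitrary: \<rho> r)
  case 0
  then show ?case by (intro ensures_while_false) auto
next
  case (Suc n)
  let ?s = "2 ^ n :: nat"
  have s: "0 < ?s" "M + ?s < 2 ^ w" using Suc.prems(11) by simp_all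
  have holds: "holds (Lt 25 30) \<rho>" using Suc.prems(1,4) one_less_power[of "2 :: nat" "Suc n"] by simp
  note body = rank_body_correct[of \<rho> ?s r x, OF _ Suc.prems(2-9) s Suc.prems(12)]
  show ?case
  proof (rule ensures_while_true[OF holds body, where T' = "14 * n + 2"])
    fix \<rho>' assume *: "\<rho>' 30 = ?s \<and> \<rho>' 33 = (if r + ?s \<le> rank x then r + ?s else r) \<and>
      agree ({..28} \<union> {34, 35}) \<rho> \<rho>'"
    have regs: "\<rho>' 20 = x" "\<rho>' 25 = 1" "\<rho>' 26 = 2" "\<rho>' 27 = 5" "\<rho>' 34 = keys" "\<rho>' 35 = M"
      using * Suc.prems by simp_all
    let ?r = "if r + ?s \<le> rank x then r + ?s else r"
    have r: "?r \<le> rank x" "rank x < ?r + ?s" using Suc.prems(9,10) by auto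
    show "ensures w D (While (Lt 25 30) rank_body) \<rho>' (14 * n + 2)
       (\<lambda>\<rho>'. \<rho>' 33 = rank x \<and> agree ({..28} \<union> {34, 35}) \<rho> \<rho>')"
      using * by (intro ensures_mono[OF Suc.IH[OF _ _ regs r s(2) Suc.prems(12)]]) force+
  qed (use Suc.prems in simp_all)
qed

lemma words_suffice: "M + 2 * L < 2 ^ w" "2 ^ (L + 1) < (2 :: nat) ^ w" "L < 2 ^ w"
proof -
  obtain n where "L = 2 ^ n" using L by blast
  then have L1: "1 \<le> L" by simp
  have "(2 :: nat) \<le> 2 ^ L" using power_increasing[of 1 L "2 :: nat"] L1 by simp
  then have q4: "4 \<le> q" using q(1) by linarith
  have "4 * q \<le> q * q" using q4 by (rule mult_le_mono1)
  then have 1: "4 * q < 2 ^ w" using words(3) by linarith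
  have 2: "L < 2 ^ L" by (rule less_exp)
  have "5 * M < 2 ^ w" using keys words(1) by linarith
  then show "M + 2 * L < 2 ^ w" using 1 2 q(1) by linarith
  show "2 ^ (L + 1) < (2 :: nat) ^ w" using 1 q(1) by (simp only: power_add) simp
  show "L < 2 ^ w" using 1 2 q(1) by linarith
qed

text \<open>As \<open>L = 2 ^ n\<close>, the first loop searches \<open>L\<close> levels in
  \<open>n\<close> rounds of \<open>26\<close> steps and the second one a window of
  \<open>2 * L\<close> ranks in \<open>n + 1\<close> rounds of \<open>14\<close>.\<close>

theorem predecessor_correct:
  assumes L_eq: "L = 2 ^ n" and x: "\<rho> 20 = x" "x < 2 ^ L"
  shows "ensures w D predecessor \<rho> (40 * n + 58)
    (\<lambda>\<rho>'. \<rho>' 33 = keys + 5 * (rank x - 1) \<and> agree {..20} \<rho> \<rho>')"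
proof -
  let ?y = "x + 2 ^ L"
  let ?P1 = "\<lambda>\<rho>'. \<rho>' 30 = L \<and> \<rho>' 29 = L \<and> \<rho>' 28 = ?y \<and> \<rho>' 21 = q \<and> \<rho>' 22 = a \<and>
    \<rho>' 23 = buckets \<and> \<rho>' 24 = table \<and> \<rho>' 25 = 1 \<and> \<rho>' 26 = 2 \<and> \<rho>' 27 = 3 \<and> \<rho>' 31 = slot 1 \<and>
    agree {..20} \<rho> \<rho>'"
  let ?P2 = "\<lambda>\<rho>'. \<exists>b. 1 \<le> b \<and> b \<le> L \<and> \<rho>' 29 = b \<and> \<rho>' 31 = slot (?y div 2 ^ b) \<and>
    ?y div 2 ^ b \<in> Z \<and> ?y div 2 ^ (b - 1) \<notin> Z \<and> \<rho>' 28 = ?y \<and> \<rho>' 25 = 1 \<and> \<rho>' 26 = 2 \<and>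
    agree {..20} \<rho> \<rho>'"
  let ?P3 = "\<lambda>\<rho>'. \<rho>' 30 = 2 ^ Suc n \<and> \<rho>' 33 \<le> rank x \<and> rank x < \<rho>' 33 + 2 ^ Suc n \<and> \<rho>' 25 = 1 \<and>
    \<rho>' 26 = 2 \<and> \<rho>' 27 = 5 \<and> \<rho>' 34 = keys \<and> \<rho>' 35 = M \<and> agree {..20} \<rho> \<rho>'"
  let ?P4 = "\<lambda>\<rho>'. \<rho>' 33 = rank x \<and> \<rho>' 25 = 1 \<and> \<rho>' 27 = 5 \<and> \<rho>' 34 = keys \<and> agree {..20} \<rho> \<rho>'"
  have y: "?y < q" using x q(1) by linarith
  have y_words: "?y < 2 ^ w" using y q_small by linarith
  have y_top: "?y div 2 ^ L = 1" using x by simp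
  have y_bottom: "?y \<notin> Z" by (rule bottom) simp
  have A1: "ensures w D (Basic init_code) \<rho> 20
     ?P1"
  proof -
    have "Suc 0 < length D" "2 < length D" "3 < length D" "4 < length D" "6 < length D" "7 < length D"
      "10 < length D" "D ! Suc 0 = q"
      using header by simp_all
    moreover have "2 ^ L + x < 2 ^ w" using y_words by simp
    ultimately show ?thesis
      using header(2-9) root(1) big x(1) words_suffice(3) by (intro ensures_basicI) (simp_all add: init_code_def add.commute)
  qed
  have A2: "ensures w D (While (Lt 25 30) level_body) \<rho>' (26 * n + 2)
     ?P2"
    if "?P1 \<rho>'" for \<rho>'
    by (rule ensures_mono[OF levels_correct[of \<rho>' n L ?y]])
      (use that L_eq y y_top y_bottom root(2) words_suffice(3) in auto)
  have A3: "ensures w D (Basic middle_code) \<rho>' 14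
     ?P3"
    if ex: "?P2 \<rho>'" for \<rho>'
  proof -
    obtain b where b: "1 \<le> b" "b \<le> L" "\<rho>' 29 = b" "\<rho>' 31 = slot (?y div 2 ^ b)"
       "?y div 2 ^ b \<in> Z" "?y div 2 ^ (b - 1) \<notin> Z" "\<rho>' 28 = ?y" "\<rho>' 25 = 1" "\<rho>' 26 = 2"
       "agree {..20} \<rho> \<rho>'"
      using ex by blast
    define e where "e = slot (?y div 2 ^ b)"
    define bit where "bit = ?y div 2 ^ (b - 1) mod 2"
    have "?y div 2 ^ b < q" using y div_le_dividend[of ?y "2 ^ b"] by linarith
    then have e: "e + 2 < length D" using slot(1) by (simp add: e_def)
    have bit: "bit \<le> 1" by (simp add: bit_def)
    have r: "D ! (e + 1 + bit) \<le> rank x" "rank x < D ! (e + 1 + bit) + 2 * L"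
      using range[OF x(2) b(1,2,5,6)] by (simp_all add: e_def bit_def)
    have pow: "2 ^ Suc n = L * 2" using L_eq by simp
    have eqs: "?y div 2 ^ (b - Suc 0) mod 2 = bit" "slot (?y div 2 ^ b) = e" by (simp_all add: e_def bit_def)
    have "e + 1 < 2 ^ w" "e + 1 + bit < length D" "e + 1 + bit < 2 ^ w" "Suc 0 \<le> b" "b < 2 ^ w"
      "8 < length D" "9 < length D" "6 < length D" "L * 2 < 2 ^ w"
      using e bit words(1) b(1,2) words_suffice header(1) by linarith+
    then show ?thesis
      unfolding pow using b(3,4,7-10) header(6,8,9) big r by (intro ensures_basicI) (simp_all add: middle_code_def eqs)
  qed
  have A4: "ensures w D (While (Lt 25 30) rank_body) \<rho>' (14 * Suc n + 2)
     ?P4"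
    if "?P3 \<rho>'" for \<rho>'
    by (rule ensures_mono[OF ranks_correct[of \<rho>' "Suc n" "\<rho>' 33" x]])
      (use that x words_suffice(1) L_eq in auto)
  have A5: "ensures w D (Basic [Alu Sub 33 33 25, Alu Mul 33 33 27, Alu Add 33 33 34]) \<rho>' 3
      (\<lambda>\<rho>'. \<rho>' 33 = keys + 5 * (rank x - 1) \<and> agree {..20} \<rho> \<rho>')"
    if "?P4 \<rho>'" for \<rho>'
  proof -
    have "Suc 0 \<le> rank x" "rank x < 2 ^ w" "(rank x - Suc 0) * 5 < 2 ^ w" "(rank x - Suc 0) * 5 + keys < 2 ^ w"
      using rank(1)[OF x(2)] keys words(1) by linarith+
    then show ?thesis
      using that by (intro ensures_basicI) (simp_all)
  qed
  show ?thesis unfolding predecessor_def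
    by (rule ensures_seq[OF A1 ensures_seq[OF A2 ensures_seq[OF A3 ensures_seq[OF A4 A5 le_refl]
            le_refl] le_refl]]) simp_all
qed

end

section \<open>The index of a set of keys\<close>

lemma sorted_list_rank:
  fixes K :: "nat set"
  assumes "finite K" "t < card K"
  shows "sorted_list_of_set K ! t \<le> x \<longleftrightarrow> t < card {k \<in> K. k \<le> x}"
proof -
  let ?l = "sorted_list_of_set K"
  have len: "length ?l = card K" and K: "set ?l = K" using assms(1) by simp_all
  have mono: "?l ! i \<le> ?l ! j" if "i \<le> j" "j < card K" for i j
    using sorted_nth_mono[OF sorted_sorted_list_of_set that(1)] that(2) len by simp
  have inj: "inj_on ((!) ?l) {..<card K}"
    using inj_on_nth[of ?l "{..<card K}"] len by simp
  show ?thesis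
  proof
    assume le: "?l ! t \<le> x"
    have "(!) ?l ` {..t} \<subseteq> {k \<in> K. k \<le> x}"
    proof
      fix k assume "k \<in> (!) ?l ` {..t}"
      then obtain i where i: "i \<le> t" "k = ?l ! i" by auto
      then have "k \<le> x" using mono[OF i(1) assms(2)] le by simp
      moreover have "k \<in> K" using i assms(2) len K nth_mem[of i ?l] by simp
      ultimately show "k \<in> {k \<in> K. k \<le> x}" by simp
    qed
    then have "card ((!) ?l ` {..t}) \<le> card {k \<in> K. k \<le> x}" using assms(1) by (intro card_mono) simp_all
    moreover have "card ((!) ?l ` {..t}) = card {..t}"
      using assms(2) by (intro card_image inj_on_subset[OF inj]) auto
    ultimately show "t < card {k \<in> K. k \<le> x}" by simp
  next
    assume less: "t < card {k \<in> K. k \<le> x}"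
    show "?l ! t \<le> x"
    proof (rule ccontr)
      assume gr: "\<not> ?l ! t \<le> x"
      have "{k \<in> K. k \<le> x} \<subseteq> (!) ?l ` {..<t}"
      proof
        fix k assume k: "k \<in> {k \<in> K. k \<le> x}"
        then obtain i where i: "i < card K" "k = ?l ! i" using K len by (metis (mono_tags) in_set_conv_nth mem_Collect_eq)
        have "i < t"
        proof (rule ccontr)
          assume "\<not> i < t"
          then have "?l ! t \<le> k" using mono[of t i] i by simp
          then show False using k gr by simp
        qed
        then show "k \<in> (!) ?l ` {..<t}" using i(2) by blast
      qed
      then have "card {k \<in> K. k \<le> x} \<le> card ((!) ?l ` {..<t})" by (intro card_mono) simp_all
      also have "\<dots> \<le> t" using card_image_le[of "{..<t}"] by simp
      finally show False using less by simp
    qed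
  qed
qed

lemma sorted_list_predecessor:
  fixes K :: "nat set"
  assumes K: "finite K" and k: "k \<in> K" "k \<le> x" "\<And>k'. k' \<in> K \<Longrightarrow> k' \<le> x \<Longrightarrow> k' \<le> k"
  shows "sorted_list_of_set K ! (card {k \<in> K. k \<le> x} - 1) = k"
proof -
  let ?l = "sorted_list_of_set K" and ?r = "card {k \<in> K. k \<le> x}"
  have r: "0 < ?r" "?r \<le> card K" using K k by (auto simp: card_gt_0_iff intro: card_mono)
  have "?r - 1 < card K" using r by linarith
  then have mem: "?l ! (?r - 1) \<in> K" using K by (metis length_sorted_list_of_set nth_mem set_sorted_list_of_set)
  obtain i where i: "i < card K" "?l ! i = k"
    using k(1) K by (metis in_set_conv_nth length_sorted_list_of_set set_sorted_list_of_set)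
  have "i < ?r" using sorted_list_rank[OF K i(1), of x] i(2) k(2) by simp
  then have "k \<le> ?l ! (?r - 1)"
    using sorted_nth_mono[OF sorted_sorted_list_of_set, of i "?r - 1" K] i r by auto
  moreover have "?l ! (?r - 1) \<le> x" using sorted_list_rank[OF K, of "?r - 1" x] r by simp
  ultimately show ?thesis using k(3)[OF mem] by simp
qed

locale key_index =
  fixes K :: "nat set" and payload :: "nat \<Rightarrow> nat list" and w p R q L n :: nat
  assumes K: "finite K" "0 \<in> K" "\<And>k. k \<in> K \<Longrightarrow> k < 2 ^ L"
    and payload: "\<And>k. k \<in> K \<Longrightarrow> length (payload k) = 4"
      "\<And>k x. k \<in> K \<Longrightarrow> x \<in> set (payload k) \<Longrightarrow> x < 2 ^ w"
    and q: "prime q" "2 * 2 ^ L \<le> q" "q * q < 2 ^ w"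
    and L: "L = 2 ^ n"
    and pR: "p < 2 ^ w" "R < 2 ^ w"
    and fits: "29 * card K + 40 < 2 ^ w"
begin

text \<open>
  A number \<open>z\<close> denotes the block of all keys \<open>k\<close> with \<open>(k + 2 ^ L) div 2 ^ h = z\<close>; the leading bit of
  \<open>z\<close> determines the level \<open>h\<close>. A block is heavy if it contains more than \<open>L\<close> keys.
\<close>

definition block :: "nat \<Rightarrow> nat \<Rightarrow> nat set" where
  "block h z = {k \<in> K. (k + 2 ^ L) div 2 ^ h = z}"

text \<open>\<open>1\<close> is the block of all keys. It is inserted explicitly so that the level
  search has a starting point even if there are at most \<open>L\<close> keys.\<close>

definition heavy :: "nat set" where
  "heavy = insert 1 {z. \<exists>h\<le>L. L < card (block h z)}"

definition level :: "nat \<Rightarrow> nat" where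
  "level z = (LEAST h. 2 ^ L \<le> z * 2 ^ h)"

text \<open>The level search stops at a heavy block whose child towards the argument is light. Light
  blocks have no slot, so the rank at which each child begins is stored with the parent.\<close>

definition below :: "nat \<Rightarrow> nat \<Rightarrow> nat" where
  "below z e = card {k \<in> K. k + 2 ^ L < (2 * z + e) * 2 ^ (level z - 1)}"

lemma L_pos: "1 \<le> L"
  by (simp add: L)

lemma pow_L: "2 \<le> (2 :: nat) ^ L"
  using power_increasing[of 1 L "2 :: nat"] L_pos by simp

lemma finite_block: "finite (block h z)"
  using K(1) by (simp add: block_def)

lemma card_block_0: "card (block 0 z) \<le> 1"
proof -
  have "block 0 z \<subseteq> {z - 2 ^ L}" by (auto simp: block_def)
  then show ?thesis using card_mono[of "{z - 2 ^ L}"] by simp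
qed

lemma heavy_level:
  assumes "(L + 1) \<le> card (block h z)"
  shows "1 \<le> h" "\<exists>k\<in>K. z = (k + 2 ^ L) div 2 ^ h"
proof -
  show "1 \<le> h" using assms card_block_0[of z] L_pos by (cases h) auto
  have "block h z \<noteq> {}" using assms by auto
  then show "\<exists>k\<in>K. z = (k + 2 ^ L) div 2 ^ h" by (auto simp: block_def)
qed

lemma heavy_less: "z \<in> heavy \<Longrightarrow> z < 2 ^ L"
proof (cases "z = 1")
  case False
  assume "z \<in> heavy"
  with False have "\<exists>h\<le>L. L < card (block h z)" by (simp add: heavy_def)
  then obtain h where "L < card (block h z)" by blast
  then have h: "L + 1 \<le> card (block h z)" by simp
  obtain k where k: "k \<in> K" "z = (k + 2 ^ L) div 2 ^ h" using heavy_level(2)[OF h] by blast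
  have "(2 :: nat) ^ 1 \<le> 2 ^ h" using heavy_level(1)[OF h] by (intro power_increasing) simp_all
  then have "z \<le> (k + 2 ^ L) div 2" unfolding k(2) by (intro div_le_mono2) simp_all
  then show ?thesis using K(3)[OF k(1)] by linarith
qed (use pow_L in simp)

lemma finite_heavy: "finite heavy"
  using heavy_less finite_subset[of heavy "{..<2 ^ L}"] by auto

text \<open>On one level the heavy blocks other than \<open>1\<close> are disjoint and have more
  than \<open>L\<close> keys each, so \<open>L\<close> times their number is at most
  \<open>card K\<close>. Level \<open>0\<close> has none, and the remaining \<open>L\<close> levels
  together contribute at most \<open>card K\<close>.\<close>

lemma card_heavy: "card heavy \<le> card K + 1"
proof -
  let ?H = "\<lambda>h. {z. L + 1 \<le> card (block h z)}"
  have finH: "finite (?H h)" if "h \<le> L" for h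
    by (rule finite_subset[OF _ finite_heavy]) (use that in \<open>auto simp: heavy_def\<close>)
  have level: "L * card (?H h) \<le> card K" if "h \<le> L" for h
  proof -
    have "L * card (?H h) \<le> (\<Sum>z\<in>?H h. card (block h z))"
      using sum_mono[of "?H h" "\<lambda>_. L" "\<lambda>z. card (block h z)"] by (simp add: mult.commute)
    also have "\<dots> = card (\<Union>z\<in>?H h. block h z)"
      using finH[OF that] finite_block by (intro card_UN_disjoint[symmetric]) (auto simp: block_def)
    also have "\<dots> \<le> card K" using K(1) by (intro card_mono) (auto simp: block_def)
    finally show ?thesis .
  qed
  have "heavy \<subseteq> insert 1 (\<Union>h\<in>{1..L}. ?H h)"
  proof
    fix z assume "z \<in> heavy"
    then consider "z = 1" | h where "h \<le> L" "L + 1 \<le> card (block h z)"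
      unfolding heavy_def using Suc_leI by fastforce
    then show "z \<in> insert 1 (\<Union>h\<in>{1..L}. ?H h)"
    proof cases
      case 2
      then have "h \<in> {1..L}" using heavy_level(1) by simp
      then show ?thesis using 2(2) by blast
    qed simp
  qed
  then have "card heavy \<le> card (insert 1 (\<Union>h\<in>{1..L}. ?H h))"
    using finH by (intro card_mono) auto
  also have "\<dots> \<le> Suc (card (\<Union>h\<in>{1..L}. ?H h))" using finH by (simp add: card_insert_if)
  also have "card (\<Union>h\<in>{1..L}. ?H h) \<le> (\<Sum>h\<in>{1..L}. card (?H h))" by (rule card_UN_le) simp
  finally have 1: "card heavy \<le> Suc (\<Sum>h\<in>{1..L}. card (?H h))" by simp
  have "L * (\<Sum>h\<in>{1..L}. card (?H h)) = (\<Sum>h\<in>{1..L}. L * card (?H h))" by (rule sum_distrib_left)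
  also have "\<dots> \<le> (\<Sum>h\<in>{1..L}. card K)"
  proof (rule sum_mono)
    fix h assume "h \<in> {1..L}"
    then have "h \<le> L" by simp
    then show "L * card (?H h) \<le> card K" by (rule level)
  qed
  also have "\<dots> = L * card K" by simp
  finally have "L * (\<Sum>h\<in>{1..L}. card (?H h)) \<le> L * card K" .
  then have "(\<Sum>h\<in>{1..L}. card (?H h)) \<le> card K"
    using L_pos by (simp only: mult_le_cancel1)
  then show ?thesis using 1 by linarith
qed

lemma heavy_bottom: "2 ^ L \<le> y \<Longrightarrow> y \<notin> heavy"
  using heavy_less leD by blast

lemma level_div:
  assumes "x < 2 ^ L" "b \<le> L"
  shows "level ((x + 2 ^ L) div 2 ^ b) = b"
  unfolding level_def
proof (rule Least_equality)
  have eq: "(2 :: nat) ^ L = 2 ^ (L - b) * 2 ^ b" using assms(2) by (simp add: power_add[symmetric])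
  have "2 ^ (L - b) \<le> (x + 2 ^ L) div 2 ^ b"
    using div_le_mono[of "2 ^ L" "x + 2 ^ L" "2 ^ b"] eq by simp
  then show "2 ^ L \<le> (x + 2 ^ L) div 2 ^ b * 2 ^ b" unfolding eq by simp
next
  fix h assume h: "2 ^ L \<le> (x + 2 ^ L) div 2 ^ b * 2 ^ h"
  show "b \<le> h"
  proof (rule ccontr)
    assume "\<not> b \<le> h"
    then have "(2 :: nat) ^ Suc h \<le> 2 ^ b" by (intro power_increasing) simp_all
    then have "(x + 2 ^ L) div 2 ^ b * 2 ^ Suc h \<le> (x + 2 ^ L) div 2 ^ b * 2 ^ b" by (rule mult_le_mono2)
    also have "\<dots> \<le> x + 2 ^ L" by (rule div_times_less_eq_dividend)
    finally show False using h assms(1) by simp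
  qed
qed

text \<open>The light block around \<open>x\<close> holds at most \<open>L\<close> keys, so the rank
  of \<open>x\<close> exceeds the number of keys before that block by at most \<open>L\<close>. The
  window \<open>2 * L\<close> makes the upper bound strict and is again a power of two.\<close>

lemma below_range:
  assumes "x < 2 ^ L" "1 \<le> b" "b \<le> L" "(x + 2 ^ L) div 2 ^ (b - 1) \<notin> heavy"
  defines "z \<equiv> (x + 2 ^ L) div 2 ^ b" and "z' \<equiv> (x + 2 ^ L) div 2 ^ (b - 1)"
  shows "below z (z' mod 2) \<le> card {k \<in> K. k \<le> x}"
    "card {k \<in> K. k \<le> x} < below z (z' mod 2) + 2 * L"
proof -
  have "z = z' div 2"
    using assms(2) div_exp_eq[of "x + 2 ^ L" "b - 1" 1] by (simp add: z_def z'_def)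
  then have z': "2 * z + z' mod 2 = z'" by simp
  have "level z = b" unfolding z_def by (rule level_div[OF assms(1,3)])
  then have below: "below z (z' mod 2) = card {k \<in> K. k + 2 ^ L < z' * 2 ^ (b - 1)}"
    by (simp add: below_def z')
  have start: "z' * 2 ^ (b - 1) \<le> x + 2 ^ L" unfolding z'_def by (rule div_times_less_eq_dividend)
  show "below z (z' mod 2) \<le> card {k \<in> K. k \<le> x}"
    unfolding below using K(1) start by (intro card_mono) auto
  have light: "card (block (b - 1) z') \<le> L"
  proof (rule ccontr)
    assume "\<not> card (block (b - 1) z') \<le> L"
    then have "\<exists>h\<le>L. L < card (block h z')" using assms(3) by (intro exI[of _ "b - 1"]) simp
    then show False using assms(4) by (simp add: heavy_def z'_def)
  qed
  have "{k \<in> K. k \<le> x} \<subseteq> {k \<in> K. k + 2 ^ L < z' * 2 ^ (b - 1)} \<union> block (b - 1) z'"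
  proof
    fix k assume k: "k \<in> {k \<in> K. k \<le> x}"
    show "k \<in> {k \<in> K. k + 2 ^ L < z' * 2 ^ (b - 1)} \<union> block (b - 1) z'"
    proof (cases "k + 2 ^ L < z' * 2 ^ (b - 1)")
      case False
      then have "z' \<le> (k + 2 ^ L) div 2 ^ (b - 1)" by (simp add: less_eq_div_iff_mult_less_eq)
      moreover have "(k + 2 ^ L) div 2 ^ (b - 1) \<le> z'" unfolding z'_def using k by (intro div_le_mono) simp
      ultimately show ?thesis using k by (simp add: block_def)
    qed (use k in simp)
  qed
  then have "card {k \<in> K. k \<le> x} \<le> card ({k \<in> K. k + 2 ^ L < z' * 2 ^ (b - 1)} \<union> block (b - 1) z')"
    using K(1) finite_block by (intro card_mono) simp_all
  also have "\<dots> \<le> below z (z' mod 2) + card (block (b - 1) z')" unfolding below by (rule card_Un_le)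
  finally show "card {k \<in> K. k \<le> x} < below z (z' mod 2) + 2 * L" using light L_pos by linarith
qed

section \<open>Memory layout of the predecessor index\<close>

definition heavy_count :: nat where
  "heavy_count = card heavy"

definition hash_functions :: "nat \<times> (nat \<Rightarrow> nat) \<times> (nat \<Rightarrow> nat) \<times> (nat \<Rightarrow> nat) \<Rightarrow> bool" where
  "hash_functions = (\<lambda>(a, A, M, B). a < q \<and> (\<forall>i. A i < q) \<and> (\<forall>i. 1 \<le> M i) \<and>
     (\<forall>i<heavy_count. B i + M i \<le> 7 * heavy_count) \<and>
     inj_on (\<lambda>z. B (hash_to q heavy_count a z) + hash_to q (M (hash_to q heavy_count a z)) (A (hash_to q heavy_count a z)) z) heavy)"

lemma hash_functions_exist: "\<exists>h. hash_functions h"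
proof -
  have "heavy \<subseteq> {..<q}"
  proof
    fix z assume "z \<in> heavy"
    then show "z \<in> {..<q}" using heavy_less[of z] q(2) by simp
  qed
  moreover have "heavy \<noteq> {}" by (simp add: heavy_def)
  ultimately obtain a A M B where "a < q \<and> (\<forall>i. A i < q) \<and> (\<forall>i. 1 \<le> M i) \<and>
     (\<forall>i<heavy_count. B i + M i \<le> 7 * heavy_count) \<and>
     inj_on (\<lambda>z. B (hash_to q heavy_count a z) + hash_to q (M (hash_to q heavy_count a z)) (A (hash_to q heavy_count a z)) z) heavy"
    using perfect_hash[OF q(1)] unfolding heavy_count_def by meson
  then have "hash_functions (a, A, M, B)" unfolding hash_functions_def split_conv .
  then show ?thesis by blast
qed

context
  fixes a :: nat and A M B :: "nat \<Rightarrow> nat"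
  assumes perfect: "hash_functions (a, A, M, B)"
begin

definition position :: "nat \<Rightarrow> nat" where
  "position z = B (hash_to q heavy_count a z) + hash_to q (M (hash_to q heavy_count a z)) (A (hash_to q heavy_count a z)) z"

definition table_at :: nat where "table_at = 16 + 5 * card K"
definition slots_at :: nat where "slots_at = table_at + 3 * heavy_count"

text \<open>A slot without a heavy block holds \<open>q\<close>, which differs from every number
  \<open>z < q\<close> that is looked up, so comparing the first word with \<open>z\<close> decides
  membership.\<close>

definition slot_entry :: "nat \<Rightarrow> nat list" where
  "slot_entry s = (if s \<in> position ` heavy
     then (let z = inv_into heavy position s in [z, below z 0, below z 1]) else [q, 0, 0])"

definition key_entry :: "nat \<Rightarrow> nat list" where
  "key_entry t = (let k = sorted_list_of_set K ! t in k # payload k)"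

text \<open>Sixteen header words, five words per key, three per bucket, and
  \<open>7 * heavy_count\<close> slots of three words each.\<close>

definition index :: "nat list" where
  "index = [p, q, a, heavy_count, table_at, slots_at, L, 2 ^ L, 16, card K, slots_at + 3 * position 1, R, 0, 0, 0, 0] @
     map (\<lambda>i. key_entry (i div 5) ! (i mod 5)) [0..<5 * card K] @
     map (\<lambda>i. [A (i div 3), M (i div 3), slots_at + 3 * B (i div 3)] ! (i mod 3)) [0..<3 * heavy_count] @
     map (\<lambda>i. slot_entry (i div 3) ! (i mod 3)) [0..<21 * heavy_count]"

lemma heavy_count_bounds: "1 \<le> heavy_count" "heavy_count \<le> card K + 1"
  using card_heavy finite_heavy by (auto simp: heavy_count_def Suc_le_eq card_gt_0_iff heavy_def)

lemma length_index: "length index = 16 + 5 * card K + 24 * heavy_count"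
  by (simp add: index_def)

lemma length_index_le: "length index \<le> 29 * card K + 40"
  using heavy_count_bounds by (simp add: length_index)

lemma index_key: "t < card K \<Longrightarrow> j < 5 \<Longrightarrow> index ! (16 + 5 * t + j) = key_entry t ! j"
  by (simp add: index_def nth_append)

lemma index_table:
  assumes "i < heavy_count"
  shows "index ! (table_at + 3 * i) = A i" "index ! (table_at + 3 * i + 1) = M i"
    "index ! (table_at + 3 * i + 2) = slots_at + 3 * B i"
proof -
  have "index ! (table_at + 3 * i + j) = [A i, M i, slots_at + 3 * B i] ! j" if "j < 3" for j
    using assms that by (simp add: index_def nth_append table_at_def)
  from this[of 0] this[of 1] this[of 2] show "index ! (table_at + 3 * i) = A i"
    "index ! (table_at + 3 * i + 1) = M i" "index ! (table_at + 3 * i + 2) = slots_at + 3 * B i"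
    by simp_all
qed

lemma index_slot:
  assumes "s < 7 * heavy_count" "j < 3"
  shows "index ! (slots_at + 3 * s + j) = slot_entry s ! j"
  using assms by (simp add: index_def nth_append slots_at_def table_at_def)

lemma position_less: "position z < 7 * heavy_count"
proof -
  let ?i = "hash_to q heavy_count a z"
  have i: "?i < heavy_count" using heavy_count_bounds by (simp add: hash_to_def)
  have "1 \<le> M ?i" "B ?i + M ?i \<le> 7 * heavy_count" using perfect i by (simp_all add: hash_functions_def)
  moreover have "hash_to q (M ?i) (A ?i) z < M ?i" using calculation(1) by (simp add: hash_to_def)
  ultimately show ?thesis unfolding position_def by linarith
qed

lemma inj_position: "inj_on position heavy"
  using perfect unfolding hash_functions_def position_def by simp

lemma slot_entry_heavy: "z \<in> heavy \<Longrightarrow> slot_entry (position z) = [z, below z 0, below z 1]"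
  using inj_position by (simp add: slot_entry_def)

lemma slot_entry_other:
  assumes "z < q"
  shows "slot_entry (position z) ! 0 = z \<longleftrightarrow> z \<in> heavy"
proof (cases "z \<in> heavy")
  case False
  show ?thesis
  proof (cases "position z \<in> position ` heavy")
    case True
    then have "inv_into heavy position (position z) \<in> heavy" by (rule inv_into_into)
    then show ?thesis using True False by (auto simp: slot_entry_def Let_def)
  qed (use False assms in \<open>simp add: slot_entry_def\<close>)
qed (simp add: slot_entry_heavy)

lemma length_index_less: "length index < 2 ^ w"
  using fits length_index_le by simp

lemma index_words: "x \<in> set index \<Longrightarrow> x < 2 ^ w"
proof -
  assume "x \<in> set index"
  have q4: "4 \<le> q" using q(2) pow_L by linarith
  have qw: "q < 2 ^ w" using q(3) mult_le_mono2[of 1 q q] q4 by linarith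
  have below: "below z e < 2 ^ w" for z e
  proof -
    have "below z e \<le> card K" unfolding below_def using K(1) by (intro card_mono) auto
    then show ?thesis using fits by simp
  qed
  consider "x \<in> {p, q, a, heavy_count, table_at, slots_at, L, 2 ^ L, 16, card K, slots_at + 3 * position 1, R, 0}"
    | i where "i < 5 * card K" "x = key_entry (i div 5) ! (i mod 5)"
    | i where "i < 3 * heavy_count" "x = [A (i div 3), M (i div 3), slots_at + 3 * B (i div 3)] ! (i mod 3)"
    | i where "x = slot_entry (i div 3) ! (i mod 3)"
    using \<open>x \<in> set index\<close> unfolding index_def by auto
  then show ?thesis
  proof cases
    case 1
    have "L < 2 ^ L" by (rule less_exp)
    then have "L < 2 ^ w" "(2 :: nat) ^ L < 2 ^ w" using q(2) qw by linarith+
    moreover have "16 + 5 * card K + 24 * heavy_count < 2 ^ w"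
      using length_index_less by (simp only: length_index)
    then have "slots_at + 3 * position 1 < 2 ^ w" "slots_at < 2 ^ w" "table_at < 2 ^ w" "heavy_count < 2 ^ w"
      "card K < 2 ^ w" "(16 :: nat) < 2 ^ w" "(0 :: nat) < 2 ^ w"
      using position_less[of 1] unfolding slots_at_def table_at_def by linarith+
    moreover have "a < q" using perfect by (simp add: hash_functions_def)
    then have "a < 2 ^ w" using qw by linarith
    ultimately show ?thesis using 1 pR qw unfolding insert_iff empty_iff by blast
  next
    case 2
    let ?k = "sorted_list_of_set K ! (i div 5)"
    have "i div 5 < card K" using 2(1) by simp
    then have k: "?k \<in> K" using K(1) by (metis length_sorted_list_of_set nth_mem set_sorted_list_of_set)
    have "length (key_entry (i div 5)) = 5" using payload(1)[OF k] by (simp add: key_entry_def Let_def)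
    then have "x \<in> set (key_entry (i div 5))" using 2(2) by (metis mod_less_divisor nth_mem zero_less_numeral)
    then have "x = ?k \<or> x \<in> set (payload ?k)" by (simp add: key_entry_def Let_def)
    moreover have "?k < 2 ^ w" using K(3)[OF k] q(2) qw by linarith
    ultimately show ?thesis using payload(2)[OF k] by blast
  next
    case 3
    have i: "i div 3 < heavy_count" using 3(1) by simp
    then have "A (i div 3) < q" "B (i div 3) + M (i div 3) \<le> 7 * heavy_count"
      using perfect by (simp_all add: hash_functions_def)
    moreover have "16 + 5 * card K + 24 * heavy_count < 2 ^ w"
      using length_index_less by (simp only: length_index)
    ultimately have "A (i div 3) < 2 ^ w" "M (i div 3) < 2 ^ w" "slots_at + 3 * B (i div 3) < 2 ^ w"
      using qw unfolding slots_at_def table_at_def by linarith+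
    moreover have "x \<in> set [A (i div 3), M (i div 3), slots_at + 3 * B (i div 3)]"
      unfolding 3(2) by (rule nth_mem) simp
    ultimately show ?thesis by auto
  next
    case 4
    let ?s = "slot_entry (i div 3)"
    have "length ?s = 3" by (simp add: slot_entry_def Let_def)
    then have "x \<in> set ?s" using 4 by (metis mod_less_divisor nth_mem zero_less_numeral)
    moreover have "inv_into heavy position (i div 3) < q" if "i div 3 \<in> position ` heavy"
      using heavy_less[OF inv_into_into[OF that]] q(2) by linarith
    ultimately show ?thesis using qw below by (auto simp: slot_entry_def Let_def split: if_splits)
  qed
qed

definition rank :: "nat \<Rightarrow> nat" where
  "rank x = card {k \<in> K. k \<le> x}"

lemma index_header:
  "16 \<le> length index" "index ! 0 = p" "index ! 1 = q" "index ! 2 = a" "index ! 3 = heavy_count" "index ! 4 = table_at"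
  "index ! 6 = L" "index ! 7 = 2 ^ L" "index ! 8 = 16" "index ! 9 = card K"
  "index ! 10 = slots_at + 3 * position 1" "index ! 11 = R"
  by (simp_all add: index_def)

lemma memory_index: "predecessor_memory w index q a heavy_count table_at L 16 (card K)"
proof unfold_locales
  show "0 < heavy_count" using heavy_count_bounds by simp
  show "a < q" using perfect by (simp add: hash_functions_def)
  fix i assume i: "i < heavy_count"
  have "A i < q" "1 \<le> M i" using perfect by (simp_all add: hash_functions_def)
  moreover have "table_at + 3 * i + 2 < length index" using i by (simp add: length_index table_at_def)
  ultimately show "table_at + 3 * i + 2 < length index \<and> index ! (table_at + 3 * i) < q \<and>
      0 < index ! (table_at + 3 * i + 1)"
    unfolding index_table[OF i] by simp
qed (use index_header index_words length_index_less q in auto)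

lemma slot_index: "predecessor_memory.slot index q a heavy_count table_at z = slots_at + 3 * position z"
proof -
  have i: "hash_to q heavy_count a z < heavy_count" using heavy_count_bounds by (simp add: hash_to_def)
  show ?thesis
    unfolding predecessor_memory.slot_def[OF memory_index] Let_def hash_to_def[symmetric] index_table[OF i]
    by (simp add: position_def hash_to_def)
qed

lemma structure_index: "predecessor_structure w index q a heavy_count table_at L 16 (card K) heavy rank"
proof -
  interpret predecessor_memory w index q a heavy_count table_at L 16 "card K" by (rule memory_index)
  show ?thesis
  proof unfold_locales
    show "index ! 10 = slot 1" by (simp only: slot_index index_header)
    show "1 \<in> heavy" by (simp add: heavy_def)
    show "\<exists>n. L = 2 ^ n" using L by blast
    show "y \<notin> heavy" if "2 ^ L \<le> y" for y by (rule heavy_bottom[OF that])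
    show "16 + 5 * card K \<le> length index" by (simp add: length_index)
    fix z assume z: "z < q"
    show "slot z + 2 < length index"
      using position_less[of z] unfolding slot_index
      by (simp add: length_index slots_at_def table_at_def)
    show "index ! slot z = z \<longleftrightarrow> z \<in> heavy"
      using index_slot[OF position_less, of 0 z] slot_entry_other[OF z] unfolding slot_index by simp
  next
    fix x b assume x: "x < 2 ^ L" "1 \<le> b" "b \<le> L" and heavy: "(x + 2 ^ L) div 2 ^ b \<in> heavy"
      and light: "(x + 2 ^ L) div 2 ^ (b - 1) \<notin> heavy"
    let ?z = "(x + 2 ^ L) div 2 ^ b" and ?e = "(x + 2 ^ L) div 2 ^ (b - 1) mod 2"
    have e: "1 + ?e < 3" by simp
    have "index ! (slots_at + 3 * position ?z + (1 + ?e)) = [?z, below ?z 0, below ?z 1] ! (1 + ?e)"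
      by (simp only: index_slot[OF position_less e] slot_entry_heavy[OF heavy])
    also have "\<dots> = below ?z ?e" by (cases "?e = 0") auto
    finally have "index ! (slot ?z + 1 + ?e) = below ?z ?e" by (simp only: slot_index add.assoc)
    then show "index ! (slot ?z + 1 + ?e) \<le> rank x \<and> rank x < index ! (slot ?z + 1 + ?e) + 2 * L"
      using below_range[OF x light] by (simp add: rank_def)
  next
    fix x assume "x < (2 :: nat) ^ L"
    have "0 < rank x" using K by (auto simp: rank_def card_gt_0_iff)
    moreover have "rank x \<le> card K" unfolding rank_def using K(1) by (intro card_mono) auto
    ultimately show "1 \<le> rank x \<and> rank x \<le> card K" by simp
  next
    fix x t assume t: "1 \<le> t" "t \<le> card K"
    then have "index ! (16 + 5 * (t - 1)) = sorted_list_of_set K ! (t - 1)"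
      using index_key[of "t - 1" 0] by (simp add: key_entry_def Let_def)
    then show "index ! (16 + 5 * (t - 1)) \<le> x \<longleftrightarrow> t \<le> rank x"
      using sorted_list_rank[OF K(1), of "t - 1" x] t by (auto simp: rank_def)
  qed
qed

lemma index_record:
  assumes k: "k \<in> K" "k \<le> x" "\<And>k'. k' \<in> K \<Longrightarrow> k' \<le> x \<Longrightarrow> k' \<le> k" and j: "j < 5"
  shows "index ! (16 + 5 * (rank x - 1) + j) = (k # payload k) ! j"
proof -
  have "0 < rank x" "rank x \<le> card K"
    using K(1) k(1,2) by (auto simp: rank_def card_gt_0_iff intro: card_mono)
  then have "rank x - 1 < card K" by linarith
  moreover have "sorted_list_of_set K ! (rank x - 1) = k"
    unfolding rank_def by (rule sorted_list_predecessor[OF K(1) k])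
  ultimately show ?thesis using index_key[OF _ j] by (simp add: key_entry_def Let_def)
qed

end

theorem predecessor_index_exists:
  "\<exists>D. (\<forall>x\<in>set D. x < 2 ^ w) \<and> length D \<le> 29 * card K + 40 \<and> 16 \<le> length D \<and> D ! 0 = p \<and> D ! 11 = R \<and>
     (\<forall>k x \<rho>. k \<in> K \<and> k \<le> x \<and> (\<forall>k'\<in>K. k' \<le> x \<longrightarrow> k' \<le> k) \<and> x < 2 ^ L \<and> \<rho> 20 = x \<longrightarrow>
        ensures w D predecessor \<rho> (40 * n + 58) (\<lambda>\<rho>'. \<rho>' 33 + 4 < length D \<and>
          (\<forall>j<5. D ! (\<rho>' 33 + j) = (k # payload k) ! j) \<and> agree {..20} \<rho> \<rho>'))"
proof -
  obtain a A M B where f: "hash_functions (a, A, M, B)" using hash_functions_exist by auto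
  let ?D = "index a A M B"
  note L_eq = L
  interpret predecessor_structure w ?D q a heavy_count table_at L 16 "card K" heavy rank
    by (rule structure_index[OF f])
  have "ensures w ?D predecessor \<rho> (40 * n + 58) (\<lambda>\<rho>'. \<rho>' 33 + 4 < length ?D \<and>
          (\<forall>j<5. ?D ! (\<rho>' 33 + j) = (k # payload k) ! j) \<and> agree {..20} \<rho> \<rho>')"
    if k: "k \<in> K" "k \<le> x" "\<forall>k'\<in>K. k' \<le> x \<longrightarrow> k' \<le> k" and x: "x < 2 ^ L" "\<rho> 20 = x" for k x \<rho>
  proof (rule ensures_mono[OF predecessor_correct[where n = n and x = x and \<rho> = \<rho>, OF L_eq x(2,1)] le_refl])
    fix \<rho>' assume *: "\<rho>' 33 = 16 + 5 * (rank x - 1) \<and> agree {..20} \<rho> \<rho>'"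
    have "rank x - 1 < card K" using rank(1)[OF x(1)] by linarith
    then have "\<rho>' 33 + 4 < length ?D" using * keys by linarith
    moreover have "\<forall>j<5. ?D ! (\<rho>' 33 + j) = (k # payload k) ! j"
      using index_record[OF f k(1,2)] k(3) * by simp
    ultimately show "\<rho>' 33 + 4 < length ?D \<and>
          (\<forall>j<5. ?D ! (\<rho>' 33 + j) = (k # payload k) ! j) \<and> agree {..20} \<rho> \<rho>'"
      using * by blast
  qed
  then show ?thesis
    using index_words[OF f] length_index_le[OF f] index_header(1,2,12)[OF f]
    by (intro exI[of _ ?D] conjI ballI allI impI; (elim conjE)?) (simp_all only:)
qed

end

section \<open>Queries on a concatenation of strings\<close>

text \<open>Register \<open>33\<close> walks through the record of the piece: start, hash, power of
  \<open>c\<close>, power of \<open>d\<close>, and the base of the second key. That key, left in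
  register \<open>20\<close>, encodes the piece together with the length at which it is cut.
  Registers up to \<open>20\<close> survive \<open>predecessor\<close>.\<close>

definition first_record_code :: "instr list" where
  "first_record_code =
     [Imm 13 1, Load 10 33, Alu Add 33 33 13, Load 3 33, Alu Add 33 33 13, Load 6 33, Alu Add 33 33 13,
      Load 4 33, Alu Add 33 33 13, Load 5 33, Imm 7 11, Load 7 7, Alu Sub 20 2 10, Alu Mul 20 20 7,
      Alu Add 20 20 5]"

definition second_record_code :: "instr list" where
  "second_record_code =
     [Imm 13 1, Alu Add 33 33 13, Load 10 33, Alu Add 33 33 13, Alu Add 33 33 13, Load 11 33, Imm 7 0,
      Load 7 7, Alu Mul 10 10 6, Alu Add 3 3 10, Alu Mod 3 3 7, Alu Mul 4 4 11, Alu Mod 4 4 7]"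

definition string_lookup :: com where
  "string_lookup =
    Seq (Basic [Imm 20 0, Alu Add 20 2 20])
   (Seq predecessor
   (Seq (Basic first_record_code)
   (Seq predecessor
     (Basic second_record_code))))"

definition finds :: "nat \<Rightarrow> nat list \<Rightarrow> nat \<Rightarrow> nat \<Rightarrow> nat list \<Rightarrow> bool" where
  "finds w D T x r \<longleftrightarrow> (\<forall>\<rho>. \<rho> 20 = x \<longrightarrow>
     ensures w D predecessor \<rho> T (\<lambda>\<rho>'. \<rho>' 33 + 4 < length D \<and>
       (\<forall>j<5. D ! (\<rho>' 33 + j) = r ! j) \<and> agree {..20} \<rho> \<rho>'))"

lemma string_lookup_correct:
  assumes first: "finds w D T x [k, A, B, C, E]" and second: "finds w D T ((x - k) * R + E) [k', A', B', C', E']"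
    and D: "16 \<le> length D" "length D < 2 ^ w" "D ! 0 = p" "D ! 11 = R"
    and k: "k \<le> x" "x < 2 ^ w" "(x - k) * R + E < 2 ^ w"
    and p: "2 * (p * p) < 2 ^ w" "A < p" "B < p" "C < p" "A' < p" "C' < p"
    and x: "\<rho> 2 = x"
  shows "ensures w D string_lookup \<rho> (2 * T + 30)
     (\<lambda>\<rho>'. \<rho>' 3 = (A + B * A') mod p \<and> \<rho>' 4 = C * C' mod p \<and> \<rho>' 7 = p \<and> agree {0, 1, 14, 15} \<rho> \<rho>')"
proof -
  let ?P2 = "\<lambda>\<rho>'. \<rho>' 33 + 4 < length D \<and> (\<forall>j<5. D ! (\<rho>' 33 + j) = [k, A, B, C, E] ! j) \<and>
    \<rho>' 2 = x \<and> agree {0, 1, 14, 15} \<rho> \<rho>'"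
  let ?P3 = "\<lambda>\<rho>'. \<rho>' 20 = (x - k) * R + E \<and> \<rho>' 3 = A \<and> \<rho>' 6 = B \<and> \<rho>' 4 = C \<and>
    agree {0, 1, 14, 15} \<rho> \<rho>'"
  let ?P4 = "\<lambda>\<rho>'. \<rho>' 33 + 4 < length D \<and> (\<forall>j<5. D ! (\<rho>' 33 + j) = [k', A', B', C', E'] ! j) \<and>
    \<rho>' 3 = A \<and> \<rho>' 6 = B \<and> \<rho>' 4 = C \<and> agree {0, 1, 14, 15} \<rho> \<rho>'"
  have big: "16 < (2 :: nat) ^ w" using D(1,2) by linarith
  have A1: "ensures w D (Basic [Imm 20 0, Alu Add 20 2 20]) \<rho> 2
      (\<lambda>\<rho>'. \<rho>' 20 = x \<and> \<rho>' 2 = x \<and> agree {0, 1, 14, 15} \<rho> \<rho>')"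
    using x k by (intro ensures_basicI) simp_all
  have A2: "ensures w D predecessor \<rho>' T ?P2"
    if "\<rho>' 20 = x \<and> \<rho>' 2 = x \<and> agree {0, 1, 14, 15} \<rho> \<rho>'" for \<rho>'
  proof -
    have "ensures w D predecessor \<rho>' T (\<lambda>\<rho>''. \<rho>'' 33 + 4 < length D \<and>
       (\<forall>j<5. D ! (\<rho>'' 33 + j) = [k, A, B, C, E] ! j) \<and> agree {..20} \<rho>' \<rho>'')"
      using first that unfolding finds_def by blast
    then show ?thesis by (rule ensures_mono) (use that in auto)
  qed
  have A3: "ensures w D (Basic first_record_code) \<rho>' 15
      ?P3"
    if r: "?P2 \<rho>'" for \<rho>'
  proof -
    let ?a = "\<rho>' 33"
    have j: "D ! (?a + j) = [k, A, B, C, E] ! j" if "j < 5" for j using r that by blast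
    have m: "D ! ?a = k" "D ! Suc ?a = A" "D ! Suc (Suc ?a) = B" "D ! Suc (Suc (Suc ?a)) = C"
      "D ! Suc (Suc (Suc (Suc ?a))) = E"
      using j[of 0] j[of 1] j[of 2] j[of 3] j[of 4] by (simp_all add: numeral_eq_Suc)
    have b: "?a < length D" "Suc ?a < length D" "Suc (Suc ?a) < length D" "Suc (Suc (Suc ?a)) < length D"
      "Suc (Suc (Suc (Suc ?a))) < length D" "Suc ?a < 2 ^ w" "Suc (Suc ?a) < 2 ^ w" "Suc (Suc (Suc ?a)) < 2 ^ w"
      "Suc (Suc (Suc (Suc ?a))) < 2 ^ w" "11 < length D" "(x - k) * R < 2 ^ w"
      using r D k by linarith+
    show ?thesis
      using r big k D(4) b m by (intro ensures_basicI) (simp_all add: first_record_code_def)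
  qed
  have A4: "ensures w D predecessor \<rho>' T ?P4"
    if "?P3 \<rho>'" for \<rho>'
  proof -
    have "ensures w D predecessor \<rho>' T (\<lambda>\<rho>''. \<rho>'' 33 + 4 < length D \<and>
       (\<forall>j<5. D ! (\<rho>'' 33 + j) = [k', A', B', C', E'] ! j) \<and> agree {..20} \<rho>' \<rho>'')"
      using second that unfolding finds_def by blast
    then show ?thesis by (rule ensures_mono) (use that in auto)
  qed
  have A5: "ensures w D (Basic second_record_code) \<rho>' 13
     (\<lambda>\<rho>'. \<rho>' 3 = (A + B * A') mod p \<and> \<rho>' 4 = C * C' mod p \<and> \<rho>' 7 = p \<and> agree {0, 1, 14, 15} \<rho> \<rho>')"
    if r: "?P4 \<rho>'" for \<rho>'
  proof -
    let ?a = "\<rho>' 33"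
    have j: "D ! (?a + j) = [k', A', B', C', E'] ! j" if "j < 5" for j using r that by blast
    have m: "D ! Suc ?a = A'" "D ! Suc (Suc (Suc ?a)) = C'"
      using j[of 1] j[of 3] by (simp_all add: numeral_eq_Suc)
    have b: "Suc ?a < length D" "Suc (Suc (Suc ?a)) < length D"
      "Suc ?a < 2 ^ w" "Suc (Suc ?a) < 2 ^ w" "Suc (Suc (Suc ?a)) < 2 ^ w" "0 < length D"
      using r D by linarith+
    have "p \<le> p * p" using p(2) by simp
    then have "p * p + p < 2 ^ w" using p(1) by linarith
    then have ov: "A' * B < 2 ^ w" "A + A' * B < 2 ^ w" "C * C' < 2 ^ w"
      using p by (auto intro: mult_less_square add_mult_less_square)
    show ?thesis
      using r big D(3) b m ov by (intro ensures_basicI) (simp_all add: second_record_code_def mult.commute)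
  qed
  show ?thesis unfolding string_lookup_def
    by (rule ensures_seq[OF A1 ensures_seq[OF A2 ensures_seq[OF A3 ensures_seq[OF A4 A5 le_refl]
            le_refl] le_refl]]) simp_all
qed

section \<open>Truncation as a predecessor query\<close>

lemma take_mono_lexorder: "x \<le> y \<Longrightarrow> take e x \<le> take e (y :: nat list)"
proof (induction e arbitrary: x y)
  case (Suc e)
  then show ?case by (cases x; cases y) auto
qed simp

lemma take_le_lexorder: "take e x \<le> (x :: nat list)"
proof (induction e arbitrary: x)
  case (Suc e)
  then show ?case by (cases x) auto
qed simp

locale string_pieces =
  fixes xs :: "nat list list" and c d p :: nat
  assumes pieces: "xs \<noteq> []" "\<And>x. x \<in> set xs \<Longrightarrow> x \<noteq> []"
    and inverse: "[c * d = 1] (mod p)" and p: "1 < p"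
begin

abbreviation S :: "nat list" where "S \<equiv> concat xs"
abbreviation N :: nat where "N \<equiv> length S"

definition prefixes :: "nat list set" where
  "prefixes = (\<Union>x\<in>set xs. (\<lambda>e. take e x) ` {..length x})"

definition R :: nat where "R = card prefixes"

definition lex_rank :: "nat list \<Rightarrow> nat" where
  "lex_rank s = card {u \<in> prefixes. u < s}"

definition start :: "nat \<Rightarrow> nat" where
  "start t = length (concat (take t xs))"

text \<open>
  The prefixes are ordered by length, and by the lexicographic order for equal lengths. Truncation
  to length \<open>e\<close> is monotone, so the prefix of length \<open>e\<close> of \<open>x\<close> is the last one of that length that
  does not exceed \<open>x\<close>: truncation is a predecessor query.
\<close>

definition prefix_key :: "nat list \<Rightarrow> nat" where
  "prefix_key s = N + 1 + length s * R + lex_rank s"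

text \<open>Starting positions are at most \<open>N\<close> and prefix keys exceed \<open>N\<close>,
  so a single structure answers both kinds of queries without confusing them.\<close>

definition key_set :: "nat set" where
  "key_set = start ` {..<length xs} \<union> prefix_key ` prefixes"

definition payload :: "nat \<Rightarrow> nat list" where
  "payload k = (if k \<le> N
     then (let t = inv_into {..<length xs} start k in
       [hash c (concat (take t xs)) mod p, c ^ k mod p, d ^ k mod p, N + 1 + lex_rank (xs ! t)])
     else (let s = inv_into prefixes prefix_key k in [hash c s mod p, 0, d ^ length s mod p, 0]))"

lemma finite_prefixes: "finite prefixes"
  by (simp add: prefixes_def)

lemma take_in_prefixes: "x \<in> set xs \<Longrightarrow> take e x \<in> prefixes"
proof -
  assume x: "x \<in> set xs"
  have eq: "take (min e (length x)) x = take e x" by (simp add: min_def)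
  have "min e (length x) \<in> {..length x}" by simp
  then have "take (min e (length x)) x \<in> prefixes" using x unfolding prefixes_def by blast
  then show ?thesis unfolding eq .
qed

lemma prefixes_closed: "s \<in> prefixes \<Longrightarrow> take e s \<in> prefixes"
proof -
  assume "s \<in> prefixes"
  then obtain x e' where x: "x \<in> set xs" "s = take e' x" by (auto simp: prefixes_def)
  then have "take e s = take (min e e') x" by simp
  then show ?thesis using take_in_prefixes[OF x(1)] by simp
qed

lemma lex_rank_less: "s \<in> prefixes \<Longrightarrow> lex_rank s < R"
  unfolding lex_rank_def R_def by (rule psubset_card_mono[OF finite_prefixes]) auto

lemma lex_rank_le_iff:
  assumes "u \<in> prefixes" "v \<in> prefixes"
  shows "lex_rank u \<le> lex_rank v \<longleftrightarrow> u \<le> v"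
proof
  have mono: "lex_rank a \<le> lex_rank b" if "a \<le> b" for a b
    unfolding lex_rank_def using finite_prefixes that by (intro card_mono) auto
  then show "u \<le> v \<Longrightarrow> lex_rank u \<le> lex_rank v" .
  assume le: "lex_rank u \<le> lex_rank v"
  show "u \<le> v"
  proof (rule ccontr)
    assume "\<not> u \<le> v"
    then have "v < u" by simp
    then have "{s \<in> prefixes. s < v} \<subset> {s \<in> prefixes. s < u}" using assms by auto
    then have "lex_rank v < lex_rank u"
      unfolding lex_rank_def using finite_prefixes by (intro psubset_card_mono) auto
    then show False using le by simp
  qed
qed

lemma card_prefixes_le: "R \<le> N + 1"
proof -
  have "prefixes \<subseteq> insert [] (\<Union>x\<in>set xs. (\<lambda>e. take e x) ` {1..length x})"
  proof
    fix s assume "s \<in> prefixes"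
    then obtain x e where "x \<in> set xs" "e \<le> length x" "s = take e x" by (auto simp: prefixes_def)
    then show "s \<in> insert [] (\<Union>x\<in>set xs. (\<lambda>e. take e x) ` {1..length x})"
    proof (cases "e = 0")
      case False
      then have "e \<in> {1..length x}" using \<open>e \<le> length x\<close> by simp
      then show ?thesis using \<open>x \<in> set xs\<close> \<open>s = take e x\<close> by blast
    qed simp
  qed
  then have "R \<le> card (insert [] (\<Union>x\<in>set xs. (\<lambda>e. take e x) ` {1..length x}))"
    unfolding R_def by (intro card_mono) auto
  also have "\<dots> \<le> Suc (card (\<Union>x\<in>set xs. (\<lambda>e. take e x) ` {1..length x}))"
    by (simp add: card_insert_if)
  also have "card (\<Union>x\<in>set ys. (\<lambda>e. take e x) ` {1..length x}) \<le> length (concat ys)" for ys :: "nat list list"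
  proof (induction ys)
    case (Cons y ys)
    have "card (\<Union>x\<in>set (y # ys). (\<lambda>e. take e x) ` {1..length x}) \<le>
        card ((\<lambda>e. take e y) ` {1..length y}) + card (\<Union>x\<in>set ys. (\<lambda>e. take e x) ` {1..length x})"
      by (simp add: card_Un_le)
    also have "card ((\<lambda>e. take e y) ` {1..length y}) \<le> length y"
      using card_image_le[of "{1..length y}" "\<lambda>e. take e y"] by simp
    finally show ?case using Cons by simp
  qed simp
  finally show ?thesis by simp
qed

lemma start_Suc: "t < length xs \<Longrightarrow> start (Suc t) = start t + length (xs ! t)"
  by (simp add: start_def take_Suc_conv_app_nth)

lemma start_mono: "t \<le> t' \<Longrightarrow> start t \<le> start t'"
proof -
  assume "t \<le> t'"
  then have "take t' xs = take t xs @ take (t' - t) (drop t xs)" using take_add[of t "t' - t" xs] by simp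
  then show ?thesis by (simp add: start_def)
qed

lemma start_less: "t < t' \<Longrightarrow> t' \<le> length xs \<Longrightarrow> start t < start t'"
proof -
  assume t: "t < t'" "t' \<le> length xs"
  then have "xs ! t \<noteq> []" using pieces(2) nth_mem[of t xs] by simp
  then have "start t < start (Suc t)" using t by (simp add: start_Suc)
  also have "\<dots> \<le> start t'" using t by (intro start_mono) simp
  finally show ?thesis .
qed

lemma start_length: "start (length xs) = N"
  by (simp add: start_def)

lemma inj_start: "inj_on start {..<length xs}"
proof (rule inj_onI)
  fix t t' assume "t \<in> {..<length xs}" "t' \<in> {..<length xs}" "start t = start t'"
  then show "t = t'" using start_less[of t t'] start_less[of t' t] by (cases t t' rule: linorder_cases) simp_all
qed

lemma prefix_key_greater: "N < prefix_key s"
  by (simp add: prefix_key_def)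

text \<open>Ranks are below \<open>R\<close>, so keys compare by length first. A prefix
  \<open>u\<close> of length \<open>e\<close> that does not exceed \<open>x\<close> is its own
  truncation, and this does not exceed the truncation of \<open>x\<close>.\<close>

lemma prefix_key_le:
  assumes "u \<in> prefixes" "x \<in> prefixes" "prefix_key u \<le> N + 1 + e * R + lex_rank x"
    and "e \<le> length x"
  shows "prefix_key u \<le> prefix_key (take e x)"
proof -
  have len: "length (take e x) = e" using assms(4) by simp
  consider "length u < e" | "length u = e" | "e < length u" by linarith
  then show ?thesis
  proof cases
    case 1
    then have "Suc (length u) * R \<le> e * R" by (intro mult_le_mono1) simp
    then show ?thesis using lex_rank_less[OF assms(1)] len by (simp add: prefix_key_def)
  next
    case 2
    then have "lex_rank u \<le> lex_rank x" using assms(3) by (simp add: prefix_key_def)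
    then have "u \<le> x" using lex_rank_le_iff assms(1,2) by blast
    then have "take e u \<le> take e x" by (rule take_mono_lexorder)
    then have "u \<le> take e x" using 2 by simp
    then have "lex_rank u \<le> lex_rank (take e x)"
      using lex_rank_le_iff[OF assms(1) prefixes_closed[OF assms(2)]] by blast
    then show ?thesis using 2 len by (simp add: prefix_key_def)
  next
    case 3
    then have "Suc e * R \<le> length u * R" by (intro mult_le_mono1) simp
    then have False using lex_rank_less[OF assms(2)] assms(3) by (simp add: prefix_key_def)
    then show ?thesis ..
  qed
qed

lemma inj_prefix_key: "inj_on prefix_key prefixes"
proof (rule inj_onI)
  fix u v assume uv: "u \<in> prefixes" "v \<in> prefixes" "prefix_key u = prefix_key v"
  have "length u = length v"
  proof (rule ccontr)
    assume "length u \<noteq> length v"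
    then consider "Suc (length u) \<le> length v" | "Suc (length v) \<le> length u" by linarith
    then show False
    proof cases
      case 1
      then have "Suc (length u) * R \<le> length v * R" by (rule mult_le_mono1)
      then show False using uv lex_rank_less[OF uv(1)] by (simp add: prefix_key_def)
    next
      case 2
      then have "Suc (length v) * R \<le> length u * R" by (rule mult_le_mono1)
      then show False using uv lex_rank_less[OF uv(2)] by (simp add: prefix_key_def)
    qed
  qed
  then have "lex_rank u = lex_rank v" using uv(3) by (simp add: prefix_key_def)
  then have "u \<le> v" "v \<le> u" using lex_rank_le_iff uv(1,2) by (metis order_refl)+
  then show "u = v" by simp
qed

lemma finite_key_set: "finite key_set"
  using finite_prefixes by (simp add: key_set_def)

lemma card_key_set: "card key_set \<le> length xs + R"
proof -
  have "card key_set \<le> card (start ` {..<length xs}) + card (prefix_key ` prefixes)"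
    unfolding key_set_def by (rule card_Un_le)
  also have "\<dots> \<le> card {..<length xs} + card prefixes"
    using finite_prefixes by (intro add_mono card_image_le) simp_all
  finally show ?thesis by (simp add: R_def)
qed

lemma zero_key: "0 \<in> key_set"
proof -
  have "start 0 = 0" "0 \<in> {..<length xs}" using pieces(1) by (simp_all add: start_def)
  then show ?thesis unfolding key_set_def by (metis UnI1 image_eqI)
qed

lemma start_le: "t < length xs \<Longrightarrow> start t \<le> N"
  using start_mono[of t "length xs"] start_length by simp

lemma payload_start:
  "t < length xs \<Longrightarrow> payload (start t) =
     [hash c (concat (take t xs)) mod p, c ^ start t mod p, d ^ start t mod p, N + 1 + lex_rank (xs ! t)]"
  using inj_start start_le by (simp add: payload_def Let_def)

lemma payload_prefix:
  "s \<in> prefixes \<Longrightarrow> payload (prefix_key s) = [hash c s mod p, 0, d ^ length s mod p, 0]"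
  using inj_prefix_key prefix_key_greater[of s] by (simp add: payload_def Let_def)

lemma length_prefix_le: "s \<in> prefixes \<Longrightarrow> length s \<le> N"
proof -
  assume "s \<in> prefixes"
  then obtain x where x: "x \<in> set xs" "length s \<le> length x" by (auto simp: prefixes_def)
  have "length x \<le> N" using x(1) by (induction xs) auto
  then show ?thesis using x(2) by simp
qed

lemma key_bound:
  assumes "e \<le> N" "x \<in> prefixes"
  shows "N + 1 + e * R + lex_rank x < (N + 2)\<^sup>2"
proof -
  have "e * R + lex_rank x < e * R + R" using lex_rank_less[OF assms(2)] by simp
  also have "\<dots> = Suc e * R" by simp
  also have "\<dots> \<le> (N + 1) * (N + 1)" using assms(1) card_prefixes_le by (intro mult_le_mono) simp_all
  finally have "N + 1 + (e * R + lex_rank x) < N + 1 + (N + 1) * (N + 1)" by simp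
  also have "\<dots> \<le> (N + 2)\<^sup>2" by (simp add: power2_eq_square)
  finally show ?thesis by simp
qed

lemma key_less: "k \<in> key_set \<Longrightarrow> k < (N + 2)\<^sup>2"
proof -
  assume "k \<in> key_set"
  then consider t where "t < length xs" "k = start t" | s where "s \<in> prefixes" "k = prefix_key s"
    unfolding key_set_def by auto
  then show ?thesis
  proof cases
    case 1
    have "N < (N + 2)\<^sup>2" by (simp add: power2_eq_square)
    then show ?thesis using start_le[OF 1(1)] 1(2) by simp
  next
    case 2
    then show ?thesis using key_bound[OF length_prefix_le 2(1), of s] by (simp add: prefix_key_def)
  qed
qed

lemma payload_length: "k \<in> key_set \<Longrightarrow> length (payload k) = 4"
  by (simp add: payload_def Let_def)

lemma payload_words:
  assumes "k \<in> key_set" "v \<in> set (payload k)" "p \<le> B" "(N + 2)\<^sup>2 \<le> B"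
  shows "v < B"
proof -
  have mod: "y mod p < B" for y using p assms(3) mod_less_divisor[of p y] by linarith
  have B: "0 < B" using p assms(3) by linarith
  from assms(1) consider t where "t < length xs" "k = start t" | s where "s \<in> prefixes" "k = prefix_key s"
    unfolding key_set_def by auto
  then show ?thesis
  proof cases
    case 1
    have "xs ! t \<in> prefixes" using take_in_prefixes[of "xs ! t" "length (xs ! t)"] 1(1) by simp
    then have "N + 1 + lex_rank (xs ! t) < B" using key_bound[of 0 "xs ! t"] assms(4) by simp
    then show ?thesis using assms(2) mod unfolding 1(2) payload_start[OF 1(1)] by auto
  next
    case 2
    then show ?thesis using assms(2) mod B unfolding 2(2) payload_prefix[OF 2(1)] by auto
  qed
qed

text \<open>\<open>x = N\<close> has to be covered as well: it belongs to the last piece, read to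
  its end, which is why the bound by the length of the piece is not strict.\<close>

lemma piece_at:
  assumes "x \<le> N"
  obtains t where "t < length xs" "start t \<le> x" "x - start t \<le> length (xs ! t)"
    "\<And>k. k \<in> key_set \<Longrightarrow> k \<le> x \<Longrightarrow> k \<le> start t"
proof -
  let ?T = "{t. t < length xs \<and> start t \<le> x}"
  define t where "t = Max ?T"
  have fin: "finite ?T" by simp
  have "0 \<in> ?T" using pieces(1) by (simp add: start_def)
  then have "t \<in> ?T" unfolding t_def using Max_in[OF fin] by blast
  then have t: "t < length xs" "start t \<le> x" by simp_all
  have max: "t' \<le> t" if "t' < length xs" "start t' \<le> x" for t'
    unfolding t_def using Max_ge[OF fin] that by simp
  have "x \<le> start (Suc t)"
  proof (cases "Suc t < length xs")
    case True
    then show ?thesis using max[of "Suc t"] by force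
  next
    case False
    then have "Suc t = length xs" using t(1) by simp
    then show ?thesis using assms start_length by simp
  qed
  then have "x - start t \<le> length (xs ! t)" using start_Suc[OF t(1)] by simp
  moreover have "k \<le> start t" if k: "k \<in> key_set" "k \<le> x" for k
  proof -
    from k(1) consider t' where "t' < length xs" "k = start t'" | s where "k = prefix_key s"
      unfolding key_set_def by auto
    then show ?thesis
    proof cases
      case 1
      then show ?thesis using max[of t'] k(2) start_mono by simp
    next
      case 2
      then show ?thesis using prefix_key_greater[of s] k(2) assms by linarith
    qed
  qed
  ultimately show ?thesis using that t by blast
qed

lemma take_split:
  assumes "t < length xs" "start t \<le> x" "x - start t \<le> length (xs ! t)"
  shows "take x S = concat (take t xs) @ take (x - start t) (xs ! t)"
proof -
  have "xs = take t xs @ xs ! t # drop (Suc t) xs" using id_take_nth_drop[OF assms(1)] .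
  then have "S = concat (take t xs) @ xs ! t @ concat (drop (Suc t) xs)"
    by (metis concat.simps(2) concat_append)
  then have "take x S = take x (concat (take t xs) @ xs ! t @ concat (drop (Suc t) xs))" by simp
  also have "\<dots> = concat (take t xs) @ take (x - start t) (xs ! t)"
    using assms(2,3) by (simp add: start_def)
  finally show ?thesis .
qed

theorem string_query_answers:
  fixes L q w n :: nat
  assumes levels: "L = 2 ^ n" "(N + 2)\<^sup>2 \<le> 2 ^ L" and q: "prime q" "2 * 2 ^ L \<le> q" "q * q < 2 ^ w"
    and words: "2 * (p * p) < 2 ^ w" "29 * (length xs + R) + 40 < 2 ^ w"
  shows "\<exists>D. (\<forall>x\<in>set D. x < 2 ^ w) \<and> length D \<le> 29 * (length xs + R) + 40 \<and>
    supports_fingerprint w (comp 0 (range_query string_lookup) @ [Halt]) D c p S (real (160 * n + 302))"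
proof -
  have "4 \<le> (N + 2)\<^sup>2" by (simp add: power2_eq_square)
  then have q4: "4 \<le> q" using levels(2) q(2) by linarith
  then have qw: "q < 2 ^ w" using q(3) mult_le_mono2[of 1 q q] by linarith
  have pw: "p < 2 ^ w" using words(1) mult_le_mono2[of 1 p p] p by linarith
  have N2: "(N + 2)\<^sup>2 \<le> 2 ^ w" using levels(2) q(2) qw by linarith
  have Nw: "N < 2 ^ w" using N2 by (simp add: power2_eq_square)
  interpret key_index key_set payload w p R q L n
  proof
    show "k < 2 ^ L" if "k \<in> key_set" for k using key_less[OF that] levels(2) by linarith
    show "v < 2 ^ w" if "k \<in> key_set" "v \<in> set (payload k)" for k v
      using payload_words[OF that] pw N2 by simp
    show "R < 2 ^ w" using words(2) by simp
    show "29 * card key_set + 40 < 2 ^ w" using card_key_set words(2) by simp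
  qed (use finite_key_set zero_key payload_length q levels pw in auto)
  obtain D where D: "\<forall>x\<in>set D. x < 2 ^ w" "length D \<le> 29 * card key_set + 40" "16 \<le> length D" "D ! 0 = p"
      "D ! 11 = R"
    and pred: "\<And>k x \<rho>. k \<in> key_set \<and> k \<le> x \<and> (\<forall>k'\<in>key_set. k' \<le> x \<longrightarrow> k' \<le> k) \<and> x < 2 ^ L \<and> \<rho> 20 = x \<Longrightarrow>
        ensures w D predecessor \<rho> (40 * n + 58) (\<lambda>\<rho>'. \<rho>' 33 + 4 < length D \<and>
          (\<forall>j<5. D ! (\<rho>' 33 + j) = (k # payload k) ! j) \<and> agree {..20} \<rho> \<rho>')"
    using predecessor_index_exists by blast
  have Dw: "length D < 2 ^ w" using D(2) card_key_set words(2) by simp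
  have lookup: "ensures w D string_lookup \<rho> (2 * (40 * n + 58) + 30)
     (\<lambda>\<rho>'. \<rho>' 3 = hash c (take x S) mod p \<and> \<rho>' 4 = d ^ x mod p \<and> \<rho>' 7 = p \<and> agree {0, 1, 14, 15} \<rho> \<rho>')"
    if x: "x \<le> N" "\<rho> 2 = x" for x \<rho>
  proof -
    obtain t where t: "t < length xs" "start t \<le> x" "x - start t \<le> length (xs ! t)"
      and t_max: "\<And>k. k \<in> key_set \<Longrightarrow> k \<le> x \<Longrightarrow> k \<le> start t"
      using piece_at[OF x(1)] by blast
    let ?e = "x - start t" and ?x = "xs ! t"
    let ?s = "take ?e ?x" and ?k = "(x - start t) * R + (N + 1 + lex_rank (xs ! t))"
    have mem: "?x \<in> set xs" using t(1) by simp
    have px: "?x \<in> prefixes" using take_in_prefixes[OF mem, of "length ?x"] by simp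
    have ps: "?s \<in> prefixes" using take_in_prefixes[OF mem] .
    have k: "?k = N + 1 + ?e * R + lex_rank ?x" by simp
    have eN: "?e \<le> N" using x(1) by simp
    have kL: "?k < (N + 2)\<^sup>2" unfolding k by (rule key_bound[OF eN px])
    have key_start: "start t \<in> key_set" using t(1) by (auto simp: key_set_def)
    have xL: "x < 2 ^ L"
    proof -
      have "N < (N + 2)\<^sup>2" by (simp add: power2_eq_square)
      then show ?thesis using x(1) levels(2) by linarith
    qed
    have 1: "finds w D (40 * n + 58) x [start t, hash c (concat (take t xs)) mod p, c ^ start t mod p,
        d ^ start t mod p, N + 1 + lex_rank ?x]"
      unfolding finds_def using pred[of "start t" x] key_start t(2) t_max xL payload_start[OF t(1)] by simp
    have key_s: "prefix_key ?s \<in> key_set" using ps by (auto simp: key_set_def)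
    have len: "length ?s = ?e" using t(3) by simp
    have "lex_rank ?s \<le> lex_rank ?x" using lex_rank_le_iff[OF ps px] take_le_lexorder by blast
    then have le: "prefix_key ?s \<le> ?k" using len by (simp add: prefix_key_def)
    have s_max: "k' \<le> prefix_key ?s" if k': "k' \<in> key_set" "k' \<le> ?k" for k'
    proof -
      from k'(1) consider t' where "t' < length xs" "k' = start t'" | u where "u \<in> prefixes" "k' = prefix_key u"
        unfolding key_set_def by auto
      then show ?thesis
      proof cases
        case 1
        then show ?thesis using start_le[of t'] prefix_key_greater[of ?s] by linarith
      next
        case 2
        then show ?thesis using prefix_key_le[OF 2(1) px _ t(3)] k'(2) k by simp
      qed
    qed
    have "?k < 2 ^ L" using kL levels(2) by linarith
    then have 2: "finds w D (40 * n + 58) ?k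
        [prefix_key ?s, hash c ?s mod p, 0, d ^ length ?s mod p, 0]"
      unfolding finds_def using pred[of "prefix_key ?s" ?k] key_s le s_max payload_prefix[OF ps] by simp
    have "?k < 2 ^ w" "x < 2 ^ w" using kL N2 x(1) Nw by linarith+
    moreover have mod: "y mod p < p" for y using p by simp
    ultimately have "ensures w D string_lookup \<rho> (2 * (40 * n + 58) + 30)
      (\<lambda>\<rho>'. \<rho>' 3 = (hash c (concat (take t xs)) mod p + (c ^ start t mod p) * (hash c ?s mod p)) mod p \<and>
        \<rho>' 4 = (d ^ start t mod p) * (d ^ length ?s mod p) mod p \<and> \<rho>' 7 = p \<and> agree {0, 1, 14, 15} \<rho> \<rho>')"
      by (intro string_lookup_correct[where \<rho> = \<rho> and x = x, OF 1 2 D(3) Dw D(4,5) t(2) _ _ words(1) mod mod mod mod mod x(2)])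
    moreover have "(hash c (concat (take t xs)) mod p + (c ^ start t mod p) * (hash c ?s mod p)) mod p =
        hash c (take x S) mod p"
      unfolding take_split[OF t] hash_append start_def
      by (intro mod_add_cong) (simp_all only: mod_mod_trivial mod_mult_eq)
    moreover have "(d ^ start t mod p) * (d ^ length ?s mod p) mod p = d ^ x mod p"
    proof -
      have "start t + length ?s = x" using len t(2) by simp
      then show ?thesis by (simp only: mod_mult_eq power_add[symmetric])
    qed
    ultimately show ?thesis by (simp only:)
  qed
  have big: "16 < (2 :: nat) ^ w" using words(2) by simp
  \<comment> \<open>Two positions are looked up, with two predecessor queries of
    \<open>40 * n + 58\<close> steps each.\<close>
  have "supports_fingerprint w (comp 0 (range_query string_lookup) @ [Halt]) D c p S
      (real (2 * (2 * (40 * n + 58) + 30) + 10))"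
    by (rule range_query_supports[OF lookup inverse p Nw words(1) big])
  then have "supports_fingerprint w (comp 0 (range_query string_lookup) @ [Halt]) D c p S (real (160 * n + 302))"
    by (simp add: algebra_simps)
  moreover have "length D \<le> 29 * (length xs + R) + 40" using D(2) card_key_set by simp
  ultimately show ?thesis using D(1) by blast
qed

end

section \<open>Linear straight line programs\<close>

lemma produces_unique: "produces G v x \<Longrightarrow> produces G v y \<Longrightarrow> x = y"
proof (induction arbitrary: y rule: produces.induct)
  case (leaf v a)
  from leaf(2) show ?case by cases (use leaf(1) in simp_all)
next
  case (node v us xs)
  from node.prems show ?case
  proof cases
    case (node us' ys)
    then have "list_all2 (produces G) us ys" "y = concat ys" using \<open>rule_of G v = Nonterminal us\<close> by simp_all
    moreover have "xs = ys" if "list_all2 (produces G) us ys" for ys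
      using node.IH that
    proof (induction us arbitrary: xs ys)
      case (Cons u us)
      then show ?case by (auto simp: list_all2_Cons1)
    qed simp
    ultimately show ?thesis by simp
  qed (use node.hyps in simp)
qed

definition edges :: "grammar \<Rightarrow> (nat \<times> nat) set" where
  "edges G = {(v, u). v \<in> nodes G \<and> u \<in> set (children (rule_of G v))}"

text \<open>By acyclicity the root is not among these nodes, so each of them has a rule of the
  restricted form.\<close>

definition below_root :: "grammar \<Rightarrow> nat set" where
  "below_root G = {v. (root G, v) \<in> (edges G)\<^sup>+}"

lemma below_root_nodes: "linear_slp G \<Longrightarrow> below_root G \<subseteq> nodes G - {root G}"
proof -
  assume G: "linear_slp G"
  have "v \<in> nodes G" if "(root G, v) \<in> (edges G)\<^sup>+" for v
    using that G by (induction rule: trancl_induct) (auto simp: edges_def linear_slp_def dag_def)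
  moreover have "(root G, root G) \<notin> (edges G)\<^sup>+"
    using G unfolding linear_slp_def dag_def acyclic_def edges_def by blast
  ultimately show ?thesis unfolding below_root_def by blast
qed

text \<open>The right child contributes one character, so a proper prefix is already a prefix of the
  string of the left child. All non-empty prefixes of pieces are therefore strings of nodes, which
  bounds their number by that of the nodes.\<close>

lemma produces_prefix:
  assumes "linear_slp G"
  shows "produces G v x \<Longrightarrow> v \<in> below_root G \<Longrightarrow>
    x \<noteq> [] \<and> (\<forall>e. 1 \<le> e \<and> e \<le> length x \<longrightarrow> (\<exists>u\<in>below_root G. produces G u (take e x)))"
proof (induction rule: produces.induct)
  case (leaf v a)
  then show ?case using produces.leaf[OF leaf(1)] by (auto simp: le_Suc_eq)
next
  case (node v us xs)
  have v: "v \<in> nodes G" "v \<noteq> root G" using below_root_nodes[OF assms] node.prems by auto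
  then have "(\<exists>a. rule_of G v = Terminal a) \<or>
      (\<exists>l r a. rule_of G v = Nonterminal [l, r] \<and> rule_of G r = Terminal a)"
    using assms unfolding linear_slp_def by blast
  then obtain l r a where us: "us = [l, r]" and r: "rule_of G r = Terminal a"
    using node.hyps by auto
  obtain y z where xs: "xs = [y, z]" "produces G l y" "produces G r z"
    and IH: "l \<in> below_root G \<Longrightarrow> y \<noteq> [] \<and>
      (\<forall>e. 1 \<le> e \<and> e \<le> length y \<longrightarrow> (\<exists>u\<in>below_root G. produces G u (take e y)))"
    using node.IH unfolding us by (auto simp: list_all2_Cons1)
  have z: "z = [a]" using produces_unique[OF xs(3) produces.leaf[OF r]] .
  have "(v, l) \<in> edges G" using v node.hyps us by (simp add: edges_def)
  then have l: "l \<in> below_root G" using node.prems unfolding below_root_def by (auto intro: trancl_into_trancl)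
  have prod: "produces G v (concat xs)"
    by (rule produces.node[OF node.hyps(1)]) (simp add: us xs list_all2_Cons1)
  have "\<exists>u\<in>below_root G. produces G u (take e (concat xs))" if e: "1 \<le> e" "e \<le> length (concat xs)" for e
  proof (cases "e \<le> length y")
    case True
    then show ?thesis using IH[OF l] e xs(1) by simp
  next
    case False
    then have "take e (concat xs) = concat xs" using e xs(1) z by simp
    then show ?thesis using prod node.prems by auto
  qed
  then show ?case using xs(1) z by simp
qed

lemma linear_slp_pieces:
  assumes G: "linear_slp G" and S: "produces G (root G) S"
  obtains xs where "S = concat xs" "xs \<noteq> []" "\<And>x. x \<in> set xs \<Longrightarrow> x \<noteq> []"
    "length xs + card (\<Union>x\<in>set xs. (\<lambda>e. take e x) ` {..length x}) \<le> 4 * size_slp G"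
proof -
  have fin: "finite (nodes G)" and root: "root G \<in> nodes G" using G by (auto simp: linear_slp_def dag_def)
  have card1: "1 \<le> card (nodes G)" using fin root by (auto simp: Suc_le_eq card_gt_0_iff)
  from S show ?thesis
  proof cases
    case (leaf a)
    have "(\<Union>x\<in>set [[a]]. (\<lambda>e. take e x) ` {..length x}) \<subseteq> {[], [a]}" by (auto simp: take_Cons')
    then have "card (\<Union>x\<in>set [[a]]. (\<lambda>e. take e x) ` {..length x}) \<le> card {[], [a]}"
      by (intro card_mono) simp_all
    then show ?thesis using leaf card1 by (intro that[of "[[a]]"]) (auto simp: size_slp_def)
  next
    case (node us xs)
    have us: "2 \<le> length us" using G node(2) by (auto simp: linear_slp_def)
    have len: "length xs = length us" using node(3) by (simp add: list_all2_lengthD)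
    have below: "set us \<subseteq> below_root G"
      using root node(2) by (auto simp: below_root_def edges_def)
    have piece: "\<exists>u\<in>below_root G. produces G u x" if "x \<in> set xs" for x
    proof -
      obtain i where i: "i < length us" "x = xs ! i" using \<open>x \<in> set xs\<close> len by (auto simp: in_set_conv_nth)
      then have "produces G (us ! i) x" using node(3) by (simp add: list_all2_conv_all_nth)
      moreover have "us ! i \<in> below_root G" using below i(1) nth_mem by blast
      ultimately show ?thesis by blast
    qed
    have nonempty: "x \<noteq> []" if "x \<in> set xs" for x
      using piece[OF that] produces_prefix[OF G] by blast
    have "(\<Union>x\<in>set xs. (\<lambda>e. take e x) ` {..length x}) \<subseteq> insert [] ((\<lambda>u. THE s. produces G u s) ` below_root G)"
    proof
      fix s assume "s \<in> (\<Union>x\<in>set xs. (\<lambda>e. take e x) ` {..length x})"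
      then obtain x e where x: "x \<in> set xs" "e \<le> length x" "s = take e x" by auto
      show "s \<in> insert [] ((\<lambda>u. THE s. produces G u s) ` below_root G)"
      proof (cases "e = 0")
        case False
        then obtain u where u: "u \<in> below_root G" "produces G u s"
          using piece[OF x(1)] produces_prefix[OF G] x(2,3) by (metis One_nat_def Suc_leI neq0_conv)
        then have "(THE s. produces G u s) = s" using produces_unique by blast
        then show ?thesis using u(1) by (metis image_eqI insertI2)
      qed (use x(3) in simp)
    qed
    moreover have fin_below: "finite (below_root G)" "card (below_root G) \<le> card (nodes G)"
      using below_root_nodes[OF G] fin by (auto intro: card_mono finite_subset)
    ultimately have "card (\<Union>x\<in>set xs. (\<lambda>e. take e x) ` {..length x}) \<le>
        card (insert [] ((\<lambda>u. THE s. produces G u s) ` below_root G))"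
      by (intro card_mono) simp_all
    also have "\<dots> \<le> Suc (card ((\<lambda>u. THE s. produces G u s) ` below_root G))"
      using fin_below by (simp add: card_insert_if)
    also have "\<dots> \<le> Suc (card (below_root G))" using card_image_le[OF fin_below(1)] by simp
    also have "\<dots> \<le> Suc (card (nodes G))" using fin_below(2) by simp
    finally have "card (\<Union>x\<in>set xs. (\<lambda>e. take e x) ` {..length x}) \<le> Suc (card (nodes G))" .
    \<comment> \<open>\<open>length xs\<close> is \<open>size_slp G - card (nodes G) + 2\<close> and
      there are at most \<open>card (nodes G) + 1\<close> prefixes, in sum at most
      \<open>size_slp G + 3\<close>.\<close>
    then have "length xs + card (\<Union>x\<in>set xs. (\<lambda>e. take e x) ` {..length x}) \<le> 4 * size_slp G"
      using node(2) len card1 by (simp add: size_slp_def)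
    moreover have "xs \<noteq> []" using us len by auto
    ultimately show ?thesis using that node(1) nonempty by blast
  qed
qed

text \<open>The key length has to be a power of two for the binary searches. Lowering
  \<open>n\<close> by one takes a square root of \<open>2 ^ (2 ^ n)\<close>, so the least suitable
  \<open>n\<close> overshoots the square of \<open>N + 2\<close> by at most another square. The
  fourth power is what a prime of the size of \<open>p\<close> can still cover.\<close>

lemma levels_exist:
  fixes N :: nat
  obtains n where "(N + 2)\<^sup>2 \<le> 2 ^ (2 ^ n)" "2 ^ (2 ^ n) < (N + 2) ^ 4"
    "real n \<le> 2 + log 2 (log 2 (real N + 2))"
proof -
  define n where "n = (LEAST n. (N + 2)\<^sup>2 \<le> 2 ^ (2 ^ n :: nat))"
  have "(N + 2)\<^sup>2 < 2 ^ ((N + 2)\<^sup>2)" by (rule less_exp)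
  also have "\<dots> \<le> 2 ^ (2 ^ ((N + 2)\<^sup>2))" by (intro power_increasing less_imp_le less_exp) simp
  finally have "\<exists>n. (N + 2)\<^sup>2 \<le> 2 ^ (2 ^ n :: nat)" by (blast intro: less_imp_le)
  then have 1: "(N + 2)\<^sup>2 \<le> 2 ^ (2 ^ n)" unfolding n_def by (rule LeastI_ex)
  have "n \<noteq> 0"
  proof
    assume "n = 0"
    then show False using 1 by (simp add: power2_eq_square)
  qed
  then obtain m where m: "n = Suc m" by (cases n) auto
  then have "\<not> (N + 2)\<^sup>2 \<le> 2 ^ (2 ^ m :: nat)" using not_less_Least[of m "\<lambda>n. (N + 2)\<^sup>2 \<le> 2 ^ (2 ^ n :: nat)"]
    by (simp add: n_def)
  then have less: "(2 :: nat) ^ (2 ^ m) < (N + 2)\<^sup>2" by simp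
  have "(2 :: nat) ^ (2 ^ n) = (2 ^ (2 ^ m))\<^sup>2" by (simp add: m power_mult[symmetric] mult.commute)
  also have "\<dots> < ((N + 2)\<^sup>2)\<^sup>2" using less by (intro power_strict_mono) simp_all
  also have "\<dots> = (N + 2) ^ 4" by (simp flip: power_mult)
  finally have 2: "(2 :: nat) ^ (2 ^ n) < (N + 2) ^ 4" .
  let ?l = "log 2 (real N + 2)"
  have l: "1 \<le> ?l" by simp
  have "real (2 ^ (2 ^ m)) < real ((N + 2)\<^sup>2)" using less by (simp only: of_nat_less_iff)
  then have "(2 :: real) ^ (2 ^ m) < (real N + 2)\<^sup>2" by (simp add: add.commute)
  then have "log 2 (2 ^ (2 ^ m)) < log 2 ((real N + 2)\<^sup>2)" by (subst log_less_cancel_iff) simp_all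
  then have "2 ^ m < 2 * ?l" by (simp add: log_nat_power)
  then have "log 2 (2 ^ m) \<le> log 2 (2 * ?l)" using l by (subst log_le_cancel_iff) simp_all
  then have "real m \<le> 1 + log 2 ?l" using l by (simp add: log_mult)
  then have "real n \<le> 2 + log 2 ?l" using m by simp
  then show ?thesis using that 1 2 by blast
qed

text \<open>\<open>5 * (N + 2) \<le> 7 * N\<close> from \<open>N = 5\<close> on, and
  \<open>7 ^ 4 = 2401\<close> is at most \<open>5 * 5 ^ 4 = 3125\<close>.\<close>

lemma power4_le_power5:
  assumes "5 \<le> (N :: nat)"
  shows "(N + 2) ^ 4 \<le> N ^ 5"
proof -
  have "(5 * (N + 2)) ^ 4 \<le> (7 * N) ^ 4" using assms by (intro power_mono) simp_all
  then have "625 * (N + 2) ^ 4 \<le> 2401 * N ^ 4" by (simp only: power_mult_distrib) simp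
  also have "\<dots> \<le> 625 * (5 * N ^ 4)" by simp
  also have "\<dots> \<le> 625 * (N * N ^ 4)" using assms by (intro mult_le_mono2 mult_le_mono1)
  finally have "(N + 2) ^ 4 \<le> N * N ^ 4" by simp
  also have "\<dots> = N ^ 5" using power_Suc[of N 4] by simp
  finally show ?thesis .
qed

text \<open>The least prime above \<open>2 * 6 ^ 4 = 2592\<close>. As \<open>51 * 51 = 2601\<close>,
  a proper factorisation would have a factor of at most \<open>50\<close>.\<close>

lemma prime_2593: "prime (2593 :: nat)"
proof (rule prime_nat_naiveI)
  fix m :: nat assume "m dvd 2593"
  then obtain k where mk: "2593 = m * k" by (elim dvdE)
  have no: "\<forall>m\<in>set [2..<51]. 2593 mod m \<noteq> (0 :: nat)" by (simp add: upt_rec_numeral)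
  have "2593 mod m = 0" "2593 mod k = 0" unfolding mk by simp_all
  then have not_in: "m \<notin> set [2..<51]" "k \<notin> set [2..<51]"
    using bspec[OF no, of m] bspec[OF no, of k] by (simp_all only: not_True_eq_False simp_thms) argo+
  have "m \<noteq> 0" by (rule notI) (use mk in simp)
  moreover have "k \<noteq> 0" by (rule notI) (use mk in simp)
  moreover have "\<not> (51 \<le> m \<and> 51 \<le> k)" using mult_le_mono[of 51 m 51 k] mk by linarith
  ultimately have "m = 1 \<or> k = 1" using not_in unfolding set_upt atLeastLessThan_iff by linarith
  then show "m = 1 \<or> m = 2593" using mk by (elim disjE) simp_all
qed simp

text \<open>The prime \<open>p\<close> serves for hashing unless \<open>N\<close> is very small.\<close>

lemma hash_prime_exists:
  assumes "0 < c" "prime p" "2 * N ^ (c + 4) \<le> p" "2 * (p * p) < 2 ^ w"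
    and w: "2 ^ 30 * (N + 1) ^ 10 \<le> (2 :: nat) ^ w" and V: "V < (N + 2) ^ 4"
  shows "\<exists>q. prime q \<and> 2 * V \<le> q \<and> q * q < 2 ^ w"
proof (cases "5 \<le> N")
  case True
  \<comment> \<open>As \<open>c\<close> is positive, the exponent in the lower bound on
    \<open>p\<close> is at least \<open>5\<close>.\<close>
  have "N ^ 5 \<le> N ^ (c + 4)" using True assms(1) by (intro power_increasing) auto
  then have "2 * V \<le> p" using V power4_le_power5[OF True] assms(3) by linarith
  then show ?thesis using assms(2,4) by (intro exI[of _ p]) simp
next
  case False
  then have "(N + 2) ^ 4 \<le> 6 ^ 4" by (intro power_mono) simp_all
  then have "2 * V \<le> 2593" using V by simp
  moreover have "(2593 :: nat) * 2593 < 2 ^ w" using word_bound_linear[OF w] by simp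
  ultimately show ?thesis using prime_2593 by blast
qed

lemma length_le_length_concat: "(\<And>x. x \<in> set xs \<Longrightarrow> x \<noteq> []) \<Longrightarrow> length xs \<le> length (concat xs)"
proof (induction xs)
  case (Cons x xs)
  then have "1 \<le> length x" "length xs \<le> length (concat xs)" by (auto simp: Suc_le_eq)
  then show ?case by simp
qed simp

theorem linear_slp_fingerprint_structure:
  "fingerprint_structure linear_slp (comp 0 (range_query string_lookup) @ [Halt]) 8
     (\<lambda>n. 116 * real n + 40) (\<lambda>N. 160 * log 2 (log 2 (real N + 2)) + 622)"
  unfolding fingerprint_structure_def
proof (intro allI impI, elim conjE)
  fix G S N c p w
  assume G: "linear_slp G" and S: "produces G (root G) S" and N: "N = length S" and c: "0 < c"
    and pp: "prime p" "2 * N ^ (c + 4) \<le> p" "p \<le> 4 * N ^ (c + 4)"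
    and w: "w = 8 * ((c + 4) * bits N)"
  obtain xs where xs: "S = concat xs" "xs \<noteq> []" "\<And>x. x \<in> set xs \<Longrightarrow> x \<noteq> []"
    "length xs + card (\<Union>x\<in>set xs. (\<lambda>e. take e x) ` {..length x}) \<le> 4 * size_slp G"
    using linear_slp_pieces[OF G S] by blast
  have "length xs \<le> N" using length_le_length_concat[OF xs(3)] xs(1) N by simp
  moreover have "1 \<le> length xs" using xs(2) by (cases xs) simp_all
  ultimately have N1: "1 \<le> N" by (rule order_trans[rotated])
  note bounds = word_bounds[OF N1 c pp(3) w]
  have lin: "2 ^ 30 * (N + 1) \<le> (2 :: nat) ^ w" by (rule word_bound_linear[OF bounds(2)])
  have p1: "1 < p" using pp(1) by (rule prime_gt_1_nat)
  have size1: "1 \<le> size_slp G"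
    using G by (auto simp: linear_slp_def dag_def size_slp_def Suc_le_eq card_gt_0_iff)
  obtain ys c' d where ys: "length (concat ys) = N" "ys \<noteq> []" "\<And>x. x \<in> set ys \<Longrightarrow> x \<noteq> []"
    "length ys + card (\<Union>x\<in>set ys. (\<lambda>e. take e x) ` {..length x}) \<le> 4 * size_slp G"
    "[c' * d = 1] (mod p)"
    and *: "\<And>D T. supports_fingerprint w (comp 0 (range_query string_lookup) @ [Halt]) D c' p (concat ys) T \<Longrightarrow>
       supports_fingerprint w (comp 0 (range_query string_lookup) @ [Halt]) D c p S T"
  proof (cases "p dvd c")
    case True
    then have N: "N = 1" "length S = 1" using prime_not_dvd[OF c pp(2)] N1 N by linarith+
    have "(\<Union>x\<in>set [[0 :: nat]]. (\<lambda>e. take e x) ` {..length x}) \<subseteq> {[], [0]}" by (auto simp: take_Cons')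
    then have "card (\<Union>x\<in>set [[0 :: nat]]. (\<lambda>e. take e x) ` {..length x}) \<le> card {[], [0 :: nat]}"
      by (intro card_mono) simp_all
    then show ?thesis
      using supports_fingerprint_zero[OF True] N size1 by (intro that[of "[[0]]" 1 1]) auto
  next
    case False
    then obtain d where "[c * d = 1] (mod p)" using inverse_exists pp(1) by blast
    then show ?thesis using xs N by (intro that[of xs c d]) auto
  qed
  interpret string_pieces ys c' d p using ys p1 by unfold_locales auto
  obtain n where n: "(N + 2)\<^sup>2 \<le> 2 ^ (2 ^ n)" "2 ^ (2 ^ n) < (N + 2) ^ 4"
    "real n \<le> 2 + log 2 (log 2 (real N + 2))"
    using levels_exist by blast
  obtain q :: nat where q: "prime q" "2 * 2 ^ (2 ^ n) \<le> q" "q * q < 2 ^ w"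
    using hash_prime_exists[OF c pp(1,2) bounds n(2)] by blast
  have space: "length ys + R \<le> 4 * size_slp G" using ys(4) by (simp add: R_def prefixes_def)
  have "length ys \<le> length (concat ys)" using ys(3) by (rule length_le_length_concat)
  then have "length ys \<le> N" "R \<le> N + 1" using card_prefixes_le ys(1) by simp_all
  then have words: "29 * (length ys + R) + 40 < 2 ^ w" using lin by simp
  have squared: "(length (concat ys) + 2)\<^sup>2 \<le> 2 ^ (2 ^ n)" using n(1) by (simp only: ys(1))
  obtain D where D: "\<forall>x\<in>set D. x < 2 ^ w" "length D \<le> 29 * (length ys + R) + 40"
    "supports_fingerprint w (comp 0 (range_query string_lookup) @ [Halt]) D c' p (concat ys) (real (160 * n + 302))"
    using string_query_answers[OF refl squared q bounds(1) words] by blast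
  \<comment> \<open>\<open>622\<close> is \<open>302\<close> plus \<open>160\<close> times the
    \<open>2\<close> in the bound on \<open>n\<close>.\<close>
  have "real (160 * n + 302) \<le> 160 * log 2 (log 2 (real N + 2)) + 622" using n(3) by simp
  then have "supports_fingerprint w (comp 0 (range_query string_lookup) @ [Halt]) D c p S
      (160 * log 2 (log 2 (real N + 2)) + 622)"
    using * D(3) supports_fingerprint_mono by blast
  moreover have "length D \<le> 116 * size_slp G + 40" using D(2) space by simp
  then have "real (length D) \<le> 116 * real (size_slp G) + 40" by linarith
  ultimately show "\<exists>D. (\<forall>x\<in>set D. x < 2 ^ w) \<and> real (length D) \<le> 116 * real (size_slp G) + 40 \<and>
     supports_fingerprint w (comp 0 (range_query string_lookup) @ [Halt]) D c p S (160 * log 2 (log 2 (real N + 2)) + 622)"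
    using D(1) by blast
qed

theorem theorem1:
  shows "(\<exists>P \<kappa> space time.
            space \<in> O(\<lambda>n. real n) \<and>
            time \<in> O(\<lambda>N. log 2 (real N)) \<and>
            fingerprint_structure slp P \<kappa> space time) \<and>
         (\<exists>P \<kappa> space time.
            space \<in> O(\<lambda>n. real n) \<and>
            time \<in> O(\<lambda>N. log 2 (log 2 (real N))) \<and>
            fingerprint_structure linear_slp P \<kappa> space time)"
proof (intro conjI exI)
  show "fingerprint_structure slp (comp 0 (range_query descend_query) @ [Halt]) 8
     (\<lambda>n. 18 * real n + 56) (\<lambda>N. 336 * log 2 (real N + 1) + 28)"
    by (rule slp_fingerprint_structure)
  show "fingerprint_structure linear_slp (comp 0 (range_query string_lookup) @ [Halt]) 8
     (\<lambda>n. 116 * real n + 40) (\<lambda>N. 160 * log 2 (log 2 (real N + 2)) + 622)"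
    by (rule linear_slp_fingerprint_structure)
qed real_asymp+

end
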